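(* Let $G$, $H_0$, $V=vUv^*$, $H=H_0+V$, $R(\kappa)=(H+\kappa^2)^{-1}$ be as in the context, and assume that $V$ satisfies the assumption $(\mathrm A_\beta)$ of the context for some integer $\beta\ge4$. Assume that the threshold $0$ is an exceptional point of the second kind, i.e. $\mathcal E=\mathsf E\supsetneq\{0\}$. Let $G_j$ be the coefficients in the asymptotic expansion $R(\kappa)=\sum_{j=-2}^{\beta-6}\kappa^jG_j+\mathcal O(\kappa^{\beta-5})$ in $\mathcal B^{\beta-2}$ as $\kappa\to0$, $\mathop{\mathrm{Re}}\kappa>0$. Then (each formula being asserted when the coefficient occurs in the expansion) $$G_0=(I-\mathsf P)\bigl(G_{0,0}-G_{0,0}vM_0^\dagger v^*G_{0,0}\bigr)(I-\mathsf P),\qquad G_1=-\widetilde{\mathcal P},$$ where $\widetilde{\mathcal P}$ is the orthogonal non-resonance projection, which is uniquely determined (independent of the choice of orthonormal non-resonance basis) because $\mathcal E/\mathsf E=\{0\}$.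
   Context: Graph. Let $(K,E_0)$ be a connected, finite, undirected, simple graph (no loops, no multiple edges), and for $\alpha=1,\dots,N$ let $(L_\alpha,E_\alpha)$ be a copy of the discrete half-line, $L_\alpha=\{1,2,\dots\}$, $E_\alpha=\{\{n,n+1\}: n\in L_\alpha\}$. Fix vertices $x_1,\dots,x_N\in K$ (not necessarily distinct). Let $G=K\cup L_1\cup\dots\cup L_N$ (disjoint union), with edges those of $E_0,E_1,\dots,E_N$ together with $\{x_\alpha,1^{(\alpha)}\}$, $\alpha=1,\dots,N$, where $1^{(\alpha)}$ is the point $1\in L_\alpha$. Free operator. For $u\colon K\to\mathbb C$ set $(h_0u)[x]=\sum_{y\in K,\{x,y\}\in E_0}(u[x]-u[y])+\sum_{\alpha=1}^Ns_\alpha[x]u[x]$, where $s_\alpha[x]=1$ if $x=x_\alpha$ and $0$ otherwise. For $u\colon L_\alpha\to\mathbb C$ set $(h_\alpha u)[1]=2u[1]-u[2]$ and $(h_\alpha u)[n]=2u[n]-u[n+1]-u[n-1]$ for $n\ge2$. Let $H_0=h_0\oplus h_1\oplus\dots\oplus h_N$, acting on all functions on $G$ decomposed as functions on $K,L_1,\dots,L_N$; on $\mathcal H=\ell^2(G)$ it is bounded and self-adjoint. The operator $h_0$ is invertible. Spaces. For $s\in\mathbb R$, $\mathcal L^s=\ell^{1,s}(G)$ is the space of $u\colon G\to\mathbb C$ with $\sum_{x\in K}|u[x]|+\sum_{\alpha}\sum_{n\in L_\alpha}(1+n^2)^{s/2}|u[n]|<\infty$; its dual $(\mathcal L^s)^*=\ell^{\infty,-s}(G)$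 is the space of $u$ with $\sup_{x\in K}|u[x]|<\infty$ and $\sup_{n\in L_\alpha}(1+n^2)^{-s/2}|u[n]|<\infty$ for all $\alpha$. Put $\mathcal B^s=\mathcal B(\mathcal L^s,(\mathcal L^s)^* )$. $\langle u,w\rangle=\sum_{x\in G}\overline{u[x]}w[x]$ whenever this converges absolutely, and $|\Psi\rangle\langle\Phi|$ is the operator $u\mapsto\langle\Phi,u\rangle\Psi$. $(\Phi\cdot\Psi)[x]=\Phi[x]\Psi[x]$ is the pointwise product. Assumption $(\mathrm A_\beta)$, $\beta\ge1$: $V\in\mathcal B(\mathcal H)$ is self-adjoint, and there exist a Hilbert space $\mathcal K$, an injective operator $v\in\mathcal B(\mathcal K,\mathcal L^\beta)$ and a self-adjoint unitary operator $U\in\mathcal B(\mathcal K)$ such that $V=vUv^*\in\mathcal B((\mathcal L^\beta)^*,\mathcal L^\beta)$; such $\mathcal K,v,U$ are fixed. Put $H=H_0+V$ and $R(\kappa)=(H+\kappa^2)^{-1}$ for $-\kappa^2\notin\sigma(H)$. Operators. $G_{0,0}=g_{0,0}\oplus g_{1,0}\oplus\dots\oplus g_{N,0}$, where $g_{0,0}=h_0^{-1}$ on functions on $K$ and, for $\alpha\ge1$, $g_{\alpha,0}$ has kernel $g_{\alpha,0}[n,m]=\min\{n,m\}$ on $L_\alpha$. $M_0=U+v^*G_{0,0}v\in\mathcal B(\mathcal K)$ (self-adjoint), and $M_0^\dagger$ is its pseudo-inverse: zero on $\mathop{\mathrm{Ker}}M_0$ and the inverse of $M_0|_{(\mathop{\mathrm{Ker}}M_0)^\perp}$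 on $(\mathop{\mathrm{Ker}}M_0)^\perp$. Eigenspaces. Let $\mathbf n^{(\alpha)}[x]=m$ if $x=m\in L_\alpha$ and $0$ otherwise; $\mathbf 1^{(\alpha)}[x]=1$ if $x\in L_\alpha$ and $0$ otherwise; $\mathbb C\mathbf n=\bigoplus_\alpha\mathbb C\mathbf n^{(\alpha)}$, $\mathbb C\mathbf 1=\bigoplus_\alpha\mathbb C\mathbf 1^{(\alpha)}$. Define $\widetilde{\mathcal E}=\{\Psi\in(\mathcal L^\beta)^*: H\Psi=0\}$, $\mathcal E=\widetilde{\mathcal E}\cap(\mathbb C\mathbf 1\oplus\mathcal L^{\beta-2})$, $\mathsf E=\widetilde{\mathcal E}\cap\mathcal L^{\beta-2}$. Projections. A basis $\{\Psi_\gamma\}$ of $\mathsf E$ is an orthonormal bound basis if $\overline{\Psi_{\gamma'}}\cdot\Psi_\gamma\in\mathcal L^0$ and $\langle\Psi_{\gamma'},\Psi_\gamma\rangle=\delta_{\gamma\gamma'}$ for all $\gamma,\gamma'$; the orthogonal bound projection is $\mathsf P=\sum_\gamma|\Psi_\gamma\rangle\langle\Psi_\gamma|$ (independent of the choice of basis). A set $\{\Psi_\gamma\}\subset\widetilde{\mathcal E}$ is an orthonormal non-resonance basis if the classes $[\Psi_\gamma]$ form a basis of $\widetilde{\mathcal E}/\mathcal E$, for every $\gamma$ and every $\Psi\in\mathsf E$ one has $\overline\Psi\cdot\Psi_\gamma\in\mathcal L^0$ and $\langle\Psi,\Psi_\gamma\rangle=0$, and there is an orthonormal system $\{c^{(\gamma)}\}\subset\mathbb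 C^N$ such that $\Psi_\gamma-\sum_\alpha c_\alpha^{(\gamma)}\mathbf n^{(\alpha)}\in\mathbb C\mathbf 1\oplus\mathcal L^{\beta-2}$ for every $\gamma$. The associated orthogonal non-resonance projection is $\widetilde{\mathcal P}=\sum_\gamma|\Psi_\gamma\rangle\langle\Psi_\gamma|$. *)

theory Defs
  imports "HOL-Analysis.Analysis" "HOL-Library.Function_Algebras"
begin

section \<open>Complex vector spaces and complex Hilbert spaces\<close>

class complex_vector = ab_group_add +
  fixes scaleC :: "complex \<Rightarrow> 'a \<Rightarrow> 'a"
  assumes scaleC_add_right: "scaleC c (x + y) = scaleC c x + scaleC c y"
    and scaleC_add_left: "scaleC (c + d) x = scaleC c x + scaleC d x"
    and scaleC_scaleC: "scaleC c (scaleC d x) = scaleC (c * d) x"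
    and scaleC_one: "scaleC 1 x = x"

global_interpretation complex_vector: vector_space "scaleC :: complex \<Rightarrow> 'a \<Rightarrow> 'a::complex_vector"
  by unfold_locales (rule scaleC_add_right scaleC_add_left scaleC_scaleC scaleC_one)+

instantiation complex :: complex_vector
begin
definition scaleC_complex :: "complex \<Rightarrow> complex \<Rightarrow> complex" where
  "scaleC_complex c z = c * z"
instance by standard (simp_all add: scaleC_complex_def algebra_simps)
end

instantiation "fun" :: (type, complex_vector) complex_vector
begin
definition scaleC_fun :: "complex \<Rightarrow> ('a \<Rightarrow> 'b) \<Rightarrow> 'a \<Rightarrow> 'b" where
  "scaleC_fun c f = (\<lambda>x. scaleC c (f x))"
instance
  by standard
    (simp_all add: scaleC_fun_def fun_eq_iff scaleC_add_right scaleC_add_left scaleC_scaleC scaleC_one)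
end

text \<open>Inner products are antilinear in the first argument. Norm, topology, positivity and
  definiteness come from the underlying real Hilbert space through the last axiom.\<close>

class complex_hilbert_space = real_inner + complete_space + complex_vector +
  fixes cinner :: "'a \<Rightarrow> 'a \<Rightarrow> complex"
  assumes scaleR_scaleC: "scaleR r x = scaleC (complex_of_real r) x"
    and cinner_commute: "cinner x y = cnj (cinner y x)"
    and cinner_add_right: "cinner x (y + z) = cinner x y + cinner x z"
    and cinner_scaleC_right: "cinner x (scaleC c y) = c * cinner x y"
    and Re_cinner: "Re (cinner x y) = inner x y"

instantiation complex :: complex_hilbert_space
begin
definition cinner_complex :: "complex \<Rightarrow> complex \<Rightarrow> complex" where
  "cinner_complex z w = cnj z * w"
instance
  by standard
    (simp_all add: scaleC_complex_def cinner_complex_def scaleR_conv_of_real inner_complex_def algebra_simps)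
end

text \<open>\<open>T \<in> \<B>(X, Y)\<close>, where \<open>X\<close> and \<open>Y\<close> are the linear subspaces carrying the norms
  \<open>p\<close> and \<open>q\<close>; the values of \<open>T\<close> outside \<open>X\<close> are irrelevant.\<close>

definition bounded_operator ::
  "'x::complex_vector set \<Rightarrow> ('x \<Rightarrow> real) \<Rightarrow> 'y::complex_vector set \<Rightarrow> ('y \<Rightarrow> real) \<Rightarrow> ('x \<Rightarrow> 'y) \<Rightarrow> bool"
  where "bounded_operator X p Y q T \<longleftrightarrow>
    (\<forall>u\<in>X. T u \<in> Y) \<and>
    (\<forall>u\<in>X. \<forall>w\<in>X. T (u + w) = T u + T w) \<and>
    (\<forall>c. \<forall>u\<in>X. T (scaleC c u) = scaleC c (T u)) \<and>
    (\<exists>C. \<forall>u\<in>X. q (T u) \<le> C * p u)"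

definition selfadjoint_op :: "('k::complex_hilbert_space \<Rightarrow> 'k) \<Rightarrow> bool" where
  "selfadjoint_op T \<longleftrightarrow> bounded_operator UNIV norm UNIV norm T \<and>
     (\<forall>f g. cinner (T f) g = cinner f (T g))"

definition unitary_op :: "('k::complex_hilbert_space \<Rightarrow> 'k) \<Rightarrow> bool" where
  "unitary_op T \<longleftrightarrow> bounded_operator UNIV norm UNIV norm T \<and> bij T \<and>
     (\<forall>f g. cinner (T f) (T g) = cinner f g)"

definition kernel_op :: "('k::complex_hilbert_space \<Rightarrow> 'k) \<Rightarrow> 'k set" where
  "kernel_op T = {f. T f = 0}"

definition orth_compl :: "'k::complex_hilbert_space set \<Rightarrow> 'k set" where
  "orth_compl W = {f. \<forall>g\<in>W. cinner g f = 0}"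

text \<open>The value at \<open>f\<close> is the element of \<open>(Ker T)\<^sup>\<bottom>\<close> that \<open>T\<close> maps to the
  \<open>(Ker T)\<^sup>\<bottom>\<close>-component of \<open>f\<close>. It is used only for self-adjoint \<open>T\<close> that is boundedly
  invertible on \<open>(Ker T)\<^sup>\<bottom>\<close>.\<close>

definition pseudo_inverse :: "('k::complex_hilbert_space \<Rightarrow> 'k) \<Rightarrow> 'k \<Rightarrow> 'k" where
  "pseudo_inverse T f = (THE g. g \<in> orth_compl (kernel_op T) \<and>
     T g \<in> orth_compl (kernel_op T) \<and> f - T g \<in> kernel_op T)"


section \<open>The graph and function spaces on it\<close>

definition connected_simple_graph :: "'a set set \<Rightarrow> bool" where
  "connected_simple_graph E \<longleftrightarrow>
     (\<forall>e\<in>E. card e = 2) \<and> (\<forall>x y. (x, y) \<in> {(x, y). {x, y} \<in> E}\<^sup>*)"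

text \<open>Vertex set of the graph: the finite type \<open>'a\<close> is \<open>K\<close> and the finite type \<open>'n\<close> indexes
  the half-lines. Half-lines start at \<open>1\<close>, so \<open>Ray \<alpha> k\<close> is the point \<open>n = k + 1\<close>
  of \<open>L\<^sub>\<alpha>\<close>.\<close>

datatype ('a, 'n) vertex = Core 'a | Ray 'n nat

type_synonym ('a, 'n) gfun = "('a, 'n) vertex \<Rightarrow> complex"

fun weight :: "real \<Rightarrow> ('a, 'n) vertex \<Rightarrow> real" where
  "weight s (Core x) = 1"
| "weight s (Ray \<alpha> k) = (1 + (real (Suc k))\<^sup>2) powr (s / 2)"

text \<open>\<open>Lsp s\<close> is \<open>\<L>\<^sup>s = \<ell>\<^sup>1\<^sup>,\<^sup>s(G)\<close>, and \<open>Ldual s\<close> is its dual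
  \<open>(\<L>\<^sup>s)\<^sup>* = \<ell>\<^sup>\<infinity>\<^sup>,\<^sup>-\<^sup>s(G)\<close>.\<close>

definition Lsp :: "real \<Rightarrow> ('a, 'n) gfun set" where
  "Lsp s = {u. (\<lambda>y. weight s y * cmod (u y)) summable_on UNIV}"

definition Lnorm :: "real \<Rightarrow> ('a, 'n) gfun \<Rightarrow> real" where
  "Lnorm s u = (\<Sum>\<^sub>\<infinity>y. weight s y * cmod (u y))"

definition Ldual :: "real \<Rightarrow> ('a, 'n) gfun set" where
  "Ldual s = {u. bdd_above (range (\<lambda>y. weight (- s) y * cmod (u y)))}"

definition Ldual_norm :: "real \<Rightarrow> ('a, 'n) gfun \<Rightarrow> real" where
  "Ldual_norm s u = (SUP y. weight (- s) y * cmod (u y))"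

definition ell2 :: "('a, 'n) gfun set" where
  "ell2 = {u. (\<lambda>y. (cmod (u y))\<^sup>2) summable_on UNIV}"

definition ell2_norm :: "('a, 'n) gfun \<Rightarrow> real" where
  "ell2_norm u = sqrt (\<Sum>\<^sub>\<infinity>y. (cmod (u y))\<^sup>2)"

text \<open>Summability of complex families is absolute; otherwise the value is \<open>0\<close>.\<close>

definition pairing :: "('a, 'n) gfun \<Rightarrow> ('a, 'n) gfun \<Rightarrow> complex" where
  "pairing u w = (\<Sum>\<^sub>\<infinity>y. cnj (u y) * w y)"

definition ket_bra :: "('a, 'n) gfun \<Rightarrow> ('a, 'n) gfun \<Rightarrow> ('a, 'n) gfun \<Rightarrow> ('a, 'n) gfun" where
  "ket_bra \<Psi> \<Phi> u = scaleC (pairing \<Phi> u) \<Psi>"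

text \<open>The adjoint \<open>v\<^sup>* : (\<L>\<^sup>\<beta>)\<^sup>* \<rightarrow> \<K>\<close> of \<open>v : \<K> \<rightarrow> \<L>\<^sup>\<beta>\<close>,
  well defined on \<open>Ldual \<beta>\<close> by the Riesz representation theorem.\<close>

definition adj :: "('k::complex_hilbert_space \<Rightarrow> ('a, 'n) gfun) \<Rightarrow> ('a, 'n) gfun \<Rightarrow> 'k" where
  "adj v u = (THE f. \<forall>g. cinner f g = pairing u (v g))"


section \<open>Operators\<close>

definition h_core ::
  "'a::finite set set \<Rightarrow> ('n::finite \<Rightarrow> 'a) \<Rightarrow> ('a \<Rightarrow> complex) \<Rightarrow> 'a \<Rightarrow> complex" where
  "h_core E0 x0 u = (\<lambda>x. (\<Sum>y\<in>{y. {x, y} \<in> E0}. u x - u y) +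
     (\<Sum>\<alpha>\<in>UNIV. (if x = x0 \<alpha> then 1 else 0) * u x))"

fun h_ray :: "(nat \<Rightarrow> complex) \<Rightarrow> nat \<Rightarrow> complex" where
  "h_ray u 0 = 2 * u 0 - u 1"
| "h_ray u (Suc k) = 2 * u (Suc k) - u (Suc (Suc k)) - u k"

text \<open>The direct sum of the operators on \<open>K\<close> and on the half-lines: the edges joining
  \<open>K\<close> to the half-lines contribute only their diagonal terms.\<close>

fun free_op ::
  "'a::finite set set \<Rightarrow> ('n::finite \<Rightarrow> 'a) \<Rightarrow> ('a, 'n) gfun \<Rightarrow> ('a, 'n) gfun" where
  "free_op E0 x0 u (Core x) = h_core E0 x0 (\<lambda>y. u (Core y)) x"
| "free_op E0 x0 u (Ray \<alpha> k) = h_ray (\<lambda>m. u (Ray \<alpha> m)) k"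

definition full_op ::
  "'a::finite set set \<Rightarrow> ('n::finite \<Rightarrow> 'a) \<Rightarrow> (('a, 'n) gfun \<Rightarrow> ('a, 'n) gfun)
    \<Rightarrow> ('a, 'n) gfun \<Rightarrow> ('a, 'n) gfun" where
  "full_op E0 x0 V u = free_op E0 x0 u + V u"

definition assumption_A ::
  "real \<Rightarrow> (('a::finite, 'n::finite) gfun \<Rightarrow> ('a, 'n) gfun)
    \<Rightarrow> ('k::complex_hilbert_space \<Rightarrow> ('a, 'n) gfun) \<Rightarrow> ('k \<Rightarrow> 'k) \<Rightarrow> bool" where
  "assumption_A \<beta> V v U \<longleftrightarrow>
     bounded_operator ell2 ell2_norm ell2 ell2_norm V \<and>
     (\<forall>u\<in>ell2. \<forall>w\<in>ell2. pairing (V u) w = pairing u (V w)) \<and>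
     bounded_operator UNIV norm (Lsp \<beta>) (Lnorm \<beta>) v \<and> inj v \<and>
     selfadjoint_op U \<and> unitary_op U \<and>
     (\<forall>u\<in>Ldual \<beta>. V u = v (U (adj v u))) \<and>
     bounded_operator (Ldual \<beta>) (Ldual_norm \<beta>) (Lsp \<beta>) (Lnorm \<beta>) V"

text \<open>Spectrum of, and resolvent \<open>(T + \<kappa>\<^sup>2)\<^sup>-\<^sup>1\<close> for, an operator \<open>T\<close> on \<open>ell2\<close>.\<close>

definition spectrum :: "(('a, 'n) gfun \<Rightarrow> ('a, 'n) gfun) \<Rightarrow> complex set" where
  "spectrum T = {z. \<not> (\<exists>S. bounded_operator ell2 ell2_norm ell2 ell2_norm S \<and>
     (\<forall>u\<in>ell2. S (T u - scaleC z u) = u \<and> T (S u) - scaleC z (S u) = u))}"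

definition resolvent ::
  "(('a, 'n) gfun \<Rightarrow> ('a, 'n) gfun) \<Rightarrow> complex \<Rightarrow> ('a, 'n) gfun \<Rightarrow> ('a, 'n) gfun" where
  "resolvent T \<kappa> = inv_into ell2 (\<lambda>u. T u + scaleC (\<kappa>\<^sup>2) u)"

text \<open>The coefficients \<open>C j\<close> satisfy
  \<open>resolvent T \<kappa> = (\<Sum>j=a..b. \<kappa>\<^sup>j C j) + \<O>(\<kappa>\<^sup>b\<^sup>+\<^sup>1)\<close> in
  \<open>\<B>\<^sup>s = \<B>(\<L>\<^sup>s, (\<L>\<^sup>s)\<^sup>*)\<close> as \<open>\<kappa> \<rightarrow> 0\<close>, \<open>Re \<kappa> > 0\<close>, where \<open>\<kappa>\<close>
  ranges over the points at which the resolvent is defined.\<close>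

definition resolvent_expansion ::
  "real \<Rightarrow> (('a, 'n) gfun \<Rightarrow> ('a, 'n) gfun) \<Rightarrow> int \<Rightarrow> int
    \<Rightarrow> (int \<Rightarrow> ('a, 'n) gfun \<Rightarrow> ('a, 'n) gfun) \<Rightarrow> bool" where
  "resolvent_expansion s T a b C \<longleftrightarrow>
     (\<forall>j\<in>{a..b}. bounded_operator (Lsp s) (Lnorm s) (Ldual s) (Ldual_norm s) (C j)) \<and>
     (\<exists>M. \<forall>\<^sub>F \<kappa> in at 0 within {\<kappa>. Re \<kappa> > 0 \<and> - \<kappa>\<^sup>2 \<notin> spectrum T}. \<forall>u\<in>Lsp s.
        Ldual_norm s (resolvent T \<kappa> u - (\<Sum>j\<in>{a..b}. scaleC (\<kappa> powi j) (C j u)))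
          \<le> M * cmod \<kappa> powi (b + 1) * Lnorm s u)"

fun G00 ::
  "'a::finite set set \<Rightarrow> ('n::finite \<Rightarrow> 'a) \<Rightarrow> ('a, 'n) gfun \<Rightarrow> ('a, 'n) gfun" where
  "G00 E0 x0 u (Core x) = inv (h_core E0 x0) (\<lambda>y. u (Core y)) x"
| "G00 E0 x0 u (Ray \<alpha> k) = (\<Sum>\<^sub>\<infinity>m. of_nat (min (Suc k) (Suc m)) * u (Ray \<alpha> m))"

definition M0 ::
  "'a::finite set set \<Rightarrow> ('n::finite \<Rightarrow> 'a) \<Rightarrow> ('k::complex_hilbert_space \<Rightarrow> ('a, 'n) gfun)
    \<Rightarrow> ('k \<Rightarrow> 'k) \<Rightarrow> 'k \<Rightarrow> 'k" where
  "M0 E0 x0 v U f = U f + adj v (G00 E0 x0 (v f))"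


section \<open>Threshold eigenspaces and projections\<close>

fun ray_n :: "'n \<Rightarrow> ('a, 'n) gfun" where
  "ray_n \<alpha> (Core x) = 0"
| "ray_n \<alpha> (Ray \<alpha>' k) = (if \<alpha>' = \<alpha> then of_nat (Suc k) else 0)"

fun ray_1 :: "'n \<Rightarrow> ('a, 'n) gfun" where
  "ray_1 \<alpha> (Core x) = 0"
| "ray_1 \<alpha> (Ray \<alpha>' k) = (if \<alpha>' = \<alpha> then 1 else 0)"

text \<open>The space \<open>\<complex>\<one> \<oplus> \<L>\<^sup>s\<close>; the sum is direct for \<open>s \<ge> -1\<close>.\<close>

definition ones_plus_L :: "real \<Rightarrow> ('a, 'n) gfun set" where
  "ones_plus_L s = {u + w | u w. u \<in> complex_vector.span (range ray_1) \<and> w \<in> Lsp s}"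

definition gen_eigenspace ::
  "'a::finite set set \<Rightarrow> ('n::finite \<Rightarrow> 'a) \<Rightarrow> (('a, 'n) gfun \<Rightarrow> ('a, 'n) gfun)
    \<Rightarrow> real \<Rightarrow> ('a, 'n) gfun set" where
  "gen_eigenspace E0 x0 V \<beta> = {\<Psi> \<in> Ldual \<beta>. full_op E0 x0 V \<Psi> = 0}"

definition res_eigenspace ::
  "'a::finite set set \<Rightarrow> ('n::finite \<Rightarrow> 'a) \<Rightarrow> (('a, 'n) gfun \<Rightarrow> ('a, 'n) gfun)
    \<Rightarrow> real \<Rightarrow> ('a, 'n) gfun set" where
  "res_eigenspace E0 x0 V \<beta> = gen_eigenspace E0 x0 V \<beta> \<inter> ones_plus_L (\<beta> - 2)"

definition bound_eigenspace ::
  "'a::finite set set \<Rightarrow> ('n::finite \<Rightarrow> 'a) \<Rightarrow> (('a, 'n) gfun \<Rightarrow> ('a, 'n) gfun)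
    \<Rightarrow> real \<Rightarrow> ('a, 'n) gfun set" where
  "bound_eigenspace E0 x0 V \<beta> = gen_eigenspace E0 x0 V \<beta> \<inter> Lsp (\<beta> - 2)"

text \<open>The eigenspaces are finite-dimensional, so only finite bases are considered.\<close>

definition bound_basis ::
  "'a::finite set set \<Rightarrow> ('n::finite \<Rightarrow> 'a) \<Rightarrow> (('a, 'n) gfun \<Rightarrow> ('a, 'n) gfun)
    \<Rightarrow> real \<Rightarrow> ('a, 'n) gfun set \<Rightarrow> bool" where
  "bound_basis E0 x0 V \<beta> B \<longleftrightarrow>
     finite B \<and> complex_vector.independent B \<and>
     complex_vector.span B = bound_eigenspace E0 x0 V \<beta> \<and>
     (\<forall>\<Psi>\<in>B. \<forall>\<Phi>\<in>B. (\<lambda>y. cnj (\<Phi> y) * \<Psi> y) \<in> Lsp 0 \<and>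
        pairing \<Phi> \<Psi> = (if \<Phi> = \<Psi> then 1 else 0))"

text \<open>The classes of the elements of the finite set \<open>B\<close> are pairwise distinct and form a
  basis of the quotient space \<open>X / Y\<close>.\<close>

definition quotient_basis :: "'x::complex_vector set \<Rightarrow> 'x set \<Rightarrow> 'x set \<Rightarrow> bool" where
  "quotient_basis X Y B \<longleftrightarrow> finite B \<and> B \<subseteq> X \<and>
     (\<forall>a. (\<Sum>\<Psi>\<in>B. scaleC (a \<Psi>) \<Psi>) \<in> Y \<longrightarrow> (\<forall>\<Psi>\<in>B. a \<Psi> = 0)) \<and>
     (\<forall>\<Phi>\<in>X. \<exists>a. \<Phi> - (\<Sum>\<Psi>\<in>B. scaleC (a \<Psi>) \<Psi>) \<in> Y)"

definition nonresonance_basis ::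
  "'a::finite set set \<Rightarrow> ('n::finite \<Rightarrow> 'a) \<Rightarrow> (('a, 'n) gfun \<Rightarrow> ('a, 'n) gfun)
    \<Rightarrow> real \<Rightarrow> ('a, 'n) gfun set \<Rightarrow> bool" where
  "nonresonance_basis E0 x0 V \<beta> B \<longleftrightarrow>
     quotient_basis (gen_eigenspace E0 x0 V \<beta>) (res_eigenspace E0 x0 V \<beta>) B \<and>
     (\<forall>\<Psi>\<in>B. \<forall>\<Phi>\<in>bound_eigenspace E0 x0 V \<beta>.
        (\<lambda>y. cnj (\<Phi> y) * \<Psi> y) \<in> Lsp 0 \<and> pairing \<Phi> \<Psi> = 0) \<and>
     (\<exists>c :: ('a, 'n) gfun \<Rightarrow> 'n \<Rightarrow> complex.
        (\<forall>\<Psi>\<in>B. \<forall>\<Phi>\<in>B. (\<Sum>\<alpha>\<in>UNIV. cnj (c \<Phi> \<alpha>) * c \<Psi> \<alpha>) = (if \<Phi> = \<Psi> then 1 else 0)) \<and>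
        (\<forall>\<Psi>\<in>B. \<Psi> - (\<Sum>\<alpha>\<in>UNIV. scaleC (c \<Psi> \<alpha>) (ray_n \<alpha>)) \<in> ones_plus_L (\<beta> - 2)))"

definition basis_projection :: "('a, 'n) gfun set \<Rightarrow> ('a, 'n) gfun \<Rightarrow> ('a, 'n) gfun" where
  "basis_projection B u = (\<Sum>\<Psi>\<in>B. ket_bra \<Psi> \<Psi> u)"

definition compl_projection :: "('a, 'n) gfun set \<Rightarrow> ('a, 'n) gfun \<Rightarrow> ('a, 'n) gfun" where
  "compl_projection B u = u - basis_projection B u"

end

theory Submission
  imports Defs
begin

text \<open>The unperturbed resolvent is never expanded. Inserting the expansion of the resolvent into
  the equation for \<open>w = (H + \<kappa>\<^sup>2)\<^sup>-\<^sup>1 u\<close> and comparing powers of \<open>\<kappa>\<close> determines each coefficient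
  up to a generalized eigenfunction. On a half-line such a function is fixed by its value at the
  first vertex, and this value is found by testing the equation with the decaying exponential:
  \<open>w[1] = \<Sum>\<^sub>m z\<^sup>m (u - V w)[m]\<close>, where \<open>z + 1/z = 2 + \<kappa>\<^sup>2\<close> and \<open>|z| < 1\<close>. Its Taylor expansion expresses
  the growth rate of each coefficient through moments. Pairing with bound states, which the
  resolvent multiplies by \<open>\<kappa>\<^sup>-\<^sup>2\<close>, gives \<open>G\<^sub>-\<^sub>2 = P\<close>, \<open>G\<^sub>-\<^sub>1 = 0\<close> and the orthogonality of all later
  coefficients to bound states. Then \<open>w = G\<^sub>0 u\<close> solves \<open>w = G\<^sub>0\<^sub>,\<^sub>0 (u - P u - V w)\<close>, and \<open>- G\<^sub>1 u\<close> is the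
  Riesz representative of \<open>u\<close> for the inner product of growth rates on the generalized
  eigenfunctions orthogonal to bound states. For the same inner product an orthonormal
  non-resonance basis is just an orthonormal basis, which gives its existence and the uniqueness
  of the projection.\<close>

section \<open>Linear maps on subspaces and orthonormal bases\<close>

text \<open>The hypothesis controls the resolvent only in a weighted norm and only off the spectrum,
  but an expansion fixes its coefficients already along one curve tending to zero, so bounded
  functionals are tested on a single path with nonreal \<kappa>^2. The delicate point is the
  boundary value: it is a series in \<phi> = - log z, the expansion is in \<kappa>, and \<kappa> -
  \<phi> is of third order. Exchanging the two would disturb the coefficient of \<kappa>^3 in
  \<kappa>^2 R(\<kappa>) u, which is G_1 u, if the first moment of V w did not vanish at leading
  order; it does, because a bound state has no constant part at infinity. The Taylor terms also
  contain the moments of orders 2 and 3 of V G_(-2) u, with factors 1/2 and 1/6. On a half-line a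
  bound state is a double tail sum of V applied to it, and summing powers twice produces the same
  factors, so these terms become the moments of orders 0 and 1 of G_(-2) u and complete the source u
  - P u - V G_0 u. The Taylor remainder costs a fourth moment of u, available because the weight
  exponent of u is at least 4 as soon as G_0 occurs.\<close>

lemma sum_fun_apply: "(\<Sum>i\<in>I. f i) y = (\<Sum>i\<in>I. f i y)"
  by (induction I rule: infinite_finite_induct) auto

lemma scaleC_fun_apply [simp]: "scaleC c f y = scaleC c (f y)"
  by (simp add: scaleC_fun_def)

lemma scaleC_complex_eq [simp]: "scaleC c (z :: complex) = c * z"
  by (simp add: scaleC_complex_def)

definition linear_on :: "'x::complex_vector set \<Rightarrow> ('x \<Rightarrow> 'y::complex_vector) \<Rightarrow> bool" where
  "linear_on W T \<longleftrightarrow> (\<forall>x\<in>W. \<forall>y\<in>W. T (x + y) = T x + T y) \<and> (\<forall>c. \<forall>x\<in>W. T (scaleC c x) = scaleC c (T x))"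

lemma linear_onI:
  assumes "\<And>x y. x \<in> W \<Longrightarrow> y \<in> W \<Longrightarrow> T (x + y) = T x + T y"
    and "\<And>c x. x \<in> W \<Longrightarrow> T (scaleC c x) = scaleC c (T x)"
  shows "linear_on W T"
  using assms by (auto simp: linear_on_def)

lemma linear_on_add: "linear_on W T \<Longrightarrow> x \<in> W \<Longrightarrow> y \<in> W \<Longrightarrow> T (x + y) = T x + T y"
  by (auto simp: linear_on_def)

lemma linear_on_scale: "linear_on W T \<Longrightarrow> x \<in> W \<Longrightarrow> T (scaleC c x) = scaleC c (T x)"
  by (auto simp: linear_on_def)

lemma linear_on_uminus: "linear_on W T \<Longrightarrow> x \<in> W \<Longrightarrow> T (- x) = - T x"
  using linear_on_scale[of W T x "-1"] by simp

lemma linear_on_0: "linear_on W T \<Longrightarrow> x \<in> W \<Longrightarrow> T 0 = 0"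
  using linear_on_scale[of W T x 0] by simp

lemma linear_on_diff:
  assumes "complex_vector.subspace W" "linear_on W T" "x \<in> W" "y \<in> W"
  shows "T (x - y) = T x - T y"
  using linear_on_add[OF assms(2,3), of "- y"] linear_on_uminus[OF assms(2,4)]
    complex_vector.subspace_neg[OF assms(1,4)] by simp

lemma linear_on_sum:
  assumes W: "complex_vector.subspace W" and T: "linear_on W T"
    and f: "\<And>i. i \<in> I \<Longrightarrow> f i \<in> W"
  shows "T (\<Sum>i\<in>I. f i) = (\<Sum>i\<in>I. T (f i))"
  using f
proof (induction I rule: infinite_finite_induct)
  case (insert i I)
  then show ?case
    using linear_on_add[OF T, of "f i" "\<Sum>i\<in>I. f i"] complex_vector.subspace_sum[OF W, of I f] by simp
qed (use linear_on_0[OF T complex_vector.subspace_0[OF W]] in auto)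

lemma linear_on_subset: "linear_on W T \<Longrightarrow> X \<subseteq> W \<Longrightarrow> linear_on X T"
  unfolding linear_on_def by blast

lemma subspace_sum_scale:
  assumes "complex_vector.subspace W" "B \<subseteq> W"
  shows "(\<Sum>b\<in>B. scaleC (a b) b) \<in> W"
  using assms by (auto intro!: complex_vector.subspace_sum complex_vector.subspace_scale)

text \<open>Relative to a subspace because the forms in question may diverge or degenerate
  elsewhere. The instances are \<open>pairing\<close> on square-summable functions and on bound
  states, \<open>growth_ip\<close> on the non-resonance representatives, and \<open>cinner\<close>
  on the whole Hilbert space and on the kernel of \<open>M0\<close>.\<close>

locale inner_product_on =
  fixes W :: "'x::complex_vector set" and ip :: "'x \<Rightarrow> 'x \<Rightarrow> complex"
  assumes subspace: "complex_vector.subspace W"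
    and ip_linear: "x \<in> W \<Longrightarrow> linear_on W (ip x)"
    and ip_commute: "x \<in> W \<Longrightarrow> y \<in> W \<Longrightarrow> ip x y = cnj (ip y x)"
    and ip_nonneg: "x \<in> W \<Longrightarrow> 0 \<le> Re (ip x x)"
    and ip_definite: "x \<in> W \<Longrightarrow> ip x x = 0 \<Longrightarrow> x = 0"
begin

definition orthonormal :: "'x set \<Rightarrow> bool" where
  "orthonormal B \<longleftrightarrow> finite B \<and> B \<subseteq> W \<and> (\<forall>x\<in>B. \<forall>y\<in>B. ip x y = (if x = y then 1 else 0))"

definition proj :: "'x set \<Rightarrow> 'x \<Rightarrow> 'x" where
  "proj B x = (\<Sum>b\<in>B. scaleC (ip b x) b)"

definition orthonormal_basis :: "'x set \<Rightarrow> bool" where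
  "orthonormal_basis B \<longleftrightarrow> orthonormal B \<and> (\<forall>x\<in>W. x = proj B x)"

lemma ip_sum_right:
  assumes "x \<in> W" "B \<subseteq> W"
  shows "ip x (\<Sum>b\<in>B. scaleC (a b) b) = (\<Sum>b\<in>B. a b * ip x b)"
proof -
  have "ip x (\<Sum>b\<in>B. scaleC (a b) b) = (\<Sum>b\<in>B. ip x (scaleC (a b) b))"
    using assms subspace by (intro linear_on_sum[OF subspace ip_linear]) (auto intro: complex_vector.subspace_scale)
  also have "\<dots> = (\<Sum>b\<in>B. a b * ip x b)"
    using assms by (intro sum.cong) (auto simp: linear_on_scale[OF ip_linear])
  finally show ?thesis .
qed

lemma orthonormal_ip_sum:
  assumes B: "orthonormal B" and b: "b \<in> B"
  shows "ip b (\<Sum>b\<in>B. scaleC (a b) b) = a b"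
proof -
  have "ip b (\<Sum>b\<in>B. scaleC (a b) b) = (\<Sum>c\<in>B. a c * (if b = c then 1 else 0))"
    using assms by (subst ip_sum_right) (auto simp: orthonormal_def intro!: sum.cong)
  then show ?thesis using assms by (auto simp: orthonormal_def if_distrib cong: if_cong)
qed

lemma proj_in: "B \<subseteq> W \<Longrightarrow> proj B x \<in> W"
  unfolding proj_def using subspace by (intro subspace_sum_scale)

lemma orthonormal_independent:
  assumes B: "orthonormal B"
  shows "complex_vector.independent B"
proof -
  have "a b = 0" if "(\<Sum>b\<in>B. scaleC (a b) b) = 0" "b \<in> B" for a b
    using orthonormal_ip_sum[OF B that(2), of a] that B linear_on_0[OF ip_linear, of b]
    by (auto simp: orthonormal_def)
  then show ?thesis
    using B complex_vector.independent_explicit_finite_subsets[of B] complex_vector.dependent_finite[of B]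
    by (auto simp: orthonormal_def)
qed

lemma orthonormal_basis_span:
  assumes B: "orthonormal_basis B"
  shows "complex_vector.span B = W"
proof
  have BW: "B \<subseteq> W" using B by (auto simp: orthonormal_basis_def orthonormal_def)
  then show "complex_vector.span B \<subseteq> W"
    by (rule complex_vector.span_minimal[OF _ subspace])
  show "W \<subseteq> complex_vector.span B"
  proof
    fix x assume "x \<in> W"
    then have x: "x = (\<Sum>b\<in>B. scaleC (ip b x) b)"
      using B by (auto simp: orthonormal_basis_def proj_def)
    show "x \<in> complex_vector.span B"
      by (subst x) (intro complex_vector.span_sum complex_vector.span_scale complex_vector.span_base)
  qed
qed

lemma orthonormal_spanning:
  assumes B: "orthonormal B" and x: "x = (\<Sum>b\<in>B. scaleC (a b) b)"
  shows "x = proj B x"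
proof -
  have "proj B x = (\<Sum>b\<in>B. scaleC (a b) b)"
    unfolding proj_def using orthonormal_ip_sum[OF B, of _ a] x by (intro sum.cong) auto
  then show ?thesis using x by simp
qed

lemma proj_orthogonal:
  assumes B: "orthonormal B" and x: "x \<in> W" and b: "b \<in> B"
  shows "ip b (x - proj B x) = 0"
  using B b x orthonormal_ip_sum[OF B b, of "\<lambda>b. ip b x"] proj_in[of B x]
  by (auto simp: orthonormal_def proj_def linear_on_diff[OF subspace ip_linear])

lemma unique_by_ip:
  assumes "x \<in> W" "y \<in> W" "\<And>z. z \<in> W \<Longrightarrow> ip z x = ip z y"
  shows "x = y"
proof -
  have d: "x - y \<in> W" using assms subspace by (auto intro: complex_vector.subspace_diff)
  then have "ip (x - y) (x - y) = 0"
    using assms linear_on_diff[OF subspace ip_linear[OF d], of x y] by auto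
  from ip_definite[OF d this] show ?thesis by simp
qed

end

lemma inner_product_on_subset:
  assumes "inner_product_on W ip" "complex_vector.subspace X" "X \<subseteq> W"
  shows "inner_product_on X ip"
proof -
  interpret inner_product_on W ip by fact
  show ?thesis
  proof
    show "complex_vector.subspace X" by fact
    show "linear_on X (ip x)" if "x \<in> X" for x
      using linear_on_subset[OF ip_linear \<open>X \<subseteq> W\<close>] that assms(3) by blast
    show "ip x y = cnj (ip y x)" if "x \<in> X" "y \<in> X" for x y
      using that assms(3) by (intro ip_commute) auto
    show "0 \<le> Re (ip x x)" if "x \<in> X" for x
      using that assms(3) by (intro ip_nonneg) auto
    show "x = 0" if "x \<in> X" "ip x x = 0" for x
      using that assms(3) ip_definite by auto
  qed
qed

text \<open>Splitting off one functional after the other bounds the dimension and carries out the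
  Gram--Schmidt process at the same time.\<close>

lemma ex_orthonormal_basis:
  assumes "finite I" "inner_product_on W ip"
    and "\<And>i. i \<in> I \<Longrightarrow> linear_on W (l i :: _ \<Rightarrow> complex)"
    and "\<And>x. x \<in> W \<Longrightarrow> (\<And>i. i \<in> I \<Longrightarrow> l i x = 0) \<Longrightarrow> x = 0"
  shows "\<exists>B. inner_product_on.orthonormal_basis W ip B"
  using assms
proof (induction I arbitrary: W rule: finite_induct)
  case empty
  then interpret inner_product_on W ip by simp
  show ?case
    using empty by (intro exI[of _ "{}"]) (auto simp: orthonormal_basis_def orthonormal_def proj_def)
next
  case (insert i I)
  then interpret inner_product_on W ip by simp
  \<comment> \<open>The remaining functionals still separate the points of this kernel, so the
    induction hypothesis applies to it.\<close>
  let ?W = "{x \<in> W. l i x = 0}"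
  have li: "linear_on W (l i)" using insert by auto
  have W': "complex_vector.subspace ?W"
    using subspace li linear_on_0[OF li]
    by (auto simp: complex_vector.subspace_def linear_on_add linear_on_scale)
  have ip': "inner_product_on ?W ip"
    using inner_product_on_subset[OF insert.prems(1) W'] by auto
  interpret sub: inner_product_on ?W ip by (rule ip')
  have "\<exists>B. sub.orthonormal_basis B"
    by (rule insert.IH[OF ip']) (use insert.prems(2,3) in \<open>auto intro: linear_on_subset\<close>)
  then obtain B where B: "sub.orthonormal_basis B" by auto
  then have on: "orthonormal B" and BW: "B \<subseteq> ?W"
    by (auto simp: sub.orthonormal_basis_def sub.orthonormal_def orthonormal_def)
  have fB: "finite B" using on by (auto simp: orthonormal_def)
  show ?case
  proof (cases "\<exists>x\<in>W. l i x \<noteq> 0")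
    case False
    then have "?W = W" by auto
    then show ?thesis using B by auto
  next
    case True
    then obtain x where x: "x \<in> W" "l i x \<noteq> 0" by auto
    \<comment> \<open>\<open>proj B x\<close> lies in the kernel of \<open>l i\<close>, so
      subtracting it makes \<open>x\<close> orthogonal to \<open>B\<close> without changing the
      value of \<open>l i\<close>.\<close>
    define y where "y = x - proj B x"
    have pB: "proj B x \<in> ?W"
      unfolding proj_def using W' BW by (rule subspace_sum_scale)
    have y: "y \<in> W" "l i y \<noteq> 0"
      using x pB subspace linear_on_diff[OF subspace li x(1), of "proj B x"]
      by (auto simp: y_def intro: complex_vector.subspace_diff)
    have y0: "y \<noteq> 0" using y linear_on_0[OF li] by auto
    define r where "r = Re (ip y y)"
    have "Im (ip y y) = - Im (ip y y)"
      using arg_cong[OF ip_commute[OF y(1) y(1)], of Im] by simp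
    then have ipy: "ip y y = of_real r" by (simp add: r_def complex_eq_iff)
    have "r \<ge> 0" unfolding r_def by (rule ip_nonneg[OF y(1)])
    moreover have "r \<noteq> 0" using ip_definite[OF y(1)] y0 unfolding ipy by auto
    ultimately have r: "r > 0" by simp
    define e where "e = scaleC (of_real (1 / sqrt r)) y"
    have e: "e \<in> W" using y subspace by (auto simp: e_def intro: complex_vector.subspace_scale)
    have lie: "l i e \<noteq> 0" using y r linear_on_scale[OF li y(1)] by (auto simp: e_def)
    have ipye: "ip y e = of_real (1 / sqrt r) * of_real r"
      using linear_on_scale[OF ip_linear[OF y(1)] y(1)] ipy by (simp add: e_def)
    have "ip e e = of_real (1 / sqrt r) * ip e y"
      using linear_on_scale[OF ip_linear[OF e] y(1), of "of_real (1 / sqrt r)"] by (simp add: e_def)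
    also have "ip e y = of_real (1 / sqrt r) * of_real r"
      by (subst ip_commute[OF e y(1)]) (simp add: ipye)
    finally have "ip e e = of_real (1 / sqrt r * (1 / sqrt r) * r)"
      by (simp only: of_real_mult mult.assoc)
    also have "1 / sqrt r * (1 / sqrt r) * r = 1" using r by (simp add: field_simps)
    finally have ee: "ip e e = 1" by simp
    have be: "ip b e = 0" if "b \<in> B" for b
    proof -
      have "ip b y = 0" unfolding y_def using on x that by (intro proj_orthogonal) auto
      moreover have "b \<in> W" using that BW by auto
      ultimately show ?thesis using linear_on_scale[OF ip_linear y(1), of b] by (simp add: e_def)
    qed
    have eb: "ip e b = 0" if "b \<in> B" for b
      using that BW by (subst ip_commute[OF e]) (auto simp: be)
    have eB: "e \<notin> B" using lie BW by auto
    have on': "orthonormal (insert e B)"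
      using on e ee be eb eB by (auto simp: orthonormal_def)
    have "z = proj (insert e B) z" if z: "z \<in> W" for z
    proof -
      \<comment> \<open>This multiple of \<open>e\<close> moves \<open>z'\<close> into the kernel of
        \<open>l i\<close>, where \<open>B\<close> is already a basis.\<close>
      define c where "c = l i z / l i e"
      define z' where "z' = z - scaleC c e"
      have "z' \<in> ?W"
        using z e subspace lie linear_on_diff[OF subspace li z, of "scaleC c e"] linear_on_scale[OF li e]
        by (auto simp: z'_def c_def intro!: complex_vector.subspace_diff complex_vector.subspace_scale)
      then have "z' = (\<Sum>b\<in>B. scaleC (ip b z') b)"
        using B by (auto simp: sub.orthonormal_basis_def sub.proj_def)
      then have "z = scaleC c e + (\<Sum>b\<in>B. scaleC (ip b z') b)" by (simp add: z'_def algebra_simps)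
      also have "\<dots> = (\<Sum>b\<in>insert e B. scaleC (if b = e then c else ip b z') b)"
        using eB fB by (auto intro!: sum.cong)
      finally show ?thesis by (intro orthonormal_spanning[OF on'])
    qed
    then show ?thesis using on' by (auto simp: orthonormal_basis_def)
  qed
qed

section \<open>Hilbert spaces and the spectrum of symmetric operators\<close>

text \<open>The representing vector minimizes |x|^2 - 2 F x. The parallelogram law makes a
  minimizing sequence Cauchy, and stationarity at the minimum is the representation.\<close>

lemma riesz_representation_real:
  fixes F :: "'h::{real_inner,complete_space} \<Rightarrow> real"
  assumes "bounded_linear F"
  shows "\<exists>f. \<forall>g. inner f g = F g"
proof -
  interpret F: bounded_linear F by fact
  obtain C where C: "C > 0" "\<And>x. norm (F x) \<le> norm x * C" using F.pos_bounded by auto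
  define J where "J x = (norm x)\<^sup>2 - 2 * F x" for x
  have Jlb: "J x \<ge> - C\<^sup>2" for x
  proof -
    have "J x \<ge> (norm x)\<^sup>2 - 2 * (norm x * C)" using C(2)[of x] by (auto simp: J_def abs_le_iff)
    moreover have "(norm x - C)\<^sup>2 \<ge> 0" by simp
    ultimately show ?thesis by (simp add: power2_diff)
  qed
  define m where "m = Inf (range J)"
  have bdd: "bdd_below (range J)" using Jlb by (auto simp: bdd_below_def)
  have mle: "m \<le> J x" for x unfolding m_def by (rule cInf_lower[OF _ bdd]) auto
  have "\<exists>x. J x < m + inverse (real (Suc n))" for n
    using cInf_lessD[of "range J" "m + inverse (real (Suc n))"] by (auto simp: m_def)
  then obtain X where X: "\<And>n. J (X n) < m + inverse (real (Suc n))" by metis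
  \<comment> \<open>The terms with \<open>F\<close> cancel because \<open>J\<close> is evaluated at
    the midpoint.\<close>
  have par: "(norm (x - y))\<^sup>2 = 2 * J x + 2 * J y - 4 * J ((1/2) *\<^sub>R (x + y))" for x y
    by (simp add: J_def F.add F.scaleR power2_norm_eq_inner inner_diff inner_add algebra_simps inner_commute)
  have dX: "(norm (X i - X j))\<^sup>2 \<le> 4 * inverse (real (Suc N))" if "i \<ge> N" "j \<ge> N" for i j N
  proof -
    have "inverse (real (Suc i)) \<le> inverse (real (Suc N))" "inverse (real (Suc j)) \<le> inverse (real (Suc N))"
      using that by (auto intro!: le_imp_inverse_le)
    then show ?thesis
      unfolding par using X[of i] X[of j] mle[of "(1/2) *\<^sub>R (X i + X j)"] by linarith
  qed
  have "Cauchy X"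
  proof (rule CauchyI)
    fix e :: real assume e: "0 < e"
    then obtain N where N: "inverse (real (Suc N)) < e\<^sup>2 / 4"
      using reals_Archimedean[of "e\<^sup>2 / 4"] by auto
    have "norm (X i - X j) < e" if "i \<ge> N" "j \<ge> N" for i j
    proof -
      have "(norm (X i - X j))\<^sup>2 < e\<^sup>2" using dX[OF that] N by linarith
      then show ?thesis using e by (auto dest: power_less_imp_less_base)
    qed
    then show "\<exists>M. \<forall>m\<ge>M. \<forall>n\<ge>M. norm (X m - X n) < e" by blast
  qed
  then obtain f where f: "X \<longlonglongrightarrow> f" using Cauchy_convergent convergent_def by blast
  have "(\<lambda>n. J (X n)) \<longlonglongrightarrow> J f"
    unfolding J_def using f by (intro tendsto_intros F.tendsto)
  moreover have "(\<lambda>n. m + inverse (real (Suc n))) \<longlonglongrightarrow> m + 0"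
    by (intro tendsto_intros LIMSEQ_inverse_real_of_nat)
  ultimately have "J f \<le> m + 0"
    using X by (intro LIMSEQ_le[of "\<lambda>n. J (X n)" _ "\<lambda>n. m + inverse (real (Suc n))"]) (auto intro: less_imp_le)
  then have min: "J f \<le> J x" for x using mle[of x] by simp
  have "inner f g = F g" for g
  proof (rule ccontr)
    define d where "d = inner f g - F g"
    assume "inner f g \<noteq> F g"
    then have d: "d \<noteq> 0" by (simp add: d_def)
    then have g: "g \<noteq> 0" by (auto simp: d_def F.zero)
    \<comment> \<open>Minimizer of the quadratic polynomial t -> J (f + t g); there \<open>J\<close>
      drops by \<open>d\<^sup>2 / (norm g)\<^sup>2\<close>.\<close>
    define t where "t = - d / (norm g)\<^sup>2"
    have "J (f + t *\<^sub>R g) = J f + t\<^sup>2 * (norm g)\<^sup>2 + 2 * t * d"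
      unfolding J_def d_def power2_norm_eq_inner
      by (simp add: F.add F.scaleR inner_add algebra_simps inner_commute power2_eq_square)
    moreover have "t\<^sup>2 * (norm g)\<^sup>2 + 2 * t * d = - (d\<^sup>2 / (norm g)\<^sup>2)"
      using g by (simp add: t_def field_simps power2_eq_square)
    ultimately have "J (f + t *\<^sub>R g) = J f - d\<^sup>2 / (norm g)\<^sup>2" by linarith
    then show False using min[of "f + t *\<^sub>R g"] d g by (simp add: divide_le_0_iff)
  qed
  then show ?thesis by blast
qed

lemma Im_cinner: "Im (cinner f g) = inner f (scaleC (- \<i>) (g :: 'k::complex_hilbert_space))"
  by (simp add: Re_cinner[symmetric] cinner_scaleC_right del: complex_vector.scale_minus_left)

text \<open>The real part is represented first. The imaginary part of F g is the real part of F (- i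
  g), so complex linearity supplies the rest.\<close>

lemma riesz_representation:
  fixes F :: "'k::complex_hilbert_space \<Rightarrow> complex"
  assumes F: "linear_on UNIV F" and C: "\<And>g. cmod (F g) \<le> C * norm g"
  shows "\<exists>f. \<forall>g. cinner f g = F g"
proof -
  have "bounded_linear (\<lambda>g. Re (F g))"
  proof (rule bounded_linear_intro)
    show "Re (F (x + y)) = Re (F x) + Re (F y)" for x y using linear_on_add[OF F, of x y] by simp
    show "Re (F (r *\<^sub>R x)) = r *\<^sub>R Re (F x)" for r x
      using linear_on_scale[OF F, of x "of_real r"] by (simp add: scaleR_scaleC)
    show "norm (Re (F x)) \<le> norm x * C" for x
      using C[of x] abs_Re_le_cmod[of "F x"] by (simp add: mult.commute)
  qed
  then obtain f where f: "\<And>g. inner f g = Re (F g)" using riesz_representation_real by blast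
  have "cinner f g = F g" for g
    using f[of g] f[of "scaleC (- \<i>) g"] linear_on_scale[OF F, of g "- \<i>"]
    by (simp add: complex_eq_iff Re_cinner Im_cinner del: complex_vector.scale_minus_left)
  then show ?thesis by blast
qed

text \<open>Lax--Milgram: solutions are the fixed points of u -> u - \<tau> (A u - f), which is a
  contraction for small \<tau> because the coercive term is linear in \<tau> and the error term
  quadratic.\<close>

lemma coercive_surj:
  fixes A :: "'h::{real_inner,complete_space} \<Rightarrow> 'h"
  assumes "bounded_linear A" and b: "b > 0" and co: "\<And>u. inner u (A u) \<ge> b * (norm u)\<^sup>2"
  shows "\<exists>u. A u = f"
proof -
  interpret A: bounded_linear A by fact
  obtain C where C: "C > 0" "\<And>x. norm (A x) \<le> norm x * C" using A.pos_bounded by auto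
  \<comment> \<open>Minimizes the bound 1 - 2 \<tau> b + \<tau>^2 C^2 for the squared contraction
    factor; the minimum is 1 - b^2 / C^2.\<close>
  define \<tau> where "\<tau> = b / C\<^sup>2"
  have tau: "\<tau> > 0" using b C by (simp add: \<tau>_def)
  define q where "q = max 0 (1 - b\<^sup>2 / C\<^sup>2)"
  have q: "0 \<le> q" "q < 1" using b C by (auto simp: q_def)
  have con: "(norm (d - \<tau> *\<^sub>R A d))\<^sup>2 \<le> q * (norm d)\<^sup>2" for d
  proof -
    have "(norm (A d))\<^sup>2 \<le> (norm d * C)\<^sup>2" using C by (intro power_mono) auto
    then have 1: "\<tau>\<^sup>2 * (norm (A d))\<^sup>2 \<le> \<tau>\<^sup>2 * ((norm d)\<^sup>2 * C\<^sup>2)"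
      by (intro mult_left_mono) (auto simp: power_mult_distrib)
    have 2: "2 * \<tau> * (b * (norm d)\<^sup>2) \<le> 2 * \<tau> * inner d (A d)"
      using co[of d] tau by (intro mult_left_mono) auto
    have "(norm (d - \<tau> *\<^sub>R A d))\<^sup>2 = (norm d)\<^sup>2 - 2 * \<tau> * inner d (A d) + \<tau>\<^sup>2 * (norm (A d))\<^sup>2"
      unfolding power2_norm_eq_inner by (simp add: inner_diff algebra_simps inner_commute power2_eq_square)
    also have "\<dots> \<le> (norm d)\<^sup>2 - 2 * \<tau> * (b * (norm d)\<^sup>2) + \<tau>\<^sup>2 * ((norm d)\<^sup>2 * C\<^sup>2)"
      using 1 2 by linarith
    also have "\<dots> = (1 - b\<^sup>2 / C\<^sup>2) * (norm d)\<^sup>2"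
      using C by (simp add: \<tau>_def field_simps power2_eq_square)
    also have "\<dots> \<le> q * (norm d)\<^sup>2" by (intro mult_right_mono) (auto simp: q_def)
    finally show ?thesis .
  qed
  have "\<exists>!u. u - \<tau> *\<^sub>R (A u - f) = u"
  proof (rule banach_fix_type)
    show "0 \<le> sqrt q" "sqrt q < 1" using q by auto
    show "\<forall>x y. dist (x - \<tau> *\<^sub>R (A x - f)) (y - \<tau> *\<^sub>R (A y - f)) \<le> sqrt q * dist x y"
    proof (intro allI)
      fix x y
      have "dist (x - \<tau> *\<^sub>R (A x - f)) (y - \<tau> *\<^sub>R (A y - f)) = norm ((x - y) - \<tau> *\<^sub>R A (x - y))"
        by (simp add: dist_norm A.diff algebra_simps)
      also have "\<dots> \<le> sqrt (q * (norm (x - y))\<^sup>2)" by (rule real_le_rsqrt[OF con])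
      finally show "dist (x - \<tau> *\<^sub>R (A x - f)) (y - \<tau> *\<^sub>R (A y - f)) \<le> sqrt q * dist x y"
        by (simp add: real_sqrt_mult dist_norm)
    qed
  qed
  then show ?thesis using tau by auto
qed

section \<open>Square-summable functions as a Hilbert space\<close>

lemma square_summable_product:
  fixes u w :: "'v \<Rightarrow> complex"
  assumes "(\<lambda>y. (cmod (u y))\<^sup>2) summable_on S" "(\<lambda>y. (cmod (w y))\<^sup>2) summable_on S"
  shows "(\<lambda>y. cmod (u y * w y)) summable_on S"
proof (rule summable_on_comparison_test)
  show "(\<lambda>y. (cmod (u y))\<^sup>2 + (cmod (w y))\<^sup>2) summable_on S"
    using assms by (intro summable_on_add)
  show "cmod (u y * w y) \<le> (cmod (u y))\<^sup>2 + (cmod (w y))\<^sup>2" for y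
  proof -
    have "2 * (cmod (u y) * cmod (w y)) \<le> (cmod (u y))\<^sup>2 + (cmod (w y))\<^sup>2"
      using sum_squares_bound[of "cmod (u y)" "cmod (w y)"] by simp
    moreover have "0 \<le> cmod (u y) * cmod (w y)" by simp
    ultimately show ?thesis unfolding norm_mult by linarith
  qed
qed auto

lemma square_summable_add:
  fixes u w :: "'v \<Rightarrow> complex"
  assumes "(\<lambda>y. (cmod (u y))\<^sup>2) summable_on S" "(\<lambda>y. (cmod (w y))\<^sup>2) summable_on S"
  shows "(\<lambda>y. (cmod (u y + w y))\<^sup>2) summable_on S"
proof (rule summable_on_comparison_test)
  show "(\<lambda>y. 2 * (cmod (u y))\<^sup>2 + 2 * (cmod (w y))\<^sup>2) summable_on S"
    using assms by (intro summable_on_add summable_on_cmult_right)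
  show "(cmod (u y + w y))\<^sup>2 \<le> 2 * (cmod (u y))\<^sup>2 + 2 * (cmod (w y))\<^sup>2" for y
  proof -
    have "(cmod (u y + w y))\<^sup>2 \<le> (cmod (u y) + cmod (w y))\<^sup>2"
      by (intro power_mono norm_triangle_ineq) auto
    also have "\<dots> \<le> 2 * (cmod (u y))\<^sup>2 + 2 * (cmod (w y))\<^sup>2"
      using sum_squares_bound[of "cmod (u y)" "cmod (w y)"] by (simp add: power2_sum)
    finally show ?thesis .
  qed
qed auto

lemma square_summable_scale:
  fixes u :: "'v \<Rightarrow> complex"
  assumes "(\<lambda>y. (cmod (u y))\<^sup>2) summable_on S"
  shows "(\<lambda>y. (cmod (c * u y))\<^sup>2) summable_on S"
  using summable_on_cmult_right[OF assms, of "(cmod c)\<^sup>2"] by (simp add: norm_mult power_mult_distrib)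

text \<open>\<open>ell2\<close> is a set of functions, whereas \<open>coercive_surj\<close> needs a
  type in the classes of complete real inner product spaces. This copy carries the real part of the
  pairing as its inner product.\<close>

typedef 'v l2 = "{u :: 'v \<Rightarrow> complex. (\<lambda>y. (cmod (u y))\<^sup>2) summable_on UNIV}"
  by (rule exI[of _ "\<lambda>_. 0"]) simp

lemma Rep_l2_summable: "(\<lambda>y. (cmod (Rep_l2 u y))\<^sup>2) summable_on UNIV"
  using Rep_l2[of u] by simp

lemma Rep_l2_product: "(\<lambda>y. cnj (Rep_l2 u y) * Rep_l2 w y) summable_on UNIV"
  by (rule abs_summable_summable, rule square_summable_product) (simp_all add: Rep_l2_summable)

instantiation l2 :: (type) real_inner
begin

definition zero_l2 :: "'a l2" where "zero_l2 = Abs_l2 (\<lambda>_. 0)"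
definition plus_l2 :: "'a l2 \<Rightarrow> 'a l2 \<Rightarrow> 'a l2" where
  "plus_l2 u w = Abs_l2 (\<lambda>y. Rep_l2 u y + Rep_l2 w y)"
definition scaleR_l2 :: "real \<Rightarrow> 'a l2 \<Rightarrow> 'a l2" where
  "scaleR_l2 r u = Abs_l2 (\<lambda>y. of_real r * Rep_l2 u y)"
definition uminus_l2 :: "'a l2 \<Rightarrow> 'a l2" where "uminus_l2 u = scaleR (-1) u"
definition minus_l2 :: "'a l2 \<Rightarrow> 'a l2 \<Rightarrow> 'a l2" where "minus_l2 u w = u + (- w)"
definition inner_l2 :: "'a l2 \<Rightarrow> 'a l2 \<Rightarrow> real" where
  "inner_l2 u w = Re (\<Sum>\<^sub>\<infinity>y. cnj (Rep_l2 u y) * Rep_l2 w y)"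
definition norm_l2 :: "'a l2 \<Rightarrow> real" where "norm_l2 u = sqrt (inner u u)"
definition dist_l2 :: "'a l2 \<Rightarrow> 'a l2 \<Rightarrow> real" where "dist_l2 u w = norm (u - w)"
definition sgn_l2 :: "'a l2 \<Rightarrow> 'a l2" where "sgn_l2 u = scaleR (inverse (norm u)) u"
definition uniformity_l2 :: "('a l2 \<times> 'a l2) filter" where
  "uniformity_l2 = (INF e\<in>{0 <..}. principal {(x, y). dist x y < e})"
definition open_l2 :: "'a l2 set \<Rightarrow> bool" where
  "open_l2 S \<longleftrightarrow> (\<forall>x\<in>S. \<forall>\<^sub>F (x', y) in uniformity. x' = x \<longrightarrow> y \<in> S)"

lemma Rep_l2_zero: "Rep_l2 0 y = 0"
  by (simp add: zero_l2_def Abs_l2_inverse)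
lemma Rep_l2_add: "Rep_l2 (u + w) y = Rep_l2 u y + Rep_l2 w y"
  by (simp add: plus_l2_def Abs_l2_inverse square_summable_add Rep_l2_summable)
lemma Rep_l2_scaleR: "Rep_l2 (r *\<^sub>R u) y = of_real r * Rep_l2 u y"
  by (subst scaleR_l2_def, subst Abs_l2_inverse) (use square_summable_scale Rep_l2_summable in auto)
lemma Rep_l2_uminus: "Rep_l2 (- u) y = - Rep_l2 u y"
  by (simp add: uminus_l2_def Rep_l2_scaleR)
lemma Rep_l2_diff: "Rep_l2 (u - w) y = Rep_l2 u y - Rep_l2 w y"
  by (simp add: minus_l2_def Rep_l2_add Rep_l2_uminus)

lemma l2_eqI: "(\<And>y. Rep_l2 u y = Rep_l2 w y) \<Longrightarrow> u = w"
  by (simp add: Rep_l2_inject[symmetric] fun_eq_iff)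

lemma inner_l2_self: "inner u u = (\<Sum>\<^sub>\<infinity>y. (cmod (Rep_l2 u y))\<^sup>2)" for u :: "'a l2"
proof -
  have "(\<Sum>\<^sub>\<infinity>y. cnj (Rep_l2 u y) * Rep_l2 u y) = (\<Sum>\<^sub>\<infinity>y. of_real ((cmod (Rep_l2 u y))\<^sup>2))"
    by (intro infsum_cong) (simp add: complex_norm_square mult.commute del: of_real_power)
  also have "\<dots> = of_real (\<Sum>\<^sub>\<infinity>y. (cmod (Rep_l2 u y))\<^sup>2)"
    by (rule infsumI, rule has_sum_of_real) (simp add: Rep_l2_summable)
  finally show ?thesis by (simp add: inner_l2_def)
qed

instance
proof
  fix x y z :: "'a l2" and r s :: real
  show "x + y + z = x + (y + z)" by (rule l2_eqI) (simp add: Rep_l2_add)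
  show "x + y = y + x" by (rule l2_eqI) (simp add: Rep_l2_add)
  show "0 + x = x" by (rule l2_eqI) (simp add: Rep_l2_add Rep_l2_zero)
  show "- x + x = 0" by (rule l2_eqI) (simp add: Rep_l2_add Rep_l2_zero Rep_l2_uminus)
  show "x - y = x + - y" by (simp add: minus_l2_def)
  show "r *\<^sub>R (x + y) = r *\<^sub>R x + r *\<^sub>R y"
    by (rule l2_eqI) (simp add: Rep_l2_add Rep_l2_scaleR algebra_simps)
  show "(r + s) *\<^sub>R x = r *\<^sub>R x + s *\<^sub>R x"
    by (rule l2_eqI) (simp add: Rep_l2_add Rep_l2_scaleR algebra_simps)
  show "r *\<^sub>R s *\<^sub>R x = (r * s) *\<^sub>R x" by (rule l2_eqI) (simp add: Rep_l2_scaleR)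
  show "1 *\<^sub>R x = x" by (rule l2_eqI) (simp add: Rep_l2_scaleR)
  show "dist x y = norm (x - y)" by (rule dist_l2_def)
  show "sgn x = inverse (norm x) *\<^sub>R x" by (rule sgn_l2_def)
  show "(uniformity :: ('a l2 \<times> 'a l2) filter) = (INF e\<in>{0 <..}. principal {(x, y). dist x y < e})"
    by (rule uniformity_l2_def)
  show "open U \<longleftrightarrow> (\<forall>x\<in>U. \<forall>\<^sub>F (x', y) in uniformity. x' = x \<longrightarrow> y \<in> U)" for U :: "'a l2 set"
    by (rule open_l2_def)
  have "(\<Sum>\<^sub>\<infinity>v. cnj (Rep_l2 y v) * Rep_l2 x v) = cnj (\<Sum>\<^sub>\<infinity>v. cnj (Rep_l2 x v) * Rep_l2 y v)"
    unfolding infsum_cnj[symmetric] by (simp add: mult.commute)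
  then show "inner x y = inner y x" by (simp add: inner_l2_def)
  show "inner (x + y) z = inner x z + inner y z"
    using Rep_l2_product[of x z] Rep_l2_product[of y z]
    by (simp add: inner_l2_def Rep_l2_add ring_distribs infsum_add)
  show "inner (r *\<^sub>R x) y = r * inner x y"
    using Rep_l2_product[of x y] by (simp add: inner_l2_def Rep_l2_scaleR mult.assoc infsum_cmult_right)
  show "0 \<le> inner x x" by (simp add: inner_l2_self infsum_nonneg)
  show "inner x x = 0 \<longleftrightarrow> x = 0"
  proof
    assume "inner x x = 0"
    then have "(cmod (Rep_l2 x v))\<^sup>2 = 0" for v
      using nonneg_infsum_le_0D[of "\<lambda>y. (cmod (Rep_l2 x y))\<^sup>2" UNIV v] Rep_l2_summable[of x]
      by (simp add: inner_l2_self)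
    then show "x = 0" by (intro l2_eqI) (simp add: Rep_l2_zero)
  qed (simp add: inner_l2_self Rep_l2_zero)
  show "norm x = sqrt (inner x x)" by (rule norm_l2_def)
qed

end

lemma norm_l2_power2: "(norm u)\<^sup>2 = (\<Sum>\<^sub>\<infinity>y. (cmod (Rep_l2 u y))\<^sup>2)" for u :: "'a l2"
  by (simp only: norm_l2_def inner_l2_self) (simp add: infsum_nonneg)

lemma norm_l2_finite_sum:
  assumes "finite S"
  shows "(\<Sum>y\<in>S. (cmod (Rep_l2 u y))\<^sup>2) \<le> (norm u)\<^sup>2"
  unfolding norm_l2_power2
  by (rule finite_sum_le_infsum[OF Rep_l2_summable assms]) auto

lemma norm_l2_ge_coordinate: "cmod (Rep_l2 u y) \<le> norm u"
  using norm_l2_finite_sum[of "{y}" u] by (simp add: power2_le_iff_abs_le)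

text \<open>The coordinates converge; bounds on finite partial sums survive the limit and then pass
  to the full sum.\<close>

instance l2 :: (type) complete_space
proof
  fix X :: "nat \<Rightarrow> 'a l2" assume X: "Cauchy X"
  have "Cauchy (\<lambda>n. Rep_l2 (X n) y)" for y
    unfolding Cauchy_def dist_norm
  proof (intro allI impI)
    fix e :: real assume "e > 0"
    then obtain M where "\<And>m n. m \<ge> M \<Longrightarrow> n \<ge> M \<Longrightarrow> norm (X m - X n) < e"
      using CauchyD[OF X] by blast
    then show "\<exists>M. \<forall>m\<ge>M. \<forall>n\<ge>M. cmod (Rep_l2 (X m) y - Rep_l2 (X n) y) < e"
      using norm_l2_ge_coordinate[of "X _ - X _" y] by (metis Rep_l2_diff le_less_trans)
  qed
  then have "\<exists>l. (\<lambda>n. Rep_l2 (X n) y) \<longlonglongrightarrow> l" for y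
    using Cauchy_convergent convergent_def by blast
  then obtain L where L: "\<And>y. (\<lambda>n. Rep_l2 (X n) y) \<longlonglongrightarrow> L y" by metis
  have fin: "(\<Sum>y\<in>S. (cmod (Rep_l2 (X n) y - L y))\<^sup>2) \<le> e\<^sup>2"
    if S: "finite S" and N: "\<And>m n. m \<ge> N \<Longrightarrow> n \<ge> N \<Longrightarrow> norm (X m - X n) < e" "n \<ge> N" for S N n e
  proof (rule LIMSEQ_le_const2)
    show "(\<lambda>m. \<Sum>y\<in>S. (cmod (Rep_l2 (X n) y - Rep_l2 (X m) y))\<^sup>2) \<longlonglongrightarrow> (\<Sum>y\<in>S. (cmod (Rep_l2 (X n) y - L y))\<^sup>2)"
      by (intro tendsto_intros L)
    have "(\<Sum>y\<in>S. (cmod (Rep_l2 (X n) y - Rep_l2 (X m) y))\<^sup>2) \<le> e\<^sup>2" if "m \<ge> N" for m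
    proof -
      have "(norm (X n - X m))\<^sup>2 \<le> e\<^sup>2" using N that by (intro power_mono) (auto intro: less_imp_le)
      then show ?thesis using norm_l2_finite_sum[OF S, of "X n - X m"] by (simp add: Rep_l2_diff)
    qed
    then show "\<exists>N. \<forall>m\<ge>N. (\<Sum>y\<in>S. (cmod (Rep_l2 (X n) y - Rep_l2 (X m) y))\<^sup>2) \<le> e\<^sup>2" by blast
  qed
  have summ: "(\<lambda>y. (cmod (Rep_l2 (X n) y - L y))\<^sup>2) summable_on UNIV"
    if "\<And>m n. m \<ge> N \<Longrightarrow> n \<ge> N \<Longrightarrow> norm (X m - X n) < e" "n \<ge> N" for N n e
    by (rule nonneg_bdd_above_summable_on) (use fin[OF _ that] in \<open>auto intro!: bdd_aboveI2\<close>)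
  obtain N1 where N1: "\<And>m n. m \<ge> N1 \<Longrightarrow> n \<ge> N1 \<Longrightarrow> norm (X m - X n) < 1"
    using CauchyD[OF X, of 1] by auto
  have "(\<lambda>y. (cmod (Rep_l2 (X N1) y + (- 1) * (Rep_l2 (X N1) y - L y)))\<^sup>2) summable_on UNIV"
    by (intro square_summable_add square_summable_scale summ[OF N1] Rep_l2_summable) auto
  then have "(\<lambda>y. (cmod (L y))\<^sup>2) summable_on UNIV" by simp
  then have RL: "Rep_l2 (Abs_l2 L) = L" by (simp add: Abs_l2_inverse)
  have "X \<longlonglongrightarrow> Abs_l2 L"
  proof (rule LIMSEQ_I)
    fix e :: real assume e: "0 < e"
    then obtain N where N: "\<And>m n. m \<ge> N \<Longrightarrow> n \<ge> N \<Longrightarrow> norm (X m - X n) < e / 2"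
      using CauchyD[OF X, of "e / 2"] by auto
    have "norm (X n - Abs_l2 L) < e" if n: "n \<ge> N" for n
    proof -
      have "(norm (X n - Abs_l2 L))\<^sup>2 \<le> (e / 2)\<^sup>2"
        unfolding norm_l2_power2 Rep_l2_diff RL
        by (intro infsum_le_finite_sums summ[OF N n] fin[OF _ N n])
      then show ?thesis using e by (auto dest!: power2_le_imp_le)
    qed
    then show "\<exists>no. \<forall>n\<ge>no. norm (X n - Abs_l2 L) < e" by blast
  qed
  then show "convergent X" by (auto simp: convergent_def)
qed

section \<open>Symmetric operators and nonreal spectral parameters\<close>

lemma ell2_Rep: "Rep_l2 u \<in> ell2" by (simp add: ell2_def Rep_l2_summable)

lemma Rep_Abs_ell2: "u \<in> ell2 \<Longrightarrow> Rep_l2 (Abs_l2 u) = u" by (simp add: ell2_def Abs_l2_inverse)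

lemma norm_eq_ell2_norm: "norm u = ell2_norm (Rep_l2 u)"
  by (simp add: norm_eq_sqrt_inner inner_l2_self ell2_norm_def)

lemma subspace_ell2: "complex_vector.subspace ell2"
  by (auto simp: complex_vector.subspace_def ell2_def square_summable_add square_summable_scale)

lemma pairing_ell2_summable:
  assumes "u \<in> ell2" "w \<in> ell2"
  shows "(\<lambda>y. cnj (u y) * w y) summable_on UNIV"
  using assms Rep_l2_product[of "Abs_l2 u" "Abs_l2 w"] by (simp add: Rep_Abs_ell2)

lemma pairing_commute: "pairing u w = cnj (pairing w u)"
  unfolding pairing_def infsum_cnj[symmetric] by (simp add: mult.commute)

lemma pairing_ell2_linear: "u \<in> ell2 \<Longrightarrow> linear_on ell2 (pairing u)"
  by (rule linear_onI) (simp_all add: pairing_def ring_distribs infsum_add pairing_ell2_summable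
      mult.left_commute infsum_cmult_right)

lemma pairing_self: "u \<in> ell2 \<Longrightarrow> pairing u u = of_real ((ell2_norm u)\<^sup>2)"
proof -
  assume u: "u \<in> ell2"
  have "pairing u u = (\<Sum>\<^sub>\<infinity>y. of_real ((cmod (u y))\<^sup>2))"
    unfolding pairing_def by (intro infsum_cong) (simp add: complex_norm_square mult.commute del: of_real_power)
  also have "\<dots> = of_real (\<Sum>\<^sub>\<infinity>y. (cmod (u y))\<^sup>2)"
    by (rule infsumI, rule has_sum_of_real) (use u in \<open>simp add: ell2_def\<close>)
  finally show ?thesis by (simp add: ell2_norm_def infsum_nonneg)
qed

lemma bounded_operatorD:
  assumes "bounded_operator X p Y q T"
  shows "\<And>u. u \<in> X \<Longrightarrow> T u \<in> Y" "linear_on X T" "\<exists>C. \<forall>u\<in>X. q (T u) \<le> C * p u"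
  using assms by (auto simp: bounded_operator_def linear_on_def)

lemma ell2_norm_scale: "u \<in> ell2 \<Longrightarrow> ell2_norm (scaleC c u) = cmod c * ell2_norm u"
  by (simp add: ell2_norm_def norm_mult power_mult_distrib infsum_cmult_right real_sqrt_mult ell2_def)

text \<open>The quadratic form of a symmetric \<open>T\<close> is real, so that of
  \<open>T - z\<close> has imaginary part - Im z times the squared norm. A suitable unit factor
  makes \<open>T - z\<close> coercive with constant |Im z|, which gives surjectivity by
  \<open>coercive_surj\<close>, and injectivity with a bounded inverse by Cauchy--Schwarz.\<close>

theorem nonreal_notin_spectrum:
  fixes T :: "('a, 'n) gfun \<Rightarrow> ('a, 'n) gfun"
  assumes T: "bounded_operator ell2 ell2_norm ell2 ell2_norm T"
    and sym: "\<And>u w. u \<in> ell2 \<Longrightarrow> w \<in> ell2 \<Longrightarrow> pairing (T u) w = pairing u (T w)"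
    and z: "Im z \<noteq> 0"
  shows "z \<notin> spectrum T"
proof -
  define b where "b = \<bar>Im z\<bar>"
  have b: "b > 0" using z by (simp add: b_def)
  \<comment> \<open>This unit rotates the real values of the quadratic form of \<open>T\<close> onto
    the imaginary axis and turns \<open>- z\<close> into a number with real part
    \<open>b\<close>.\<close>
  define \<omega> where "\<omega> = of_real (sgn (Im z)) * \<i>"
  have om: "cmod \<omega> = 1" "\<omega> \<noteq> 0" using z by (auto simp: \<omega>_def norm_mult sgn_if)
  note Tin = bounded_operatorD(1)[OF T] and Tlin = bounded_operatorD(2)[OF T]
  obtain C0 where C0: "\<And>u. u \<in> ell2 \<Longrightarrow> ell2_norm (T u) \<le> C0 * ell2_norm u"
    using bounded_operatorD(3)[OF T] by auto
  define D where "D u = T u - scaleC z u" for u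
  have Din: "D u \<in> ell2" if "u \<in> ell2" for u
    using that Tin subspace_ell2 unfolding D_def
    by (auto intro!: complex_vector.subspace_diff complex_vector.subspace_scale)
  have Dlin: "linear_on ell2 D"
    by (rule linear_onI) (auto simp: D_def linear_on_add[OF Tlin] linear_on_scale[OF Tlin] fun_eq_iff algebra_simps)
  define A :: "('a, 'n) vertex l2 \<Rightarrow> ('a, 'n) vertex l2" where
    "A u = Abs_l2 (scaleC \<omega> (D (Rep_l2 u)))" for u
  have RA: "Rep_l2 (A u) = scaleC \<omega> (D (Rep_l2 u))" for u
    unfolding A_def
    by (rule Rep_Abs_ell2) (intro complex_vector.subspace_scale[OF subspace_ell2] Din ell2_Rep)
  have addR: "Rep_l2 (u + w) = Rep_l2 u + Rep_l2 w" for u w :: "('a, 'n) vertex l2"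
    by (simp add: fun_eq_iff Rep_l2_add)
  have scR: "Rep_l2 (r *\<^sub>R u) = scaleC (of_real r) (Rep_l2 u)" for u :: "('a, 'n) vertex l2" and r
    by (simp add: fun_eq_iff Rep_l2_scaleR)
  have tri: "ell2_norm (u - w) \<le> ell2_norm u + ell2_norm w" if "u \<in> ell2" "w \<in> ell2"
    for u w :: "('a, 'n) gfun"
  proof -
    have "Rep_l2 (Abs_l2 u - Abs_l2 w) = u - w" by (simp add: fun_eq_iff Rep_l2_diff Rep_Abs_ell2 that)
    then show ?thesis
      using norm_triangle_ineq4[of "Abs_l2 u" "Abs_l2 w"] that by (simp add: norm_eq_ell2_norm Rep_Abs_ell2)
  qed
  have bl: "bounded_linear A"
  proof (rule bounded_linear_intro)
    show "A (x + y) = A x + A y" for x y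
      by (rule l2_eqI) (simp add: RA Rep_l2_add addR linear_on_add[OF Dlin ell2_Rep ell2_Rep] algebra_simps)
    show "A (r *\<^sub>R x) = r *\<^sub>R A x" for r x
      by (rule l2_eqI) (simp add: RA Rep_l2_scaleR scR linear_on_scale[OF Dlin ell2_Rep])
    show "norm (A x) \<le> norm x * (C0 + cmod z)" for x
    proof -
      have "norm (A x) = ell2_norm (D (Rep_l2 x))"
        by (simp add: norm_eq_ell2_norm RA ell2_norm_scale[OF Din[OF ell2_Rep]] om)
      also have "\<dots> \<le> ell2_norm (T (Rep_l2 x)) + ell2_norm (scaleC z (Rep_l2 x))"
        unfolding D_def
        by (intro tri Tin ell2_Rep complex_vector.subspace_scale[OF subspace_ell2])
      also have "\<dots> \<le> C0 * norm x + cmod z * norm x"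
        using C0[OF ell2_Rep, of x] by (simp add: norm_eq_ell2_norm ell2_norm_scale ell2_Rep)
      finally show ?thesis by (simp add: algebra_simps)
    qed
  qed
  have co: "inner u (A u) = b * (norm u)\<^sup>2" for u
  proof -
    let ?u = "Rep_l2 u"
    have u: "?u \<in> ell2" by (rule ell2_Rep)
    have "pairing ?u (T ?u) = cnj (pairing ?u (T ?u))"
      using sym[OF u u] pairing_commute[of "T ?u" ?u] by simp
    then have im: "Im (pairing ?u (T ?u)) = 0" by (metis Im_i_times add.inverse_neutral cnj.simps(2) complex_cnj_i equal_neg_zero mult_zero_right)
    have "inner u (A u) = Re (pairing ?u (scaleC \<omega> (D ?u)))"
      by (simp add: inner_l2_def pairing_def RA)
    also have "pairing ?u (scaleC \<omega> (D ?u)) = \<omega> * (pairing ?u (T ?u) - z * of_real ((norm u)\<^sup>2))"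
      using u Tin[OF u] Din[OF u] pairing_self[OF u] complex_vector.subspace_scale[OF subspace_ell2 u, of z]
        linear_on_diff[OF subspace_ell2 pairing_ell2_linear[OF u] Tin[OF u], of "scaleC z ?u"]
      by (simp add: linear_on_scale[OF pairing_ell2_linear] D_def norm_eq_ell2_norm
          del: of_real_power)
    also have "Re \<dots> = b * (norm u)\<^sup>2"
      using im by (simp add: \<omega>_def b_def sgn_if del: of_real_power)
    finally show ?thesis .
  qed
  have lower: "b * ell2_norm u \<le> ell2_norm (D u)" if "u \<in> ell2" for u
  proof -
    let ?u = "Abs_l2 u :: ('a, 'n) vertex l2"
    have "norm (A ?u) = ell2_norm (D u)"
      by (simp add: norm_eq_ell2_norm RA Rep_Abs_ell2 that ell2_norm_scale Din om)
    moreover have "b * (norm ?u)\<^sup>2 \<le> norm ?u * norm (A ?u)"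
      using norm_cauchy_schwarz[of ?u "A ?u"] by (simp add: co)
    then have "b * norm ?u \<le> norm (A ?u)"
      by (cases "norm ?u = 0") (simp_all add: power2_eq_square mult.left_commute)
    ultimately show ?thesis by (simp add: norm_eq_ell2_norm Rep_Abs_ell2 that)
  qed
  have surj: "\<exists>u\<in>ell2. D u = f" if "f \<in> ell2" for f
  proof -
    obtain u where u: "A u = Abs_l2 (scaleC \<omega> f)" using coercive_surj[OF bl b] co by fastforce
    have "Rep_l2 (A u) = scaleC \<omega> f"
      unfolding u by (rule Rep_Abs_ell2) (intro complex_vector.subspace_scale[OF subspace_ell2] that)
    then have "D (Rep_l2 u) = f" using om(2) unfolding RA by (simp add: fun_eq_iff)
    then show ?thesis using ell2_Rep by blast
  qed
  have inj: "inj_on D ell2"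
  proof (rule inj_onI)
    fix u w :: "('a, 'n) gfun" assume uw: "u \<in> ell2" "w \<in> ell2" "D u = D w"
    have d: "u - w \<in> ell2" using uw subspace_ell2 by (auto intro: complex_vector.subspace_diff)
    have "D (u - w) = 0" using linear_on_diff[OF subspace_ell2 Dlin] uw by auto
    then have "b * ell2_norm (u - w) \<le> ell2_norm (0 :: ('a, 'n) gfun)" using lower[OF d] by simp
    also have "ell2_norm (0 :: ('a, 'n) gfun) = 0" by (simp add: ell2_norm_def)
    finally have "ell2_norm (u - w) \<le> 0" using b by (simp add: mult_le_0_iff)
    then have "norm (Abs_l2 (u - w)) \<le> 0" using d by (simp add: norm_eq_ell2_norm Rep_Abs_ell2)
    then have "Rep_l2 (Abs_l2 (u - w)) = Rep_l2 0" by simp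
    then show "u = w" using d by (simp add: Rep_Abs_ell2 fun_eq_iff Rep_l2_zero)
  qed
  define S where "S = inv_into ell2 D"
  have Sin: "S f \<in> ell2" and DS: "D (S f) = f" if "f \<in> ell2" for f
    using surj[OF that] inv_into_into[of f D ell2] f_inv_into_f[of f D ell2] by (auto simp: S_def)
  have SD: "S (D u) = u" if "u \<in> ell2" for u
    unfolding S_def using inv_into_f_f[OF inj that] .
  have "bounded_operator ell2 ell2_norm ell2 ell2_norm S"
    unfolding bounded_operator_def
  proof (intro conjI ballI allI exI)
    fix u w :: "('a, 'n) gfun" and c assume u: "u \<in> ell2" 
    show "S u \<in> ell2" by (rule Sin[OF u])
    show "S (scaleC c u) = scaleC c (S u)"
      using SD[of "scaleC c (S u)"] Sin[OF u] DS[OF u] linear_on_scale[OF Dlin Sin[OF u]]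
        complex_vector.subspace_scale[OF subspace_ell2 Sin[OF u], of c] by simp
    show "ell2_norm (S u) \<le> inverse b * ell2_norm u"
      using lower[OF Sin[OF u]] b by (simp add: DS[OF u] field_simps)
    assume w: "w \<in> ell2"
    show "S (u + w) = S u + S w"
      using SD[of "S u + S w"] Sin[OF u] DS[OF u] Sin[OF w] DS[OF w] linear_on_add[OF Dlin Sin[OF u] Sin[OF w]]
        complex_vector.subspace_add[OF subspace_ell2 Sin[OF u] Sin[OF w]] by simp
  qed
  then show ?thesis using SD DS by (auto simp: spectrum_def D_def)
qed

section \<open>Sequences on a half-line\<close>

definition moment_summable :: "nat \<Rightarrow> (nat \<Rightarrow> complex) \<Rightarrow> bool" where
  "moment_summable p f \<longleftrightarrow> (\<lambda>m. real (Suc m) ^ p * cmod (f m)) summable_on UNIV"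

definition moment :: "nat \<Rightarrow> (nat \<Rightarrow> complex) \<Rightarrow> complex" where
  "moment p f = (\<Sum>\<^sub>\<infinity>m. of_nat (Suc m) ^ p * f m)"

text \<open>Zero-energy Green function of the half-line with a Dirichlet condition at the missing
  point 0; the index \<open>k\<close> stands for the position \<open>k + 1\<close>.\<close>

definition green :: "(nat \<Rightarrow> complex) \<Rightarrow> nat \<Rightarrow> complex" where
  "green f k = (\<Sum>\<^sub>\<infinity>m. of_nat (min (Suc k) (Suc m)) * f m)"

text \<open>The subtraction is truncated, so only the terms with m > k contribute. As min {k + 1, m
  + 1} = (m + 1) - (m - k) with this subtraction, \<open>tail\<close> is the decaying part that
  separates \<open>green\<close> from its limit, the first moment.\<close>

definition tail :: "(nat \<Rightarrow> complex) \<Rightarrow> nat \<Rightarrow> complex" where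
  "tail f k = (\<Sum>\<^sub>\<infinity>m. of_nat (m - k) * f m)"

lemma weighted_abs_summable:
  assumes f: "moment_summable p f" and a: "\<And>m. cmod (a m) \<le> C * real (Suc m) ^ p"
  shows "(\<lambda>m. cmod (a m * f m)) summable_on UNIV"
proof (rule summable_on_comparison_test)
  show "(\<lambda>m. C * (real (Suc m) ^ p * cmod (f m))) summable_on UNIV"
    using f by (intro summable_on_cmult_right) (simp add: moment_summable_def)
  show "cmod (a m * f m) \<le> C * (real (Suc m) ^ p * cmod (f m))" for m
    using mult_right_mono[OF a, of "cmod (f m)" m] by (simp add: norm_mult mult.assoc)
qed auto

lemmas weighted_summable = abs_summable_summable[OF weighted_abs_summable]

lemma moment_summable_mono:
  assumes "moment_summable q f" "p \<le> q"
  shows "moment_summable p f"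
proof -
  have "(\<lambda>m. cmod (of_nat (Suc m) ^ p * f m)) summable_on UNIV"
    using assms by (intro weighted_abs_summable[where C = 1 and p = q])
      (auto simp: norm_power simp del: of_nat_Suc intro!: power_increasing)
  then show ?thesis by (simp add: moment_summable_def norm_mult norm_power del: of_nat_Suc)
qed

lemma moment_term_summable:
  assumes "moment_summable q f" "p \<le> q"
  shows "(\<lambda>m. of_nat (Suc m) ^ p * f m) summable_on UNIV"
  using moment_summable_mono[OF assms]
  by (intro weighted_summable[where C = 1 and p = p]) (auto simp: norm_power simp del: of_nat_Suc)

lemma green_has_sum:
  assumes "moment_summable 0 f"
  shows "((\<lambda>m. of_nat (min (Suc k) (Suc m)) * f m) has_sum green f k) UNIV"
  unfolding green_def
  by (rule has_sum_infsum, rule weighted_summable[OF assms, where C = "real (Suc k)"])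
    (auto simp del: min_Suc_Suc of_nat_Suc)

lemma tail_has_sum:
  assumes "moment_summable 1 f"
  shows "((\<lambda>m. of_nat (m - k) * f m) has_sum tail f k) UNIV"
  unfolding tail_def
  by (rule has_sum_infsum, rule weighted_summable[OF assms, where C = 1]) auto

lemma green_0: "green f 0 = moment 0 f"
  by (simp add: green_def moment_def)

text \<open>As a function of k, min {k + 1, m + 1} is linear except for a kink at k = m, so its
  negative second difference is the unit mass there. At k = 0 the missing neighbour would carry min
  {0, m + 1} = 0, in agreement with \<open>h_ray\<close>.\<close>

lemma h_ray_green:
  assumes "moment_summable 0 f"
  shows "h_ray (green f) k = f k"
proof (cases k)
  case 0
  have "((\<lambda>m. 2 * (of_nat (min (Suc 0) (Suc m)) * f m) + (-1) * (of_nat (min (Suc 1) (Suc m)) * f m))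
      has_sum (2 * green f 0 + (-1) * green f 1)) UNIV"
    by (intro has_sum_add has_sum_cmult_right green_has_sum assms)
  also have "(\<lambda>m. 2 * (of_nat (min (Suc 0) (Suc m)) * f m) + (-1) * (of_nat (min (Suc 1) (Suc m)) * f m))
      = (\<lambda>m::nat. if m = 0 then f 0 else 0)"
    by (auto simp: fun_eq_iff min_def algebra_simps)
  finally have "((\<lambda>m::nat. if m = 0 then f 0 else 0) has_sum (2 * green f 0 + (-1) * green f 1)) UNIV" .
  moreover have "((\<lambda>m::nat. if m = 0 then f 0 else 0) has_sum f 0) UNIV"
    by (rule has_sum_finite_neutralI[of "{0}"]) auto
  ultimately have "2 * green f 0 + (-1) * green f 1 = f 0" by (rule has_sum_unique)
  then show ?thesis using 0 by simp
next
  case (Suc j)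
  let ?F = "\<lambda>m. 2 * (of_nat (min (Suc (Suc j)) (Suc m)) * f m)
      + ((-1) * (of_nat (min (Suc (Suc (Suc j))) (Suc m)) * f m) + (-1) * (of_nat (min (Suc j) (Suc m)) * f m))"
  have "(?F has_sum (2 * green f (Suc j) + ((-1) * green f (Suc (Suc j)) + (-1) * green f j))) UNIV"
    by (intro has_sum_add has_sum_cmult_right green_has_sum assms)
  moreover have "?F m = (if m = Suc j then f m else 0)" for m
  proof -
    consider "m \<le> j" | "m = Suc j" | "m \<ge> Suc (Suc j)" by linarith
    then show ?thesis
    proof cases
      case 3
      then have "min (Suc (Suc j)) (Suc m) = Suc (Suc j)" "min (Suc (Suc (Suc j))) (Suc m) = Suc (Suc (Suc j))"
        "min (Suc j) (Suc m) = Suc j" by auto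
      then show ?thesis using 3 by (simp add: algebra_simps)
    qed (auto simp: min_def algebra_simps)
  qed
  then have "?F = (\<lambda>m. if m = Suc j then f m else 0)" by blast
  moreover have "((\<lambda>m. if m = Suc j then f m else 0) has_sum f (Suc j)) UNIV"
    by (rule has_sum_finite_neutralI[of "{Suc j}"]) auto
  ultimately have "2 * green f (Suc j) + ((-1) * green f (Suc (Suc j)) + (-1) * green f j) = f (Suc j)"
    using has_sum_unique by fastforce
  then show ?thesis using Suc by (simp add: algebra_simps)
qed

text \<open>The recursion is of second order, but its first instance involves only two values, so a
  single initial value is enough.\<close>

lemma h_ray_determined:
  assumes "\<And>k. h_ray u k = h_ray w k" "u 0 = w 0"
  shows "u k = w k"
proof (induction k rule: less_induct)
  case (less k)
  show ?case
  proof (cases k)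
    case 0 then show ?thesis using assms by simp
  next
    case (Suc j)
    show ?thesis
    proof (cases j)
      case 0 then show ?thesis using assms(1)[of 0] assms(2) Suc by simp
    next
      case (Suc i)
      then have "u j = w j" "u i = w i" using \<open>k = Suc j\<close> by (auto intro: less)
      then show ?thesis using assms(1)[of j] Suc \<open>k = Suc j\<close> by simp
    qed
  qed
qed

lemma h_ray_linear: "h_ray (\<lambda>k. u k + c * w k) k = h_ray u k + c * h_ray w k"
  by (cases k) (auto simp: algebra_simps)

lemma h_ray_identity: "h_ray (\<lambda>k. of_nat (Suc k)) k = 0"
  by (cases k) auto

text \<open>Relative to \<open>green f\<close> only a homogeneous solution remains, a multiple of
  the position \<open>k + 1\<close>. The first vertex fixes the multiple because
  \<open>green f 0 = moment 0 f\<close>; this multiple is the growth rate used throughout.\<close>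

lemma h_ray_solution:
  assumes f: "moment_summable 0 f" and u: "\<And>k. h_ray u k = f k"
  shows "u k = green f k + (u 0 - moment 0 f) * of_nat (Suc k)"
  by (rule h_ray_determined)
    (simp_all only: u h_ray_linear h_ray_green[OF f] h_ray_identity, simp_all add: green_0)

lemma green_eq_tail:
  assumes "moment_summable 1 f"
  shows "green f k = moment 1 f - tail f k"
proof -
  have "((\<lambda>m. of_nat (Suc m) * f m + (-1) * (of_nat (m - k) * f m)) has_sum (moment 1 f + (-1) * tail f k)) UNIV"
    using moment_term_summable[OF assms, of 1]
    by (intro has_sum_add has_sum_cmult_right tail_has_sum assms) (simp add: moment_def)
  also have "(\<lambda>m. of_nat (Suc m) * f m + (-1) * (of_nat (m - k) * f m))
      = (\<lambda>m. of_nat (min (Suc k) (Suc m)) * f m)"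
    by (auto simp: fun_eq_iff min_def of_nat_diff algebra_simps)
  finally show ?thesis
    using green_has_sum[OF moment_summable_mono[OF assms], of k] has_sum_unique by fastforce
qed

lemma sum_shifted: "(\<Sum>k<m. Suc k ^ p * (m - k)) \<le> Suc m ^ (p + 2)"
proof -
  have "(\<Sum>k<m. Suc k ^ p * (m - k)) \<le> (\<Sum>k<m. Suc m ^ p * Suc m)"
    by (intro sum_mono mult_mono power_mono) auto
  also have "\<dots> = Suc m ^ (p + 1) * m" by simp
  also have "\<dots> \<le> Suc m ^ (p + 1) * Suc m" by (intro mult_left_mono) auto
  finally show ?thesis by (simp add: algebra_simps)
qed

text \<open>The inner sum is taken over k, where only the terms k < m are nonzero and their total is
  at most (m + 1)^(p + 2) times |f m| by \<open>sum_shifted\<close>. This is why passing to the tail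
  costs two moments.\<close>

lemma tail_double_summable:
  assumes f: "moment_summable (p + 2) f"
  shows "(\<lambda>(k, m). cmod (of_nat (Suc k ^ p * (m - k)) * f m)) summable_on UNIV \<times> UNIV"
proof -
  let ?g = "\<lambda>(m, k). of_nat (Suc k ^ p * (m - k)) * f m"
  have hs: "((\<lambda>k. cmod (?g (m, k))) has_sum (real (\<Sum>k<m. Suc k ^ p * (m - k)) * cmod (f m))) UNIV" for m
    by (rule has_sum_finite_neutralI[of "{..<m}"])
      (auto simp: norm_mult sum_distrib_right simp del: of_nat_Suc of_nat_diff of_nat_mult of_nat_power)
  have "Infinite_Sum.abs_summable_on (?g) (UNIV \<times> UNIV)"
    unfolding Infinite_Sum.abs_summable_on_Sigma_iff
  proof (intro conjI ballI)
    show "Infinite_Sum.abs_summable_on ((\<lambda>k. ?g (m, k))) UNIV" for m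
      using hs[of m] by (rule has_sum_imp_summable)
    have eq: "(\<Sum>\<^sub>\<infinity>k. cmod (?g (m, k))) = real (\<Sum>k<m. Suc k ^ p * (m - k)) * cmod (f m)" for m
      by (rule infsumI[OF hs])
    show "Infinite_Sum.abs_summable_on ((\<lambda>m. \<Sum>\<^sub>\<infinity>k. cmod (?g (m, k)))) UNIV"
      unfolding eq
    proof (rule Infinite_Sum.abs_summable_on_comparison_test)
      show "Infinite_Sum.abs_summable_on ((\<lambda>m. real (Suc m) ^ (p + 2) * cmod (f m))) UNIV"
        using f unfolding moment_summable_def by (simp add: abs_mult del: of_nat_Suc)
      have "real (\<Sum>k<m. Suc k ^ p * (m - k)) \<le> real (Suc m) ^ (p + 2)" for m
        using of_nat_mono[OF sum_shifted[of p m], where ?'a = real] by (simp only: of_nat_power)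
      then show "norm (real (\<Sum>k<m. Suc k ^ p * (m - k)) * cmod (f m)) \<le> norm (real (Suc m) ^ (p + 2) * cmod (f m))" for m
        using mult_right_mono[of _ _ "cmod (f m)"]
        by (simp only: real_norm_def abs_of_nonneg mult_nonneg_nonneg of_nat_0_le_iff zero_le_power norm_ge_zero)
    qed
  qed
  then show ?thesis
    by (subst summable_on_swap) (simp add: case_prod_unfold)
qed

lemma moment_summable_tail:
  assumes f: "moment_summable (p + 2) f"
  shows "moment_summable p (tail f)"
proof -
  let ?g = "\<lambda>(k, m). of_nat (Suc k ^ p * (m - k)) * f m"
  have "Infinite_Sum.abs_summable_on ?g (UNIV \<times> UNIV)"
    using tail_double_summable[OF f] by (simp add: case_prod_unfold)
  then have s: "\<And>k. Infinite_Sum.abs_summable_on (\<lambda>m. ?g (k, m)) UNIV"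
    "Infinite_Sum.abs_summable_on (\<lambda>k. \<Sum>\<^sub>\<infinity>m. norm (?g (k, m))) UNIV"
    unfolding Infinite_Sum.abs_summable_on_Sigma_iff by auto
  have "Infinite_Sum.abs_summable_on (\<lambda>k. of_nat (Suc k) ^ p * tail f k) UNIV"
  proof (rule Infinite_Sum.abs_summable_on_comparison_test[OF s(2)])
    fix k
    have "(\<Sum>\<^sub>\<infinity>m. ?g (k, m)) = (\<Sum>\<^sub>\<infinity>m. of_nat (Suc k) ^ p * (of_nat (m - k) * f m))"
      by (simp add: mult.assoc)
    also have "\<dots> = of_nat (Suc k) ^ p * tail f k"
      unfolding tail_def by (rule infsum_cmult_right')
    finally show "norm (of_nat (Suc k) ^ p * tail f k) \<le> norm (\<Sum>\<^sub>\<infinity>m. norm (?g (k, m)))"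
      using norm_infsum_bound[OF s(1)[of k]] by simp
  qed
  then show ?thesis by (simp add: moment_summable_def norm_mult norm_power del: of_nat_Suc)
qed

lemma moment_tail:
  assumes f: "moment_summable (p + 2) f"
  shows "moment p (tail f) = (\<Sum>\<^sub>\<infinity>m. of_nat (\<Sum>k<m. Suc k ^ p * (m - k)) * f m)"
proof -
  let ?g = "\<lambda>k m. of_nat (Suc k ^ p * (m - k)) * f m"
  have "(\<lambda>(k, m). ?g k m) summable_on UNIV \<times> UNIV"
    by (rule abs_summable_summable) (use tail_double_summable[OF f] in \<open>simp add: case_prod_unfold\<close>)
  then have "(\<Sum>\<^sub>\<infinity>k. \<Sum>\<^sub>\<infinity>m. ?g k m) = (\<Sum>\<^sub>\<infinity>m. \<Sum>\<^sub>\<infinity>k. ?g k m)" by (rule infsum_swap_banach)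
  also have "(\<Sum>\<^sub>\<infinity>k. \<Sum>\<^sub>\<infinity>m. ?g k m) = moment p (tail f)"
    unfolding moment_def tail_def by (simp add: mult.assoc flip: infsum_cmult_right')
  finally have "moment p (tail f) = (\<Sum>\<^sub>\<infinity>m. \<Sum>\<^sub>\<infinity>k. ?g k m)" .
  moreover have "(\<Sum>\<^sub>\<infinity>k. ?g k m) = of_nat (\<Sum>k<m. Suc k ^ p * (m - k)) * f m" for m
    by (rule infsumI, rule has_sum_finite_neutralI[of "{..<m}"]) (auto simp: sum_distrib_right)
  ultimately show ?thesis by simp
qed

text \<open>The closed form ((m + 1)^2 - (m + 1)) / 2 of a sum of consecutive numbers, arranged to
  avoid division and subtraction of naturals. The next lemma is the cubic analogue ((m + 1)^3 - (m +
  1)) / 6. The denominators are those of the Taylor series of exp, which later produces a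
  cancellation.\<close>

lemma sum_triangle_0: "2 * (\<Sum>k<m. Suc k ^ 0 * (m - k)) + Suc m = Suc m ^ 2"
proof (induction m)
  case (Suc m)
  have "(\<Sum>k<m. Suc k ^ 0 * (Suc m - k)) = (\<Sum>k<m. Suc k ^ 0 * (m - k) + 1)"
    by (intro sum.cong) (auto simp: Suc_diff_le)
  then have e: "(\<Sum>k<Suc m. Suc k ^ 0 * (Suc m - k)) = (\<Sum>k<m. Suc k ^ 0 * (m - k)) + Suc m"
    by (simp add: sum.distrib sum_Suc)
  have "2 * (\<Sum>k<Suc m. Suc k ^ 0 * (Suc m - k)) + Suc (Suc m)
      = (2 * (\<Sum>k<m. Suc k ^ 0 * (m - k)) + Suc m) + 2 * Suc m + 1" unfolding e by presburger
  also have "\<dots> = Suc (Suc m) ^ 2" unfolding Suc by (simp add: power2_eq_square)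
  finally show ?case .
qed simp

lemma sum_triangle_1: "6 * (\<Sum>k<m. Suc k ^ 1 * (m - k)) + Suc m = Suc m ^ 3"
proof (induction m)
  case (Suc m)
  have s: "2 * (\<Sum>k<m. Suc k) = m * (m + 1)" by (induction m) auto
  have "(\<Sum>k<m. Suc k ^ 1 * (Suc m - k)) = (\<Sum>k<m. Suc k ^ 1 * (m - k) + Suc k)"
    by (intro sum.cong) (auto simp: Suc_diff_le)
  then have e: "(\<Sum>k<Suc m. Suc k ^ 1 * (Suc m - k)) = (\<Sum>k<m. Suc k ^ 1 * (m - k)) + (\<Sum>k<m. Suc k) + Suc m"
    unfolding sum.lessThan_Suc sum.distrib by simp
  have "6 * (\<Sum>k<Suc m. Suc k ^ 1 * (Suc m - k)) + Suc (Suc m)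
      = (6 * (\<Sum>k<m. Suc k ^ 1 * (m - k)) + Suc m) + 3 * (2 * (\<Sum>k<m. Suc k)) + 6 * Suc m + 1"
    unfolding e by presburger
  also have "\<dots> = Suc (Suc m) ^ 3" unfolding Suc s by (simp add: power3_eq_cube algebra_simps)
  finally show ?case .
qed simp

text \<open>On a half-line a bound state is the tail of the potential applied to it. This identity
  and \<open>moment_1_tail\<close> therefore express its low moments through higher moments of that
  potential term.\<close>

lemma moment_0_tail:
  assumes f: "moment_summable 2 f"
  shows "2 * moment 0 (tail f) + moment 1 f = moment 2 f"
proof -
  have h0: "((\<lambda>m. of_nat (\<Sum>k<m. Suc k ^ 0 * (m - k)) * f m) has_sum moment 0 (tail f)) UNIV"
    unfolding moment_tail[of 0 f, simplified add_0, OF f]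
  proof (rule has_sum_infsum, rule weighted_summable[OF f, where C = 1])
    show "cmod (of_nat (\<Sum>k<m. Suc k ^ 0 * (m - k))) \<le> 1 * real (Suc m) ^ 2" for m
      using of_nat_mono[OF sum_shifted[of 0 m], where ?'a = real]
      by (simp only: norm_of_nat of_nat_power mult_1 add_0)
  qed
  have "((\<lambda>m. 2 * (of_nat (\<Sum>k<m. Suc k ^ 0 * (m - k)) * f m) + of_nat (Suc m) ^ 1 * f m)
      has_sum (2 * moment 0 (tail f) + moment 1 f)) UNIV"
    using moment_term_summable[OF f, of 1]
    by (intro has_sum_add has_sum_cmult_right h0) (simp add: moment_def)
  also have "(\<lambda>m. 2 * (of_nat (\<Sum>k<m. Suc k ^ 0 * (m - k)) * f m) + of_nat (Suc m) ^ 1 * f m)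
      = (\<lambda>m. of_nat (Suc m) ^ 2 * f m)"
  proof
    fix m
    have "2 * (of_nat (\<Sum>k<m. Suc k ^ 0 * (m - k)) * f m) + of_nat (Suc m) ^ 1 * f m
       = of_nat (2 * (\<Sum>k<m. Suc k ^ 0 * (m - k)) + Suc m) * f m" by (simp add: algebra_simps)
    then show "2 * (of_nat (\<Sum>k<m. Suc k ^ 0 * (m - k)) * f m) + of_nat (Suc m) ^ 1 * f m = of_nat (Suc m) ^ 2 * f m"
      by (simp only: sum_triangle_0 of_nat_power)
  qed
  finally show ?thesis unfolding moment_def[of 2] by (rule infsumI[symmetric])
qed

lemma moment_1_tail:
  assumes f: "moment_summable 3 f"
  shows "6 * moment 1 (tail f) + moment 1 f = moment 3 f"
proof -
  have f': "moment_summable (1 + 2) f" using f by (simp add: numeral_3_eq_3)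
  have h0: "((\<lambda>m. of_nat (\<Sum>k<m. Suc k ^ 1 * (m - k)) * f m) has_sum moment 1 (tail f)) UNIV"
    unfolding moment_tail[OF f']
  proof (rule has_sum_infsum, rule weighted_summable[OF f', where C = 1])
    show "cmod (of_nat (\<Sum>k<m. Suc k ^ 1 * (m - k))) \<le> 1 * real (Suc m) ^ (1 + 2)" for m
      using of_nat_mono[OF sum_shifted[of 1 m], where ?'a = real]
      by (simp only: norm_of_nat of_nat_power mult_1)
  qed
  have "((\<lambda>m. 6 * (of_nat (\<Sum>k<m. Suc k ^ 1 * (m - k)) * f m) + of_nat (Suc m) ^ 1 * f m)
      has_sum (6 * moment 1 (tail f) + moment 1 f)) UNIV"
    using moment_term_summable[OF f, of 1]
    by (intro has_sum_add has_sum_cmult_right h0) (simp add: moment_def)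
  also have "(\<lambda>m. 6 * (of_nat (\<Sum>k<m. Suc k ^ 1 * (m - k)) * f m) + of_nat (Suc m) ^ 1 * f m)
      = (\<lambda>m. of_nat (Suc m) ^ 3 * f m)"
  proof
    fix m
    have "6 * (of_nat (\<Sum>k<m. Suc k ^ 1 * (m - k)) * f m) + of_nat (Suc m) ^ 1 * f m
       = of_nat (6 * (\<Sum>k<m. Suc k ^ 1 * (m - k)) + Suc m) * f m" by (simp add: algebra_simps)
    then show "6 * (of_nat (\<Sum>k<m. Suc k ^ 1 * (m - k)) * f m) + of_nat (Suc m) ^ 1 * f m = of_nat (Suc m) ^ 3 * f m"
      by (simp only: sum_triangle_1 of_nat_power)
  qed
  finally show ?thesis unfolding moment_def[of 3] by (rule infsumI[symmetric])
qed

text \<open>The decaying solution \<open>z\<^sup>m\<close> of the homogeneous equation, where \<open>z + 1/z = 2 + \<kappa>\<^sup>2\<close>, tests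
  the resolvent equation on a half-line and leaves only the boundary value.\<close>

lemma ray_boundary_value:
  assumes z: "cmod z < 1" "z \<noteq> 0" "(2 + \<mu>) * z = 1 + z\<^sup>2"
    and w: "\<And>k. cmod (w k) \<le> C" and f: "moment_summable 0 f"
    and eq: "\<And>k. h_ray w k + \<mu> * w k = f k"
  shows "w 0 = (\<Sum>\<^sub>\<infinity>m. z ^ Suc m * f m)"
proof -
  \<comment> \<open>Discrete Wronskian of \<open>w\<close> and the powers of \<open>z\<close>, with
    value 0 at the missing neighbour of the first vertex. The relation between \<open>z\<close> and
    \<mu> makes the tested equation telescope in it, and boundedness of \<open>w\<close> makes it
    decay.\<close>
  define D where "D m = z ^ m * w m - z ^ Suc m * (case m of 0 \<Rightarrow> 0 | Suc j \<Rightarrow> w j)" for m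
  have step: "z ^ Suc m * f m = D m - D (Suc m)" for m
  proof (cases m)
    case 0
    have "z * f 0 = (1 + z\<^sup>2) * w 0 - z * w 1" unfolding z(3)[symmetric] eq[of 0, symmetric] by (simp add: algebra_simps)
    then show ?thesis using 0 by (simp add: D_def algebra_simps power2_eq_square)
  next
    case (Suc j)
    have "z ^ Suc m * f m = z ^ m * ((1 + z\<^sup>2) * w m - z * w (Suc m) - z * w j)"
      unfolding Suc z(3)[symmetric] eq[of "Suc j", symmetric] by (simp add: algebra_simps)
    then show ?thesis using Suc by (simp add: D_def algebra_simps power2_eq_square)
  qed
  have ps: "(\<Sum>m<n. z ^ Suc m * f m) = w 0 - D n" for n
    by (induction n) (simp_all only: sum.lessThan_Suc step, simp_all add: D_def)
  have C: "C \<ge> 0" using w[of 0] norm_ge_zero[of "w 0"] by linarith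
  have "cmod (D n) \<le> 2 * C * cmod z ^ n" for n
  proof -
    have 1: "cmod (case n of 0 \<Rightarrow> 0 | Suc j \<Rightarrow> w j) \<le> C" using w C by (auto split: nat.split)
    have "cmod (D n) \<le> cmod (z ^ n * w n) + cmod (z ^ Suc n * (case n of 0 \<Rightarrow> 0 | Suc j \<Rightarrow> w j))"
      unfolding D_def by (rule norm_triangle_ineq4)
    also have "\<dots> = cmod z ^ n * cmod (w n) + cmod z ^ n * (cmod z * cmod (case n of 0 \<Rightarrow> 0 | Suc j \<Rightarrow> w j))"
      by (simp add: norm_mult norm_power)
    also have "\<dots> \<le> cmod z ^ n * C + cmod z ^ n * (1 * C)"
      using w 1 C z(1) by (intro add_mono mult_left_mono mult_mono) auto
    finally show ?thesis by simp
  qed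
  moreover have "(\<lambda>n. 2 * C * cmod z ^ n) \<longlonglongrightarrow> 2 * C * 0"
    using z(1) by (intro tendsto_intros LIMSEQ_power_zero) auto
  ultimately have "D \<longlonglongrightarrow> 0"
    by (intro Lim_null_comparison[of D "\<lambda>n. 2 * C * cmod z ^ n"]) auto
  then have "(\<lambda>m. z ^ Suc m * f m) sums (w 0 - 0)"
    unfolding sums_def ps by (intro tendsto_intros)
  moreover have "(\<lambda>m. z ^ Suc m * f m) summable_on UNIV"
  proof (rule weighted_summable[OF f, where C = 1])
    show "cmod (z ^ Suc m) \<le> 1 * real (Suc m) ^ 0" for m
      using z(1) by (auto simp: norm_power norm_mult intro!: mult_le_one power_le_one)
  qed
  then have "(\<lambda>m. z ^ Suc m * f m) sums (\<Sum>\<^sub>\<infinity>m. z ^ Suc m * f m)"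
    by (intro has_sum_imp_sums has_sum_infsum)
  ultimately show ?thesis using sums_unique2 by fastforce
qed

text \<open>Near zero this is Taylor's bound; for |w| > 1 each term is dominated by |w|^4 because
  the exponential is at most 1 in modulus. Validity on the whole half-plane lets w = (m + 1) \<phi>
  be inserted for all m at once.\<close>

lemma exp_taylor_half_plane:
  assumes "Re w \<ge> 0"
  shows "cmod (exp (- w) - (1 - w + w\<^sup>2 / 2 - w ^ 3 / 6)) \<le> 4 * cmod w ^ 4"
proof (cases "cmod w \<le> 1")
  case True
  have "cmod (exp (- w) - (\<Sum>k\<le>3. (- w) ^ k / fact k)) \<le> exp \<bar>Re (- w)\<bar> * cmod (- w) ^ Suc 3 / fact 3"
    by (rule Taylor_exp)
  also have "(\<Sum>k\<le>3. (- w) ^ k / fact k) = 1 - w + w\<^sup>2 / 2 - w ^ 3 / 6"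
    by (simp add: eval_nat_numeral fact_numeral)
  also have "exp \<bar>Re (- w)\<bar> * cmod (- w) ^ Suc 3 / fact 3 \<le> 3 * cmod w ^ 4 / fact 3"
  proof -
    have "exp \<bar>Re (- w)\<bar> \<le> exp 1" using abs_Re_le_cmod[of "- w"] True by simp
    also have "exp (1::real) \<le> 3" by (rule exp_le)
    finally show ?thesis by (intro divide_right_mono mult_mono) auto
  qed
  also have "\<dots> \<le> 4 * cmod w ^ 4" by (simp add: fact_numeral)
  finally show ?thesis .
next
  case False
  have p: "cmod w ^ k \<le> cmod w ^ 4" if "k \<le> 4" for k using that False by (intro power_increasing) auto
  have "cmod (exp (- w) - (1 - w + w\<^sup>2 / 2 - w ^ 3 / 6))
      \<le> cmod (exp (- w)) + (cmod 1 + cmod w + cmod (w\<^sup>2 / 2) + cmod (w ^ 3 / 6))"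
    by (intro order_trans[OF norm_triangle_ineq4] add_mono order_refl order_trans[OF norm_triangle_ineq])
  \<comment> \<open>The five terms contribute 1 + 1 + 1 + 1/2 + 1/6 < 4.\<close>
  also have "\<dots> \<le> 4 * cmod w ^ 4"
  proof -
    have "cmod (exp (- w)) \<le> 1" using assms by simp
    moreover have "cmod (w\<^sup>2 / 2) = cmod w ^ 2 / 2" "cmod (w ^ 3 / 6) = cmod w ^ 3 / 6" "cmod 1 = 1"
      by (simp_all add: norm_power norm_divide)
    moreover have "1 \<le> cmod w ^ 4" "cmod w \<le> cmod w ^ 4" using p[of 0] p[of 1] by simp_all
    ultimately show ?thesis using p[of 2] p[of 3] by linarith
  qed
  finally show ?thesis .
qed

section \<open>The weighted spaces and the free operator\<close>

lemma vertex_UNIV: "UNIV = range Core \<union> (\<Union>\<alpha>. range (Ray \<alpha>))"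
proof -
  have "y \<in> range Core \<union> (\<Union>\<alpha>. range (Ray \<alpha>))" for y by (cases y) auto
  then show ?thesis by auto
qed

lemma has_sum_vertex:
  fixes f :: "('a::finite, 'n::finite) vertex \<Rightarrow> 'b::topological_comm_monoid_add"
  assumes "\<And>\<alpha>. ((\<lambda>k. f (Ray \<alpha> k)) has_sum S \<alpha>) UNIV"
  shows "(f has_sum ((\<Sum>x\<in>UNIV. f (Core x)) + (\<Sum>\<alpha>\<in>UNIV. S \<alpha>))) UNIV"
  unfolding vertex_UNIV
proof (rule has_sum_Un_disjoint)
  have "((f \<circ> Core) has_sum (\<Sum>x\<in>UNIV. f (Core x))) UNIV"
    using has_sum_finite[of UNIV "f \<circ> Core"] by (simp add: o_def)
  then show "(f has_sum (\<Sum>x\<in>UNIV. f (Core x))) (range Core)"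
    by (subst has_sum_reindex) (auto simp: inj_on_def)
  show "(f has_sum (\<Sum>\<alpha>\<in>UNIV. S \<alpha>)) (\<Union>\<alpha>. range (Ray \<alpha>))"
  proof (rule sum_has_sum)
    show "(f has_sum S \<alpha>) (range (Ray \<alpha>))" for \<alpha>
      using assms[of \<alpha>] by (subst has_sum_reindex) (auto simp: inj_on_def o_def)
  qed auto
qed auto

lemma summable_vertex_iff:
  fixes f :: "('a::finite, 'n::finite) vertex \<Rightarrow> 'b::banach"
  shows "f summable_on UNIV \<longleftrightarrow> (\<forall>\<alpha>. (\<lambda>k. f (Ray \<alpha> k)) summable_on UNIV)"
proof
  assume f: "f summable_on UNIV"
  show "\<forall>\<alpha>. (\<lambda>k. f (Ray \<alpha> k)) summable_on UNIV"
  proof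
    fix \<alpha>
    have "f summable_on range (Ray \<alpha>)" by (rule summable_on_subset_banach[OF f]) simp
    then show "(\<lambda>k. f (Ray \<alpha> k)) summable_on UNIV"
      by (subst (asm) summable_on_reindex) (auto simp: inj_on_def o_def)
  qed
next
  assume "\<forall>\<alpha>. (\<lambda>k. f (Ray \<alpha> k)) summable_on UNIV"
  then have "((\<lambda>k. f (Ray \<alpha> k)) has_sum infsum (\<lambda>k. f (Ray \<alpha> k)) UNIV) UNIV" for \<alpha> by auto
  from has_sum_vertex[OF this] show "f summable_on UNIV" by (rule has_sum_imp_summable)
qed

lemma infsum_vertex:
  fixes f :: "('a::finite, 'n::finite) vertex \<Rightarrow> 'b::banach"
  assumes "f summable_on UNIV"
  shows "infsum f UNIV = (\<Sum>x\<in>UNIV. f (Core x)) + (\<Sum>\<alpha>\<in>UNIV. \<Sum>\<^sub>\<infinity>k. f (Ray \<alpha> k))"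
  by (rule infsumI, rule has_sum_vertex) (use assms in \<open>auto simp: summable_vertex_iff\<close>)

lemma one_plus_square_nonzero: "1 + (x :: real)\<^sup>2 \<noteq> 0"
  using zero_le_power2[of x] by linarith

lemma weight_pos: "weight s y > 0"
  by (cases y) (auto simp: one_plus_square_nonzero)

lemma weight_mono: "s \<le> t \<Longrightarrow> weight s y \<le> weight t y"
  by (cases y) (auto intro!: powr_mono)

lemma weight_0: "weight 0 y = 1"
  by (cases y) (auto simp: one_plus_square_nonzero)

lemma weight_ge_1: "0 \<le> s \<Longrightarrow> 1 \<le> weight s y"
  using weight_mono[of 0 s y] by (simp add: weight_0)

lemma weight_uminus: "weight (- s) y = inverse (weight s y)"
  by (cases y) (auto simp: powr_minus)

lemma weight_Ray: "weight (real p) (Ray \<alpha> k) = sqrt (1 + (real (Suc k))\<^sup>2) ^ p"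
proof -
  have "(1 + (real (Suc k))\<^sup>2) powr (real p / 2) = ((1 + (real (Suc k))\<^sup>2) powr (1 / 2)) powr real p"
    by (simp add: powr_powr)
  also have "\<dots> = sqrt (1 + (real (Suc k))\<^sup>2) ^ p"
    by (subst powr_half_sqrt) (auto intro!: powr_realpow add_pos_nonneg)
  finally show ?thesis by simp
qed

lemma weight_Ray_bounds:
  "real (Suc k) ^ p \<le> weight (real p) (Ray \<alpha> k)" "weight (real p) (Ray \<alpha> k) \<le> 2 ^ p * real (Suc k) ^ p"
proof -
  have "real (Suc k) \<le> sqrt (1 + (real (Suc k))\<^sup>2)" by (rule real_le_rsqrt) simp
  then show "real (Suc k) ^ p \<le> weight (real p) (Ray \<alpha> k)"
    unfolding weight_Ray by (intro power_mono) auto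
  have "(1::real) \<le> (real (Suc k))\<^sup>2" by (rule one_le_power) simp
  moreover have "(2 * real (Suc k))\<^sup>2 = 4 * (real (Suc k))\<^sup>2" by (simp only: power_mult_distrib) simp
  ultimately have "1 + (real (Suc k))\<^sup>2 \<le> (2 * real (Suc k))\<^sup>2" by linarith
  then have "sqrt (1 + (real (Suc k))\<^sup>2) \<le> 2 * real (Suc k)" by (intro real_le_lsqrt) auto
  then show "weight (real p) (Ray \<alpha> k) \<le> 2 ^ p * real (Suc k) ^ p"
    unfolding weight_Ray power_mult_distrib[symmetric] by (intro power_mono) auto
qed

text \<open>The finite core imposes no condition, and on a half-line the weight is comparable to a
  power of the position by \<open>weight_Ray_bounds\<close>. Integer exponents thus reduce to
  moments.\<close>

lemma Lsp_iff:
  fixes u :: "('a::finite, 'n::finite) gfun"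
  shows "u \<in> Lsp (real p) \<longleftrightarrow> (\<forall>\<alpha>. moment_summable p (\<lambda>k. u (Ray \<alpha> k)))"
proof -
  have "(\<lambda>k. weight (real p) (Ray \<alpha> k :: ('a, 'n) vertex) * cmod (u (Ray \<alpha> k))) summable_on UNIV
      \<longleftrightarrow> moment_summable p (\<lambda>k. u (Ray \<alpha> k))" (is "?f summable_on _ \<longleftrightarrow> _") for \<alpha>
  proof
    assume "?f summable_on UNIV"
    then show "moment_summable p (\<lambda>k. u (Ray \<alpha> k))"
      unfolding moment_summable_def
      by (rule summable_on_comparison_test) (auto intro!: mult_right_mono weight_Ray_bounds simp del: weight.simps of_nat_Suc)
  next
    assume "moment_summable p (\<lambda>k. u (Ray \<alpha> k))"
    then have "(\<lambda>k. 2 ^ p * (real (Suc k) ^ p * cmod (u (Ray \<alpha> k)))) summable_on UNIV"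
      unfolding moment_summable_def by (rule summable_on_cmult_right)
    then show "?f summable_on UNIV"
    proof (rule summable_on_comparison_test)
      show "?f k \<le> 2 ^ p * (real (Suc k) ^ p * cmod (u (Ray \<alpha> k)))" for k
        unfolding mult.assoc[symmetric] by (intro mult_right_mono weight_Ray_bounds) simp
    qed (auto intro!: mult_nonneg_nonneg less_imp_le[OF weight_pos] simp del: weight.simps)
  qed
  then show ?thesis by (simp only: Lsp_def mem_Collect_eq summable_vertex_iff) 
qed

lemma Lsp_iff_0:
  fixes u :: "('a::finite, 'n::finite) gfun"
  shows "u \<in> Lsp 0 \<longleftrightarrow> (\<forall>\<alpha>. moment_summable 0 (\<lambda>k. u (Ray \<alpha> k)))"
  using Lsp_iff[of u 0] by simp

lemma Lsp_mono: "s \<le> t \<Longrightarrow> u \<in> Lsp t \<Longrightarrow> u \<in> Lsp s"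
  unfolding Lsp_def mem_Collect_eq
  by (erule summable_on_comparison_test) (auto intro!: mult_right_mono weight_mono mult_nonneg_nonneg less_imp_le[OF weight_pos])

lemma subspace_Lsp: "complex_vector.subspace (Lsp s)"
  unfolding complex_vector.subspace_def
proof (intro conjI ballI allI)
  fix u w :: "('a, 'n) gfun" and c assume u: "u \<in> Lsp s" 
  then have "(\<lambda>y. cmod c * (weight s y * cmod (u y))) summable_on UNIV"
    unfolding Lsp_def mem_Collect_eq by (rule summable_on_cmult_right)
  then show "scaleC c u \<in> Lsp s" by (simp add: Lsp_def norm_mult mult.left_commute)
  assume "w \<in> Lsp s"
  with u have "(\<lambda>y. weight s y * cmod (u y) + weight s y * cmod (w y)) summable_on UNIV"
    by (intro summable_on_add) (auto simp: Lsp_def)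
  then show "u + w \<in> Lsp s"
    unfolding Lsp_def mem_Collect_eq
  proof (rule summable_on_comparison_test)
    show "weight s y * cmod ((u + w) y) \<le> weight s y * cmod (u y) + weight s y * cmod (w y)" for y
      unfolding distrib_left[symmetric] plus_fun_apply
      by (intro mult_left_mono norm_triangle_ineq less_imp_le[OF weight_pos])
  qed (auto intro!: mult_nonneg_nonneg less_imp_le[OF weight_pos])
qed (simp add: Lsp_def)

lemma Ldual_iff: "u \<in> Ldual s \<longleftrightarrow> (\<exists>C. \<forall>y. cmod (u y) \<le> C * weight s y)"
proof -
  have "weight (- s) y * cmod (u y) \<le> C \<longleftrightarrow> cmod (u y) \<le> C * weight s y" for C y
    using weight_pos[of s y] by (simp add: weight_uminus field_simps)
  then show ?thesis by (auto simp: Ldual_def bdd_above_def)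
qed

lemma LdualI: "(\<And>y. cmod (u y) \<le> C * weight s y) \<Longrightarrow> u \<in> Ldual s"
  by (auto simp: Ldual_iff)

lemma Ldual_bound:
  assumes "u \<in> Ldual s"
  shows "cmod (u y) \<le> Ldual_norm s u * weight s y"
proof -
  have "weight (- s) y * cmod (u y) \<le> Ldual_norm s u"
    unfolding Ldual_norm_def using assms by (intro cSUP_upper) (auto simp: Ldual_def)
  then show ?thesis using weight_pos[of s y] by (simp add: weight_uminus field_simps)
qed

lemma Ldual_norm_le:
  assumes "\<And>y. cmod (u y) \<le> C * weight s y"
  shows "Ldual_norm s u \<le> C"
  unfolding Ldual_norm_def
proof (rule cSUP_least)
  show "weight (- s) y * cmod (u y) \<le> C" for y
    using assms[of y] weight_pos[of s y] by (simp add: weight_uminus field_simps)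
qed simp

lemma Ldual_norm_nonneg:
  fixes u :: "('a, 'n) gfun"
  assumes u: "u \<in> Ldual s"
  shows "0 \<le> Ldual_norm s u"
proof -
  fix y :: "('a, 'n) vertex"
  have "0 \<le> Ldual_norm s u * weight s y" using Ldual_bound[OF u, of y] norm_ge_zero order_trans by blast
  then show ?thesis using weight_pos[of s y] by (simp add: zero_le_mult_iff)
qed

lemma Ldual_mono:
  assumes "s \<le> t" "u \<in> Ldual s"
  shows "u \<in> Ldual t" "Ldual_norm t u \<le> Ldual_norm s u"
proof -
  have b: "cmod (u y) \<le> Ldual_norm s u * weight t y" for y
    using Ldual_bound[OF assms(2)] mult_left_mono[OF weight_mono[OF assms(1)] Ldual_norm_nonneg[OF assms(2)]]
    by (rule order_trans)
  show "u \<in> Ldual t" by (rule LdualI[OF b])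
  show "Ldual_norm t u \<le> Ldual_norm s u" by (rule Ldual_norm_le[OF b])
qed

lemma subspace_Ldual: "complex_vector.subspace (Ldual s)"
  unfolding complex_vector.subspace_def
proof (intro conjI ballI allI)
  fix u w :: "('a, 'n) gfun" and c assume u: "u \<in> Ldual s" 
  have "cmod (scaleC c u y) \<le> (cmod c * Ldual_norm s u) * weight s y" for y
    using mult_left_mono[OF Ldual_bound[OF u, of y], of "cmod c"] by (simp add: norm_mult mult.assoc)
  then show "scaleC c u \<in> Ldual s" by (rule LdualI)
  assume w: "w \<in> Ldual s"
  have "cmod ((u + w) y) \<le> (Ldual_norm s u + Ldual_norm s w) * weight s y" for y
    using norm_triangle_ineq[of "u y" "w y"] Ldual_bound[OF u, of y] Ldual_bound[OF w, of y]
    by (simp add: distrib_right)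
  then show "u + w \<in> Ldual s" by (rule LdualI)
qed (auto intro!: LdualI[of _ 0])

lemma Lnorm_nonneg: "0 \<le> Lnorm s u"
  unfolding Lnorm_def by (intro infsum_nonneg mult_nonneg_nonneg less_imp_le[OF weight_pos] norm_ge_zero)

lemma Lsp_bound:
  assumes "u \<in> Lsp s"
  shows "weight s y * cmod (u y) \<le> Lnorm s u"
proof -
  have "(\<Sum>y\<in>{y}. weight s y * cmod (u y)) \<le> Lnorm s u"
    unfolding Lnorm_def using assms
    by (intro finite_sum_le_infsum) (auto simp: Lsp_def intro!: mult_nonneg_nonneg less_imp_le[OF weight_pos])
  then show ?thesis by simp
qed

lemma Lsp_sub_Ldual: "u \<in> Lsp s \<Longrightarrow> 0 \<le> s \<Longrightarrow> 0 \<le> t \<Longrightarrow> u \<in> Ldual t"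
proof (rule LdualI[of _ "Lnorm s u"])
  fix y assume u: "u \<in> Lsp s" and s: "0 \<le> s" "0 \<le> t"
  have "1 * cmod (u y) \<le> weight s y * cmod (u y)" by (intro mult_right_mono weight_ge_1 s) simp
  also have "\<dots> \<le> Lnorm s u * 1" using Lsp_bound[OF u, of y] by simp
  also have "\<dots> \<le> Lnorm s u * weight t y" by (intro mult_left_mono weight_ge_1 s Lnorm_nonneg)
  finally show "cmod (u y) \<le> Lnorm s u * weight t y" by simp
qed

lemma Lsp_sub_ell2:
  assumes u: "u \<in> Lsp s" and s: "0 \<le> s"
  shows "u \<in> ell2"
  unfolding ell2_def mem_Collect_eq
proof (rule summable_on_comparison_test)
  have u0: "u \<in> Lsp 0" using Lsp_mono[OF s u] .
  then have "(\<lambda>y. cmod (u y)) summable_on UNIV" by (simp add: Lsp_def weight_0)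
  then show "(\<lambda>y. Lnorm 0 u * cmod (u y)) summable_on UNIV" by (rule summable_on_cmult_right)
  show "(cmod (u y))\<^sup>2 \<le> Lnorm 0 u * cmod (u y)" for y
    using Lsp_bound[OF u0, of y] by (simp add: power2_eq_square weight_0 mult_right_mono)
qed auto

lemma ell2_bound: "u \<in> ell2 \<Longrightarrow> cmod (u y) \<le> ell2_norm u"
  using norm_l2_ge_coordinate[of "Abs_l2 u" y] by (simp add: norm_eq_ell2_norm Rep_Abs_ell2)

lemma ell2_norm_nonneg: "0 \<le> ell2_norm u"
  by (simp add: ell2_norm_def infsum_nonneg)

lemma ell2_sub_Ldual:
  fixes u :: "('a, 'n) gfun"
  assumes u: "u \<in> ell2" and t: "0 \<le> t"
  shows "u \<in> Ldual t"
proof (rule LdualI)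
  fix y :: "('a, 'n) vertex"
  have "ell2_norm u * 1 \<le> ell2_norm u * weight t y"
    by (intro mult_left_mono weight_ge_1 t ell2_norm_nonneg)
  then show "cmod (u y) \<le> ell2_norm u * weight t y" using ell2_bound[OF u, of y] by simp
qed

lemma
  assumes u: "u \<in> Ldual s" and w: "w \<in> Lsp s"
  shows pairing_abs_summable: "(\<lambda>y. cmod (cnj (u y) * w y)) summable_on UNIV"
    and pairing_bound: "cmod (pairing u w) \<le> Ldual_norm s u * Lnorm s w"
proof -
  have hs: "((\<lambda>y. Ldual_norm s u * (weight s y * cmod (w y))) has_sum (Ldual_norm s u * Lnorm s w)) UNIV"
    using w unfolding Lnorm_def by (intro has_sum_cmult_right has_sum_infsum) (simp add: Lsp_def)
  have le: "cmod (cnj (u y) * w y) \<le> Ldual_norm s u * (weight s y * cmod (w y))" for y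
    using mult_right_mono[OF Ldual_bound[OF u, of y], of "cmod (w y)"] by (simp add: norm_mult mult.assoc)
  show s: "(\<lambda>y. cmod (cnj (u y) * w y)) summable_on UNIV"
    by (rule summable_on_comparison_test[OF has_sum_imp_summable[OF hs] le]) auto
  show "cmod (pairing u w) \<le> Ldual_norm s u * Lnorm s w"
    unfolding pairing_def by (rule norm_infsum_le[OF has_sum_infsum[OF abs_summable_summable[OF s]] hs le])
qed

lemma pairing_summable: "u \<in> Ldual s \<Longrightarrow> w \<in> Lsp s \<Longrightarrow> (\<lambda>y. cnj (u y) * w y) summable_on UNIV"
  by (rule abs_summable_summable[OF pairing_abs_summable])

lemma pairing_summable': "u \<in> Lsp s \<Longrightarrow> w \<in> Ldual s \<Longrightarrow> (\<lambda>y. cnj (u y) * w y) summable_on UNIV"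
  using pairing_summable[of w s u] summable_on_cnj_iff[of "\<lambda>y. cnj (w y) * u y" UNIV]
  by (simp add: mult.commute)

lemma pairing_linear: "u \<in> Ldual s \<Longrightarrow> linear_on (Lsp s) (pairing u)"
  by (rule linear_onI) (simp_all add: pairing_def ring_distribs infsum_add pairing_summable
      mult.left_commute infsum_cmult_right)

lemma pairing_linear': "u \<in> Lsp s \<Longrightarrow> linear_on (Ldual s) (pairing u)"
  by (rule linear_onI) (simp_all add: pairing_def ring_distribs infsum_add pairing_summable'
      mult.left_commute infsum_cmult_right)

lemma pairing_vertex:
  fixes u w :: "('a::finite, 'n::finite) gfun"
  assumes "(\<lambda>y. cnj (u y) * w y) summable_on UNIV"
  shows "pairing u w = (\<Sum>x\<in>UNIV. cnj (u (Core x)) * w (Core x))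
    + (\<Sum>\<alpha>\<in>UNIV. \<Sum>\<^sub>\<infinity>k. cnj (u (Ray \<alpha> k)) * w (Ray \<alpha> k))"
  unfolding pairing_def by (rule infsum_vertex[OF assms])

lemma ray_sum_le_Lnorm:
  fixes g :: "('a::finite, 'n::finite) gfun"
  assumes g: "g \<in> Lsp (real p)" and i: "i \<le> p"
  shows "(\<Sum>\<^sub>\<infinity>m. real (Suc m) ^ i * cmod (g (Ray \<alpha> m))) \<le> Lnorm (real p) g"
proof -
  have s: "(\<lambda>y. weight (real p) y * cmod (g y)) summable_on UNIV" using g by (simp add: Lsp_def)
  have sa: "(\<lambda>m. weight (real p) (Ray \<alpha> m :: ('a, 'n) vertex) * cmod (g (Ray \<alpha> m))) summable_on UNIV" for \<alpha>
    using s unfolding summable_vertex_iff by blast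
  have n: "0 \<le> weight (real p) y * cmod (g y)" for y
    by (intro mult_nonneg_nonneg less_imp_le[OF weight_pos]) simp
  have "(\<Sum>\<^sub>\<infinity>m. real (Suc m) ^ i * cmod (g (Ray \<alpha> m)))
      \<le> (\<Sum>\<^sub>\<infinity>m. weight (real p) (Ray \<alpha> m :: ('a, 'n) vertex) * cmod (g (Ray \<alpha> m)))"
  proof (rule infsum_mono[OF _ sa])
    show "(\<lambda>m. real (Suc m) ^ i * cmod (g (Ray \<alpha> m))) summable_on UNIV"
      using moment_summable_mono[OF _ i, of "\<lambda>m. g (Ray \<alpha> m)"] g unfolding Lsp_iff moment_summable_def by blast
    fix m
    have "real (Suc m) ^ i \<le> real (Suc m) ^ p" using i by (intro power_increasing) auto
    also have "\<dots> \<le> weight (real p) (Ray \<alpha> m :: ('a, 'n) vertex)" by (rule weight_Ray_bounds)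
    finally show "real (Suc m) ^ i * cmod (g (Ray \<alpha> m)) \<le> weight (real p) (Ray \<alpha> m :: ('a, 'n) vertex) * cmod (g (Ray \<alpha> m))"
      by (intro mult_right_mono) auto
  qed
  also have "\<dots> \<le> (\<Sum>\<alpha>\<in>UNIV. \<Sum>\<^sub>\<infinity>m. weight (real p) (Ray \<alpha> m :: ('a, 'n) vertex) * cmod (g (Ray \<alpha> m)))"
    by (rule member_le_sum) (auto intro!: infsum_nonneg n simp del: weight.simps)
  also have "\<dots> \<le> Lnorm (real p) g"
    unfolding Lnorm_def infsum_vertex[OF s] using n by (simp add: sum_nonneg del: weight.simps)
  finally show ?thesis .
qed

section \<open>The half-line operator on square-summable sequences\<close>

lemma has_sum_shift:
  fixes g :: "nat \<Rightarrow> 'b::banach"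
  assumes "(g has_sum S) UNIV"
  shows "((\<lambda>k. case k of 0 \<Rightarrow> 0 | Suc j \<Rightarrow> g j) has_sum S) UNIV"
proof -
  have "((\<lambda>k. case k of 0 \<Rightarrow> 0 | Suc j \<Rightarrow> g j) has_sum S) (range Suc)"
    using assms by (subst has_sum_reindex) (auto simp: o_def)
  then show ?thesis
    by (subst has_sum_cong_neutral[where T = "range Suc" and g = "\<lambda>k. case k of 0 \<Rightarrow> 0 | Suc j \<Rightarrow> g j"])
      (auto split: nat.split simp: image_iff)
qed

lemma summable_shift_left:
  fixes g :: "nat \<Rightarrow> 'b::banach"
  assumes "g summable_on UNIV"
  shows "(\<lambda>k. g (Suc k)) summable_on UNIV"
proof -
  have "g summable_on range Suc" by (rule summable_on_subset_banach[OF assms]) simp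
  then show ?thesis by (subst (asm) summable_on_reindex) (auto simp: o_def)
qed

lemma h_ray_case: "h_ray u k = 2 * u k - u (Suc k) - (case k of 0 \<Rightarrow> 0 | Suc j \<Rightarrow> u j)"
  by (cases k) auto

text \<open>Both sides equal 2 A - P - Q. An index shift accounts for the exchange of the two
  neighbour terms, and no boundary term arises because the missing neighbour contributes
  zero.\<close>

lemma h_ray_symmetric:
  assumes u: "(\<lambda>k. (cmod (u k))\<^sup>2) summable_on UNIV" and w: "(\<lambda>k. (cmod (w k))\<^sup>2) summable_on UNIV"
  shows "(\<Sum>\<^sub>\<infinity>k. cnj (h_ray u k) * w k) = (\<Sum>\<^sub>\<infinity>k. cnj (u k) * h_ray w k)"
proof -
  have prod: "(\<lambda>k. cnj (a k) * b k) summable_on UNIV"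
    if "(\<lambda>k. (cmod (a k))\<^sup>2) summable_on UNIV" "(\<lambda>k. (cmod (b k))\<^sup>2) summable_on UNIV" for a b :: "nat \<Rightarrow> complex"
    by (rule abs_summable_summable, rule square_summable_product) (use that in auto)
  define A P Q where "A = (\<Sum>\<^sub>\<infinity>k. cnj (u k) * w k)" and "P = (\<Sum>\<^sub>\<infinity>k. cnj (u (Suc k)) * w k)"
    and "Q = (\<Sum>\<^sub>\<infinity>k. cnj (u k) * w (Suc k))"
  have A: "((\<lambda>k. cnj (u k) * w k) has_sum A) UNIV"
    unfolding A_def by (intro has_sum_infsum prod u w)
  have P: "((\<lambda>k. cnj (u (Suc k)) * w k) has_sum P) UNIV"
    unfolding P_def by (intro has_sum_infsum prod summable_shift_left[OF u] w)
  have Q: "((\<lambda>k. cnj (u k) * w (Suc k)) has_sum Q) UNIV"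
    unfolding Q_def by (intro has_sum_infsum prod summable_shift_left[OF w] u)
  have "((\<lambda>k. 2 * (cnj (u k) * w k) + ((-1) * (cnj (u (Suc k)) * w k)
       + (-1) * (case k of 0 \<Rightarrow> 0 | Suc j \<Rightarrow> cnj (u j) * w (Suc j)))) has_sum (2 * A + ((-1) * P + (-1) * Q))) UNIV"
    by (intro has_sum_add has_sum_cmult_right has_sum_shift A P Q)
  also have "(\<lambda>k. 2 * (cnj (u k) * w k) + ((-1) * (cnj (u (Suc k)) * w k)
       + (-1) * (case k of 0 \<Rightarrow> 0 | Suc j \<Rightarrow> cnj (u j) * w (Suc j)))) = (\<lambda>k. cnj (h_ray u k) * w k)"
    by (auto simp: h_ray_case algebra_simps split: nat.split)
  finally have 1: "((\<lambda>k. cnj (h_ray u k) * w k) has_sum (2 * A + ((-1) * P + (-1) * Q))) UNIV" .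
  have "((\<lambda>k. 2 * (cnj (u k) * w k) + ((-1) * (case k of 0 \<Rightarrow> 0 | Suc j \<Rightarrow> cnj (u (Suc j)) * w j)
       + (-1) * (cnj (u k) * w (Suc k)))) has_sum (2 * A + ((-1) * P + (-1) * Q))) UNIV"
    by (intro has_sum_add has_sum_cmult_right has_sum_shift A P Q)
  also have "(\<lambda>k. 2 * (cnj (u k) * w k) + ((-1) * (case k of 0 \<Rightarrow> 0 | Suc j \<Rightarrow> cnj (u (Suc j)) * w j)
       + (-1) * (cnj (u k) * w (Suc k)))) = (\<lambda>k. cnj (u k) * h_ray w k)"
    by (auto simp: h_ray_case algebra_simps split: nat.split)
  finally have 2: "((\<lambda>k. cnj (u k) * h_ray w k) has_sum (2 * A + ((-1) * P + (-1) * Q))) UNIV" .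
  show ?thesis using infsumI[OF 1] infsumI[OF 2] by simp
qed

text \<open>The constant is 12 + 3 + 3, from (2 a + b + c)^2 \<le> 12 a^2 + 3 b^2 + 3 c^2 and the
  fact that a shift does not increase the sum of squares.\<close>

lemma h_ray_bounded:
  assumes u: "(\<lambda>k. (cmod (u k))\<^sup>2) summable_on UNIV" and N: "(\<Sum>\<^sub>\<infinity>k. (cmod (u k))\<^sup>2) \<le> N"
  shows "(\<lambda>k. (cmod (h_ray u k))\<^sup>2) summable_on UNIV" "(\<Sum>\<^sub>\<infinity>k. (cmod (h_ray u k))\<^sup>2) \<le> 18 * N"
proof -
  define g where "g = (\<lambda>k. (cmod (u k))\<^sup>2)"
  have g: "(g has_sum infsum g UNIV) UNIV" using u by (simp add: g_def)
  have g1: "((\<lambda>k. g (Suc k)) has_sum (\<Sum>\<^sub>\<infinity>k. g (Suc k))) UNIV"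
    by (intro has_sum_infsum summable_shift_left[OF has_sum_imp_summable[OF g]])
  have "((\<lambda>k. case k of 0 \<Rightarrow> 0 | Suc j \<Rightarrow> g (Suc j)) has_sum (\<Sum>\<^sub>\<infinity>k. g (Suc k))) UNIV"
    by (rule has_sum_shift[OF g1])
  from has_sum_mono[OF this g] have le: "(\<Sum>\<^sub>\<infinity>k. g (Suc k)) \<le> infsum g UNIV"
    by (auto split: nat.split simp: g_def)
  let ?G = "\<lambda>k. 12 * g k + (3 * g (Suc k) + 3 * (case k of 0 \<Rightarrow> 0 | Suc j \<Rightarrow> g j))"
  have G: "(?G has_sum (12 * infsum g UNIV + (3 * (\<Sum>\<^sub>\<infinity>k. g (Suc k)) + 3 * infsum g UNIV))) UNIV"
    by (intro has_sum_add has_sum_cmult_right has_sum_shift g g1)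
  have pt: "(cmod (h_ray u k))\<^sup>2 \<le> ?G k" for k
  proof -
    define a b c where "a = cmod (u k)" and "b = cmod (u (Suc k))"
      and "c = cmod (case k of 0 \<Rightarrow> 0 | Suc j \<Rightarrow> u j)"
    have "cmod (h_ray u k) \<le> 2 * a + b + c"
      unfolding h_ray_case a_def b_def c_def
      by (rule order_trans[OF norm_triangle_ineq4] add_mono order_refl)+ (simp_all add: norm_mult)
    then have "(cmod (h_ray u k))\<^sup>2 \<le> (2 * a + b + c)\<^sup>2" by (intro power_mono) auto
    also have "\<dots> \<le> 12 * a\<^sup>2 + (3 * b\<^sup>2 + 3 * c\<^sup>2)"
      using sum_squares_bound[of "2 * a" b] sum_squares_bound[of "2 * a" c] sum_squares_bound[of b c]
      by (simp add: power2_eq_square algebra_simps)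
    also have "\<dots> = ?G k" by (auto simp: a_def b_def c_def g_def split: nat.split)
    finally show ?thesis .
  qed
  show s: "(\<lambda>k. (cmod (h_ray u k))\<^sup>2) summable_on UNIV"
    by (rule summable_on_comparison_test[OF has_sum_imp_summable[OF G] pt]) auto
  have "(\<Sum>\<^sub>\<infinity>k. (cmod (h_ray u k))\<^sup>2) \<le> 12 * infsum g UNIV + (3 * (\<Sum>\<^sub>\<infinity>k. g (Suc k)) + 3 * infsum g UNIV)"
    by (rule has_sum_mono[OF has_sum_infsum[OF s] G pt])
  then show "(\<Sum>\<^sub>\<infinity>k. (cmod (h_ray u k))\<^sup>2) \<le> 18 * N" using le N by (simp add: g_def)
qed

section \<open>The operator on the finite graph\<close>

lemma h_core_eq:
  "h_core E0 x0 u x = (\<Sum>y\<in>UNIV. if {x, y} \<in> E0 then u x - u y else 0)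
     + (\<Sum>\<alpha>\<in>UNIV. (if x = x0 \<alpha> then 1 else 0) * u x)"
  by (simp add: h_core_def sum.If_cases)

lemma h_core_symmetric:
  "(\<Sum>x\<in>UNIV. cnj (h_core E0 x0 u x) * w x) = (\<Sum>x\<in>UNIV. cnj (u x) * h_core E0 x0 w x)"
proof -
  define e s where "e x y = (if {x, y} \<in> E0 then 1 else 0 :: complex)"
    and "s x \<alpha> = (if x = x0 \<alpha> then 1 else 0 :: complex)" for x y \<alpha>
  have cnj [simp]: "cnj (e x y) = e x y" "cnj (s x \<alpha>) = s x \<alpha>" and e_commute: "e x y = e y x" for x y \<alpha>
    by (auto simp: e_def s_def insert_commute)
  have h: "h_core E0 x0 f x = (\<Sum>y\<in>UNIV. e x y * f x) - (\<Sum>y\<in>UNIV. e x y * f y) + (\<Sum>\<alpha>\<in>UNIV. s x \<alpha> * f x)" for f x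
    unfolding h_core_eq sum_subtractf[symmetric]
    by (intro arg_cong2[of _ _ _ _ "(+)"] sum.cong) (auto simp: e_def s_def)
  have l: "cnj (h_core E0 x0 u x) * w x = (\<Sum>y\<in>UNIV. e x y * (cnj (u x) * w x)) - (\<Sum>y\<in>UNIV. e x y * (cnj (u y) * w x))
    + (\<Sum>\<alpha>\<in>UNIV. s x \<alpha> * (cnj (u x) * w x))" for x
    unfolding h by (simp add: ring_distribs sum_distrib_left sum_distrib_right mult_ac)
  have r: "cnj (u x) * h_core E0 x0 w x = (\<Sum>y\<in>UNIV. e x y * (cnj (u x) * w x)) - (\<Sum>y\<in>UNIV. e x y * (cnj (u x) * w y))
    + (\<Sum>\<alpha>\<in>UNIV. s x \<alpha> * (cnj (u x) * w x))" for x
    unfolding h by (simp add: ring_distribs sum_distrib_left sum_distrib_right mult_ac)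
  have "(\<Sum>x\<in>UNIV. \<Sum>y\<in>UNIV. e x y * (cnj (u y) * w x)) = (\<Sum>x\<in>UNIV. \<Sum>y\<in>UNIV. e x y * (cnj (u x) * w y))"
    by (subst sum.swap) (simp add: e_commute)
  then show ?thesis unfolding l r sum.distrib sum_subtractf by simp
qed

text \<open>Energy identity: twice the real part of <u, h u> is the sum of |u x - u y|^2 over
  oriented edges plus twice the sum of |u|^2 over the attachment vertices with multiplicity. If it
  vanishes, \<open>u\<close> is constant along edges and zero wherever a half-line is
  attached.\<close>

lemma h_core_injective:
  assumes conn: "connected_simple_graph E0" and h: "\<And>x. h_core E0 x0 u x = 0"
  shows "u x = 0"
proof -
  let ?e = "\<lambda>x y. if {x, y} \<in> E0 then 1 else 0 :: real"
  let ?s = "\<lambda>x. \<Sum>\<alpha>\<in>UNIV. (if x = x0 \<alpha> then 1 else 0 :: real)"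
  have c: "Re (cnj (u x) * h_core E0 x0 u x) = (\<Sum>y\<in>UNIV. ?e x y * Re (cnj (u x) * (u x - u y))) + ?s x * (cmod (u x))\<^sup>2" for x
    unfolding h_core_eq distrib_left plus_complex.sel sum_distrib_left Re_sum sum_distrib_right
    by (intro arg_cong2[of _ _ _ _ "(+)"] sum.cong) (auto simp: cmod_power2 simp flip: power2_eq_square)
  have "0 = (\<Sum>x\<in>UNIV. Re (cnj (u x) * h_core E0 x0 u x))" by (simp add: h)
  also have "\<dots> = (\<Sum>x\<in>UNIV. \<Sum>y\<in>UNIV. ?e x y * Re (cnj (u x) * (u x - u y))) + (\<Sum>x\<in>UNIV. ?s x * (cmod (u x))\<^sup>2)"
    unfolding c by (rule sum.distrib)
  finally have 1: "0 = (\<Sum>x\<in>UNIV. \<Sum>y\<in>UNIV. ?e x y * Re (cnj (u x) * (u x - u y))) + (\<Sum>x\<in>UNIV. ?s x * (cmod (u x))\<^sup>2)" .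
  have sw: "(\<Sum>x\<in>UNIV. \<Sum>y\<in>UNIV. ?e x y * Re (cnj (u x) * (u x - u y)))
      = (\<Sum>x\<in>UNIV. \<Sum>y\<in>UNIV. ?e x y * Re (cnj (u y) * (u y - u x)))"
    by (subst sum.swap) (simp add: insert_commute)
  have polar: "(cmod (a - b))\<^sup>2 = Re (cnj a * (a - b)) + Re (cnj b * (b - a))" for a b
    unfolding cmod_power2 by (simp add: power2_eq_square algebra_simps)
  have "(\<Sum>x\<in>UNIV. \<Sum>y\<in>UNIV. ?e x y * (cmod (u x - u y))\<^sup>2)
      = (\<Sum>x\<in>UNIV. \<Sum>y\<in>UNIV. ?e x y * Re (cnj (u x) * (u x - u y)))
      + (\<Sum>x\<in>UNIV. \<Sum>y\<in>UNIV. ?e x y * Re (cnj (u y) * (u y - u x)))"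
    unfolding sum.distrib[symmetric] polar distrib_left ..
  with 1 sw have z: "(\<Sum>x\<in>UNIV. \<Sum>y\<in>UNIV. ?e x y * (cmod (u x - u y))\<^sup>2) + 2 * (\<Sum>x\<in>UNIV. ?s x * (cmod (u x))\<^sup>2) = 0"
    by simp
  have n1: "0 \<le> (\<Sum>x\<in>UNIV. \<Sum>y\<in>UNIV. ?e x y * (cmod (u x - u y))\<^sup>2)" by (intro sum_nonneg) auto
  have n2: "0 \<le> (\<Sum>x\<in>UNIV. ?s x * (cmod (u x))\<^sup>2)" by (intro sum_nonneg mult_nonneg_nonneg) auto
  have "(\<Sum>x\<in>UNIV. \<Sum>y\<in>UNIV. ?e x y * (cmod (u x - u y))\<^sup>2) = 0" using z n1 n2 by linarith
  then have zero: "?e x y * (cmod (u x - u y))\<^sup>2 = 0" for x y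
    by (simp add: sum_nonneg_eq_0_iff sum_nonneg)
  then have edge: "u x = u y" if "{x, y} \<in> E0" for x y using zero[of x y] that by simp
  have "(\<Sum>x\<in>UNIV. ?s x * (cmod (u x))\<^sup>2) = 0" using z n1 n2 by linarith
  then have "?s x * (cmod (u x))\<^sup>2 = 0" for x
    by (simp add: sum_nonneg_eq_0_iff sum_nonneg)
  then have s0: "u (x0 \<alpha>) = 0" for \<alpha>
  proof -
    have "?s (x0 \<alpha>) \<ge> (if x0 \<alpha> = x0 \<alpha> then 1 else 0)" by (rule member_le_sum) auto
    then show ?thesis using \<open>?s (x0 \<alpha>) * (cmod (u (x0 \<alpha>)))\<^sup>2 = 0\<close> by auto
  qed
  \<comment> \<open>The index type of the half-lines is inhabited, so an attachment vertex exists;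
    connectedness carries the zero from there to \<open>x\<close>.\<close>
  fix \<alpha>
  have "(x0 \<alpha>, x) \<in> {(x, y). {x, y} \<in> E0}\<^sup>*" using conn by (auto simp: connected_simple_graph_def)
  then have "u x = u (x0 \<alpha>)" by (induction rule: rtrancl_induct) (use edge in auto)
  then show ?thesis using s0 by simp
qed

lemma h_core_linear: "linear_on UNIV (h_core E0 x0)"
proof (rule linear_onI)
  show "h_core E0 x0 (u + w) = h_core E0 x0 u + h_core E0 x0 w" for u w
    by (rule ext) (simp add: h_core_def sum.distrib sum_subtractf algebra_simps)
  show "h_core E0 x0 (scaleC c u) = scaleC c (h_core E0 x0 u)" for c u
    by (rule ext) (simp add: h_core_def sum_distrib_left distrib_left right_diff_distrib mult.left_commute)
qed

text \<open>Finite dimension turns injectivity into surjectivity. Functions on the finite type are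
  moved to \<open>complex ^ 'a\<close>, a Euclidean space, and the operator is treated there as a
  real-linear map.\<close>

lemma h_core_bij:
  fixes E0 :: "'a::finite set set" and x0 :: "'n::finite \<Rightarrow> 'a"
  assumes conn: "connected_simple_graph E0"
  shows "bij (h_core E0 x0)"
proof (rule bijI)
  show inj: "inj (h_core E0 x0)"
  proof (rule injI)
    fix u w assume "h_core E0 x0 u = h_core E0 x0 w"
    then have "h_core E0 x0 (u - w) = 0"
      using linear_on_diff[OF complex_vector.subspace_UNIV h_core_linear[of E0 x0], of u w] by simp
    then have "(u - w) x = 0" for x
      using h_core_injective[OF conn, of x0 "u - w"] by simp
    then show "u = w" by (simp add: fun_eq_iff)
  qed
  define L :: "complex ^ 'a \<Rightarrow> complex ^ 'a" where "L v = (\<chi> x. h_core E0 x0 (\<lambda>y. v $ y) x)" for v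
  have "linear L"
  proof (rule linearI)
    show "L (v + w) = L v + L w" for v w
      using linear_on_add[OF h_core_linear[of E0 x0], of "\<lambda>y. v $ y" "\<lambda>y. w $ y"]
      by (simp add: L_def vec_eq_iff plus_fun_def)
    show "L (r *\<^sub>R v) = r *\<^sub>R L v" for r v
      using linear_on_scale[OF h_core_linear[of E0 x0], of "\<lambda>y. v $ y" "of_real r"]
      by (simp add: L_def vec_eq_iff scaleC_fun_def scaleR_conv_of_real[where 'a = complex])
  qed
  moreover have "inj L"
  proof (rule injI)
    fix v w assume "L v = L w"
    then have "h_core E0 x0 (\<lambda>y. v $ y) = h_core E0 x0 (\<lambda>y. w $ y)" by (auto simp: L_def vec_eq_iff)
    then have "(\<lambda>y. v $ y) = (\<lambda>y. w $ y)" using inj by (simp add: inj_eq)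
    then show "v = w" by (simp add: vec_eq_iff fun_eq_iff)
  qed
  ultimately have "surj L" by (rule linear_inj_imp_surj)
  show "surj (h_core E0 x0)"
  unfolding surj_def
  proof
    fix f
    obtain v where "L v = (\<chi> x. f x)" using \<open>surj L\<close> by (metis surjD)
    then have "h_core E0 x0 (\<lambda>y. v $ y) = f" by (auto simp: L_def vec_eq_iff fun_eq_iff)
    then show "\<exists>u. f = h_core E0 x0 u" by blast
  qed
qed

section \<open>The free operator and its Green operator at zero energy\<close>

lemma free_op_linear: "linear_on UNIV (free_op E0 x0)"
proof (rule linear_onI; rule ext)
  fix u w c y
  show "free_op E0 x0 (u + w) y = (free_op E0 x0 u + free_op E0 x0 w) y"
  proof (cases y)
    case (Core x)
    then show ?thesis
      using linear_on_add[OF h_core_linear[of E0 x0], of "\<lambda>y. u (Core y)" "\<lambda>y. w (Core y)"]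
      by (simp add: plus_fun_def)
  next
    case (Ray \<alpha> k)
    then show ?thesis using h_ray_linear[of "\<lambda>m. u (Ray \<alpha> m)" 1 "\<lambda>m. w (Ray \<alpha> m)" k] by simp
  qed
  show "free_op E0 x0 (scaleC c u) y = scaleC c (free_op E0 x0 u) y"
  proof (cases y)
    case (Core x)
    then show ?thesis
      using linear_on_scale[OF h_core_linear[of E0 x0], of "\<lambda>y. u (Core y)" c]
      by (simp add: scaleC_fun_def)
  next
    case (Ray \<alpha> k)
    have "h_ray (\<lambda>k. 0) k = 0" by (cases k) auto
    then show ?thesis using Ray h_ray_linear[of "\<lambda>m. 0" c "\<lambda>m. u (Ray \<alpha> m)" k] by simp
  qed
qed

lemma G00_Ray: "G00 E0 x0 f (Ray \<alpha> k) = green (\<lambda>m. f (Ray \<alpha> m)) k"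
  by (simp add: green_def)

declare G00.simps(2) [simp del]

lemma h_core_inv: "connected_simple_graph E0 \<Longrightarrow> h_core E0 x0 (inv (h_core E0 x0) f) = f"
  by (rule surj_f_inv_f[OF bij_is_surj[OF h_core_bij]])

lemma free_op_G00:
  fixes f :: "('a::finite, 'n::finite) gfun"
  assumes conn: "connected_simple_graph E0" and f: "f \<in> Lsp 0"
  shows "free_op E0 x0 (G00 E0 x0 f) = f"
proof
  fix y
  show "free_op E0 x0 (G00 E0 x0 f) y = f y"
  proof (cases y)
    case (Core x)
    then show ?thesis using h_core_inv[OF conn, of x0 "\<lambda>y. f (Core y)"] by simp
  next
    case (Ray \<alpha> k)
    then show ?thesis using f by (simp add: G00_Ray h_ray_green Lsp_iff_0)
  qed
qed

text \<open>On the core the solution is unique because \<open>h_core\<close> is bijective; on each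
  half-line the only freedom is a multiple of the linear solution, fixed by the value at the first
  vertex.\<close>

lemma free_op_solution:
  fixes f :: "('a::finite, 'n::finite) gfun"
  assumes conn: "connected_simple_graph E0" and f: "f \<in> Lsp 0" and u: "free_op E0 x0 u = f"
  shows "u = G00 E0 x0 f + (\<Sum>\<alpha>\<in>UNIV. scaleC (u (Ray \<alpha> 0) - moment 0 (\<lambda>k. f (Ray \<alpha> k))) (ray_n \<alpha>))"
proof
  fix y
  show "u y = (G00 E0 x0 f + (\<Sum>\<alpha>\<in>UNIV. scaleC (u (Ray \<alpha> 0) - moment 0 (\<lambda>k. f (Ray \<alpha> k))) (ray_n \<alpha>))) y"
  proof (cases y)
    case (Core x)
    have "h_core E0 x0 (\<lambda>y. u (Core y)) = (\<lambda>y. f (Core y))"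
    proof
      show "h_core E0 x0 (\<lambda>y. u (Core y)) x = f (Core x)" for x
        using fun_cong[OF u, of "Core x"] by simp
    qed
    then have "inv (h_core E0 x0) (\<lambda>y. f (Core y)) = (\<lambda>y. u (Core y))"
      by (metis bij_inv_eq_iff conn h_core_bij)
    then show ?thesis using Core by (simp add: sum_fun_apply)
  next
    case (Ray \<alpha> k)
    have "h_ray (\<lambda>m. u (Ray \<alpha> m)) k = f (Ray \<alpha> k)" for k using fun_cong[OF u, of "Ray \<alpha> k"] by simp
    then have "u (Ray \<alpha> k) = green (\<lambda>k. f (Ray \<alpha> k)) k
        + (u (Ray \<alpha> 0) - moment 0 (\<lambda>k. f (Ray \<alpha> k))) * of_nat (Suc k)"
      using f by (intro h_ray_solution) (auto simp: Lsp_iff_0)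
    then show ?thesis using Ray by (simp add: sum_fun_apply G00_Ray if_distrib cong: if_cong)
  qed
qed

text \<open>The condition at the first vertices makes every multiple of \<open>ray_n\<close> in
  \<open>free_op_solution\<close> vanish. In this form the statement identifies the constant
  coefficient of the resolvent.\<close>

lemma G00_unique:
  fixes f :: "('a::finite, 'n::finite) gfun"
  assumes "connected_simple_graph E0" "f \<in> Lsp 0" "free_op E0 x0 u = f"
    and "\<And>\<alpha>. u (Ray \<alpha> 0) = moment 0 (\<lambda>k. f (Ray \<alpha> k))"
  shows "u = G00 E0 x0 f"
  using free_op_solution[OF assms(1-3)] assms(4) by simp

lemma G00_boundary: "G00 E0 x0 f (Ray \<alpha> 0) = moment 0 (\<lambda>k. f (Ray \<alpha> k))"
  by (simp add: G00_Ray green_0)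

lemma G00_linear:
  fixes E0 :: "'a::finite set set" and x0 :: "'n::finite \<Rightarrow> 'a"
  assumes conn: "connected_simple_graph E0"
  shows "linear_on (Lsp 0) (G00 E0 x0)"
proof (rule linear_onI)
  have m: "moment 0 (\<lambda>k. u (Ray \<alpha> k) + w (Ray \<alpha> k)) = moment 0 (\<lambda>k. u (Ray \<alpha> k)) + moment 0 (\<lambda>k. w (Ray \<alpha> k))"
    if "u \<in> Lsp 0" "w \<in> Lsp 0" for \<alpha> and u w :: "('a, 'n) gfun"
    using that moment_term_summable[of 0 _ 0] unfolding moment_def distrib_left
    by (intro infsum_add) (auto simp: Lsp_iff_0)
  fix u w :: "('a, 'n) gfun" and c
  assume u: "u \<in> Lsp 0"
  show "G00 E0 x0 (scaleC c u) = scaleC c (G00 E0 x0 u)"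
  proof (rule G00_unique[OF conn, symmetric])
    show "scaleC c u \<in> Lsp 0" by (rule complex_vector.subspace_scale[OF subspace_Lsp u])
  qed (simp_all add: linear_on_scale[OF free_op_linear] free_op_G00[OF conn u] G00_boundary
      moment_def infsum_cmult_right')
  assume w: "w \<in> Lsp 0"
  show "G00 E0 x0 (u + w) = G00 E0 x0 u + G00 E0 x0 w"
  proof (rule G00_unique[OF conn, symmetric])
    show "u + w \<in> Lsp 0" by (rule complex_vector.subspace_add[OF subspace_Lsp u w])
  qed (simp_all add: linear_on_add[OF free_op_linear] free_op_G00[OF conn] u w G00_boundary m)
qed

lemma real_Suc_le_weight_1: "real (Suc k) \<le> weight 1 (Ray \<alpha> k)"
  using weight_Ray_bounds(1)[of k 1 \<alpha>] by simp

lemma ray_n_Ldual: "ray_n \<alpha> \<in> Ldual 1"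
proof (rule LdualI[of _ 1])
  fix y
  show "cmod (ray_n \<alpha> y) \<le> 1 * weight 1 y"
    using real_Suc_le_weight_1 weight_pos[of 1 y] 
    by (cases y) (auto simp del: weight.simps of_nat_Suc intro: less_imp_le)
qed

lemma ray_1_Ldual: "ray_1 \<alpha> \<in> Ldual 0"
proof (rule LdualI[of _ 1])
  fix y
  show "cmod (ray_1 \<alpha> y) \<le> 1 * weight 0 y" by (cases y) (auto simp: weight_0 simp del: weight.simps)
qed

lemma core_bounded:
  fixes u :: "('a::finite, 'n) gfun"
  shows "cmod (u (Core x)) \<le> (\<Sum>x\<in>UNIV. cmod (u (Core x)))"
  by (rule member_le_sum) auto

lemma G00_Ldual:
  fixes f :: "('a::finite, 'n::finite) gfun"
  assumes f: "f \<in> Lsp 0"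
  shows "G00 E0 x0 f \<in> Ldual 1"
proof -
  let ?g = "G00 E0 x0 f"
  define C where "C = (\<Sum>x\<in>UNIV. cmod (?g (Core x)))"
  define D where "D = (\<Sum>\<alpha>\<in>UNIV. \<Sum>\<^sub>\<infinity>m. cmod (f (Ray \<alpha> m)))"
  have C: "C \<ge> 0" unfolding C_def by (intro sum_nonneg) auto
  have D: "D \<ge> 0" unfolding D_def by (intro sum_nonneg infsum_nonneg) auto
  have "cmod (?g y) \<le> (C + D) * weight 1 y" for y
  proof (cases y)
    case (Core x)
    then show ?thesis using core_bounded[of ?g x] D unfolding C_def by (simp del: G00.simps)
  next
    case (Ray \<alpha> k)
    have s: "(\<lambda>m. cmod (f (Ray \<alpha> m))) summable_on UNIV"
      using f by (simp add: Lsp_iff_0 moment_summable_def)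
    have "cmod (green (\<lambda>m. f (Ray \<alpha> m)) k) \<le> real (Suc k) * (\<Sum>\<^sub>\<infinity>m. cmod (f (Ray \<alpha> m)))"
    proof (rule norm_infsum_le[OF green_has_sum])
      show "((\<lambda>m. real (Suc k) * cmod (f (Ray \<alpha> m))) has_sum real (Suc k) * (\<Sum>\<^sub>\<infinity>m. cmod (f (Ray \<alpha> m)))) UNIV"
        by (intro has_sum_cmult_right has_sum_infsum s)
      show "cmod (of_nat (min (Suc k) (Suc m)) * f (Ray \<alpha> m)) \<le> real (Suc k) * cmod (f (Ray \<alpha> m))" for m
        unfolding norm_mult norm_of_nat by (intro mult_right_mono) auto
    qed (use f in \<open>simp add: Lsp_iff_0\<close>)
    also have "\<dots> \<le> weight 1 y * D"
      unfolding D_def Ray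
      by (intro mult_mono real_Suc_le_weight_1 member_le_sum infsum_nonneg less_imp_le[OF weight_pos]) auto
    also have "\<dots> \<le> (C + D) * weight 1 y"
      using C weight_pos[of 1 y] by (simp add: algebra_simps)
    finally show ?thesis by (simp add: Ray G00_Ray del: weight.simps)
  qed
  then show ?thesis by (rule LdualI)
qed

text \<open>By \<open>green_eq_tail\<close> the limit on a half-line is the first moment, and the
  deviation is minus \<open>tail\<close>, which costs two powers of the weight.\<close>

lemma G00_asymptotics:
  fixes f :: "('a::finite, 'n::finite) gfun"
  assumes f: "f \<in> Lsp (real (p + 2))"
  shows "G00 E0 x0 f - (\<Sum>\<alpha>\<in>UNIV. scaleC (moment 1 (\<lambda>k. f (Ray \<alpha> k))) (ray_1 \<alpha>)) \<in> Lsp (real p)"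
  unfolding Lsp_iff
proof
  fix \<alpha>
  have f': "moment_summable (p + 2) (\<lambda>k. f (Ray \<alpha> k))" using f unfolding Lsp_iff by blast
  have "(\<lambda>k. (G00 E0 x0 f - (\<Sum>\<alpha>\<in>UNIV. scaleC (moment 1 (\<lambda>k. f (Ray \<alpha> k))) (ray_1 \<alpha>))) (Ray \<alpha> k))
     = (\<lambda>k. - tail (\<lambda>k. f (Ray \<alpha> k)) k)"
    using green_eq_tail[OF moment_summable_mono[OF f', of 1]]
    by (simp add: sum_fun_apply G00_Ray if_distrib cong: if_cong)
  then show "moment_summable p (\<lambda>k. (G00 E0 x0 f - (\<Sum>\<alpha>\<in>UNIV. scaleC (moment 1 (\<lambda>k. f (Ray \<alpha> k))) (ray_1 \<alpha>))) (Ray \<alpha> k))"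
    using moment_summable_tail[OF f'] by (simp add: moment_summable_def)
qed

text \<open>Fubini for a symmetric kernel. A first moment of one factor suffices because min {k + 1,
  m + 1} \<le> k + 1.\<close>

lemma green_symmetric:
  assumes f: "moment_summable 1 f" and g: "moment_summable 0 g"
  shows "(\<Sum>\<^sub>\<infinity>k. cnj (green g k) * f k) = (\<Sum>\<^sub>\<infinity>k. cnj (g k) * green f k)"
proof -
  let ?F = "\<lambda>k m. of_nat (min (Suc k) (Suc m)) * cnj (g m) * f k"
  have sg: "(\<lambda>m. cmod (g m)) summable_on UNIV" using g by (simp add: moment_summable_def)
  have sf: "(\<lambda>m. real (Suc m) * cmod (f m)) summable_on UNIV" using f by (simp add: moment_summable_def)
  have bound: "cmod (?F k m) \<le> real (Suc k) * cmod (f k) * cmod (g m)" for k m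
  proof -
    have "real (min (Suc k) (Suc m)) * (cmod (f k) * cmod (g m)) \<le> real (Suc k) * (cmod (f k) * cmod (g m))"
      by (intro mult_right_mono) auto
    then show ?thesis unfolding norm_mult norm_of_nat by (simp add: mult_ac)
  qed
  have "(\<lambda>(k, m). ?F k m) summable_on UNIV \<times> UNIV"
  proof (rule abs_summable_summable, unfold Infinite_Sum.abs_summable_on_Sigma_iff, intro conjI ballI)
    have in1: "(\<lambda>m. real (Suc k) * cmod (f k) * cmod (g m)) summable_on UNIV" for k
      by (intro summable_on_cmult_right sg)
    show s: "(\<lambda>m. norm (case (k, m) of (k, m) \<Rightarrow> ?F k m)) summable_on UNIV" for k
      by (rule summable_on_comparison_test[OF in1]) (use bound in auto)
    show "(\<lambda>k. norm (\<Sum>\<^sub>\<infinity>m. norm (case (k, m) of (k, m) \<Rightarrow> ?F k m))) summable_on UNIV"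
    proof (rule summable_on_comparison_test)
      show "(\<lambda>k. (\<Sum>\<^sub>\<infinity>m. cmod (g m)) * (real (Suc k) * cmod (f k))) summable_on UNIV"
        by (intro summable_on_cmult_right sf)
      fix k
      have "(\<Sum>\<^sub>\<infinity>m. norm (case (k, m) of (k, m) \<Rightarrow> ?F k m)) \<le> (\<Sum>\<^sub>\<infinity>m. real (Suc k) * cmod (f k) * cmod (g m))"
        by (rule infsum_mono[OF s in1]) (use bound in auto)
      also have "\<dots> = (\<Sum>\<^sub>\<infinity>m. cmod (g m)) * (real (Suc k) * cmod (f k))"
        by (simp add: infsum_cmult_right')
      finally show "norm (\<Sum>\<^sub>\<infinity>m. norm (case (k, m) of (k, m) \<Rightarrow> ?F k m)) \<le> (\<Sum>\<^sub>\<infinity>m. cmod (g m)) * (real (Suc k) * cmod (f k))"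
        by (simp add: infsum_nonneg)
    qed auto
  qed
  then have "(\<Sum>\<^sub>\<infinity>k. \<Sum>\<^sub>\<infinity>m. ?F k m) = (\<Sum>\<^sub>\<infinity>m. \<Sum>\<^sub>\<infinity>k. ?F k m)" by (rule infsum_swap_banach)
  also have "(\<lambda>k. \<Sum>\<^sub>\<infinity>m. ?F k m) = (\<lambda>k. cnj (green g k) * f k)"
    unfolding green_def infsum_cnj[symmetric] by (simp add: infsum_cmult_left')
  also have "(\<lambda>m. \<Sum>\<^sub>\<infinity>k. ?F k m) = (\<lambda>m. cnj (g m) * green f m)"
    unfolding green_def infsum_cmult_right'[symmetric] by (simp add: min.commute mult_ac)
  finally show ?thesis .
qed

lemma G00_symmetric:
  fixes f g :: "('a::finite, 'n::finite) gfun"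
  assumes conn: "connected_simple_graph E0" and f: "f \<in> Lsp 1" and g: "g \<in> Lsp 1"
  shows "pairing (G00 E0 x0 g) f = pairing g (G00 E0 x0 f)"
proof -
  have f0: "f \<in> Lsp 0" and g0: "g \<in> Lsp 0" using f g Lsp_mono[of 0 1] by auto
  have ms: "moment_summable 1 (\<lambda>k. f (Ray \<alpha> k))" "moment_summable 0 (\<lambda>k. g (Ray \<alpha> k))" for \<alpha>
    using f g0 Lsp_iff[of f 1] Lsp_iff_0[of g] by auto
  let ?h = "h_core E0 x0"
  have "(\<Sum>x\<in>UNIV. cnj (inv ?h (\<lambda>y. g (Core y)) x) * f (Core x))
      = (\<Sum>x\<in>UNIV. cnj (inv ?h (\<lambda>y. g (Core y)) x) * ?h (inv ?h (\<lambda>y. f (Core y))) x)"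
    by (simp add: h_core_inv[OF conn])
  also have "\<dots> = (\<Sum>x\<in>UNIV. cnj (g (Core x)) * inv ?h (\<lambda>y. f (Core y)) x)"
    by (rule trans[OF h_core_symmetric[symmetric]]) (simp only: h_core_inv[OF conn])
  finally have core: "(\<Sum>x\<in>UNIV. cnj (G00 E0 x0 g (Core x)) * f (Core x))
      = (\<Sum>x\<in>UNIV. cnj (g (Core x)) * G00 E0 x0 f (Core x))" unfolding G00.simps(1) .
  show ?thesis
    unfolding pairing_vertex[OF pairing_summable[OF G00_Ldual[OF g0] f]]
      pairing_vertex[OF pairing_summable'[OF g G00_Ldual[OF f0]]] core
    by (simp add: G00_Ray green_symmetric[OF ms])
qed

section \<open>Boundedness and symmetry on square-summable functions\<close>

lemma free_op_bounded:
  fixes E0 :: "'a::finite set set" and x0 :: "'n::finite \<Rightarrow> 'a"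
  obtains C where "\<And>u. u \<in> ell2 \<Longrightarrow> free_op E0 x0 u \<in> ell2 \<and> ell2_norm (free_op E0 x0 u) \<le> C * ell2_norm u"
proof -
  have "\<exists>C. \<forall>u\<in>ell2. cmod (free_op E0 x0 u (Core x)) \<le> C * ell2_norm u" for x
  proof (intro exI ballI)
    fix u :: "('a, 'n) gfun" assume u: "u \<in> ell2"
    let ?N = "ell2_norm u"
    have b: "cmod (u y) \<le> ?N" for y by (rule ell2_bound[OF u])
    have "cmod (free_op E0 x0 u (Core x)) \<le> (\<Sum>y\<in>{y. {x, y} \<in> E0}. 2 * ?N) + (\<Sum>\<alpha>\<in>(UNIV::'n set). ?N)"
      unfolding free_op.simps h_core_def
    proof (rule order_trans[OF norm_triangle_ineq], intro add_mono order_trans[OF norm_sum] sum_mono)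
      show "cmod (u (Core x) - u (Core y)) \<le> 2 * ?N" for y
        using norm_triangle_ineq4[of "u (Core x)" "u (Core y)"] b[of "Core x"] b[of "Core y"] by simp
      show "cmod ((if x = x0 \<alpha> then 1 else 0) * u (Core x)) \<le> ?N" for \<alpha>
        using b[of "Core x"] ell2_norm_nonneg[of u] by auto
    qed
    also have "\<dots> = (2 * real (card {y. {x, y} \<in> E0}) + real CARD('n)) * ?N"
      by (simp add: algebra_simps)
    finally show "cmod (free_op E0 x0 u (Core x)) \<le> (2 * real (card {y. {x, y} \<in> E0}) + real CARD('n)) * ?N" .
  qed
  then obtain c where c: "\<And>x u. u \<in> ell2 \<Longrightarrow> cmod (free_op E0 x0 u (Core x)) \<le> c x * ell2_norm u" by metis
  \<comment> \<open>Squared constants: one for each core vertex, and the 18 of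
    \<open>h_ray_bounded\<close> for each half-line.\<close>
  define C where "C = (\<Sum>x\<in>UNIV. (c x)\<^sup>2) + (\<Sum>\<alpha>\<in>(UNIV::'n set). 18)"
  have C: "C \<ge> 0" unfolding C_def by (intro add_nonneg_nonneg sum_nonneg) auto
  have "free_op E0 x0 u \<in> ell2 \<and> ell2_norm (free_op E0 x0 u) \<le> sqrt C * ell2_norm u" if u: "u \<in> ell2" for u
  proof -
    have s: "(\<lambda>y. (cmod (u y))\<^sup>2) summable_on UNIV" using u by (simp add: ell2_def)
    let ?S = "\<Sum>\<^sub>\<infinity>y. (cmod (u y))\<^sup>2"
    have N: "(ell2_norm u)\<^sup>2 = ?S" by (simp add: ell2_norm_def infsum_nonneg)
    have r: "(\<lambda>k. (cmod (u (Ray \<alpha> k)))\<^sup>2) summable_on UNIV" for \<alpha>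
      using s unfolding summable_vertex_iff by auto
    have le: "(\<Sum>\<^sub>\<infinity>k. (cmod (u (Ray \<alpha> k)))\<^sup>2) \<le> ?S" for \<alpha>
    proof -
      have "(\<Sum>\<^sub>\<infinity>k. (cmod (u (Ray \<alpha> k)))\<^sup>2) \<le> (\<Sum>\<alpha>\<in>UNIV. \<Sum>\<^sub>\<infinity>k. (cmod (u (Ray \<alpha> k)))\<^sup>2)"
        by (rule member_le_sum) (auto intro: infsum_nonneg)
      also have "\<dots> \<le> ?S" unfolding infsum_vertex[OF s] by (simp add: sum_nonneg)
      finally show ?thesis .
    qed
    have hs: "((\<lambda>y. (cmod (free_op E0 x0 u y))\<^sup>2) has_sum
        ((\<Sum>x\<in>UNIV. (cmod (free_op E0 x0 u (Core x)))\<^sup>2) + (\<Sum>\<alpha>\<in>UNIV. \<Sum>\<^sub>\<infinity>k. (cmod (free_op E0 x0 u (Ray \<alpha> k)))\<^sup>2))) UNIV"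
      by (rule has_sum_vertex) (simp add: h_ray_bounded(1)[OF r order_refl])
    have "(\<Sum>x\<in>UNIV. (cmod (free_op E0 x0 u (Core x)))\<^sup>2) + (\<Sum>\<alpha>\<in>UNIV. \<Sum>\<^sub>\<infinity>k. (cmod (free_op E0 x0 u (Ray \<alpha> k)))\<^sup>2)
      \<le> (\<Sum>x\<in>UNIV. (c x)\<^sup>2 * (ell2_norm u)\<^sup>2) + (\<Sum>\<alpha>\<in>(UNIV::'n set). 18 * (ell2_norm u)\<^sup>2)"
    proof (intro add_mono sum_mono)
      show "(cmod (free_op E0 x0 u (Core x)))\<^sup>2 \<le> (c x)\<^sup>2 * (ell2_norm u)\<^sup>2" for x
        unfolding power_mult_distrib[symmetric] by (intro power_mono c[OF u]) simp
      show "(\<Sum>\<^sub>\<infinity>k. (cmod (free_op E0 x0 u (Ray \<alpha> k)))\<^sup>2) \<le> 18 * (ell2_norm u)\<^sup>2" for \<alpha>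
        unfolding N free_op.simps by (rule h_ray_bounded(2)[OF r le])
    qed
    also have "\<dots> = C * (ell2_norm u)\<^sup>2"
      by (simp add: C_def distrib_right sum_distrib_right)
    finally have "(\<Sum>\<^sub>\<infinity>y. (cmod (free_op E0 x0 u y))\<^sup>2) \<le> C * (ell2_norm u)\<^sup>2" unfolding infsumI[OF hs] .
    then have "ell2_norm (free_op E0 x0 u) \<le> sqrt (C * (ell2_norm u)\<^sup>2)" unfolding ell2_norm_def[of "free_op E0 x0 u"] by (rule real_sqrt_le_mono)
    also have "\<dots> = sqrt C * ell2_norm u" by (simp add: real_sqrt_mult ell2_norm_nonneg)
    finally show ?thesis using has_sum_imp_summable[OF hs] by (simp add: ell2_def)
  qed
  then show thesis by (rule that)
qed

lemma free_op_symmetric: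
  fixes u w :: "('a::finite, 'n::finite) gfun"
  assumes u: "u \<in> ell2" and w: "w \<in> ell2"
  shows "pairing (free_op E0 x0 u) w = pairing u (free_op E0 x0 w)"
proof -
  have in2: "free_op E0 x0 f \<in> ell2" if "f \<in> ell2" for f :: "('a, 'n) gfun"
    using free_op_bounded[of E0 x0] that by metis
  have r: "(\<lambda>k. (cmod (f (Ray \<alpha> k)))\<^sup>2) summable_on UNIV" if "f \<in> ell2" for \<alpha> and f :: "('a, 'n) gfun"
    using that unfolding ell2_def mem_Collect_eq summable_vertex_iff by auto
  show ?thesis
    unfolding pairing_vertex[OF pairing_ell2_summable[OF in2[OF u] w]]
      pairing_vertex[OF pairing_ell2_summable[OF u in2[OF w]]]
    by (simp add: h_ray_symmetric[OF r[OF u] r[OF w]] h_core_symmetric)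
qed

lemma ell2_norm_triangle:
  assumes "u \<in> ell2" "w \<in> ell2"
  shows "ell2_norm (u + w) \<le> ell2_norm u + ell2_norm w"
proof -
  have "Rep_l2 (Abs_l2 u + Abs_l2 w) = u + w" by (simp add: fun_eq_iff Rep_l2_add Rep_Abs_ell2 assms)
  then show ?thesis
    using norm_triangle_ineq[of "Abs_l2 u" "Abs_l2 w"] assms by (simp add: norm_eq_ell2_norm Rep_Abs_ell2)
qed

lemma full_op_bounded:
  fixes E0 :: "'a::finite set set" and x0 :: "'n::finite \<Rightarrow> 'a"
  assumes V: "bounded_operator ell2 ell2_norm ell2 ell2_norm V"
  shows "bounded_operator ell2 ell2_norm ell2 ell2_norm (full_op E0 x0 V)"
proof -
  obtain C where C: "\<And>u. u \<in> ell2 \<Longrightarrow> free_op E0 x0 u \<in> ell2 \<and> ell2_norm (free_op E0 x0 u) \<le> C * ell2_norm u"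
    using free_op_bounded by blast
  obtain D where D: "\<And>u. u \<in> ell2 \<Longrightarrow> ell2_norm (V u) \<le> D * ell2_norm u"
    using bounded_operatorD(3)[OF V] by auto
  note Vin = bounded_operatorD(1)[OF V] and Vlin = bounded_operatorD(2)[OF V]
  have "ell2_norm (full_op E0 x0 V u) \<le> (C + D) * ell2_norm u" if u: "u \<in> ell2" for u
  proof -
    have "ell2_norm (full_op E0 x0 V u) \<le> ell2_norm (free_op E0 x0 u) + ell2_norm (V u)"
      unfolding full_op_def using C u Vin by (intro ell2_norm_triangle) auto
    then show ?thesis using C[OF u] D[OF u] by (simp add: distrib_right)
  qed
  moreover have "full_op E0 x0 V u \<in> ell2" if "u \<in> ell2" for u
    unfolding full_op_def using C[OF that] Vin[OF that] by (auto intro: complex_vector.subspace_add[OF subspace_ell2])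
  ultimately show ?thesis
    unfolding bounded_operator_def
    by (auto simp: full_op_def linear_on_add[OF free_op_linear] linear_on_scale[OF free_op_linear]
        linear_on_add[OF Vlin] linear_on_scale[OF Vlin] complex_vector.scale_right_distrib)
qed

lemma full_op_symmetric:
  fixes u w :: "('a::finite, 'n::finite) gfun"
  assumes V: "bounded_operator ell2 ell2_norm ell2 ell2_norm V"
    and sym: "\<And>u w. u \<in> ell2 \<Longrightarrow> w \<in> ell2 \<Longrightarrow> pairing (V u) w = pairing u (V w)"
    and u: "u \<in> ell2" and w: "w \<in> ell2"
  shows "pairing (full_op E0 x0 V u) w = pairing u (full_op E0 x0 V w)"
proof -
  have in2: "free_op E0 x0 f \<in> ell2" if "f \<in> ell2" for f :: "('a, 'n) gfun"
    using free_op_bounded[of E0 x0] that by metis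
  note Vin = bounded_operatorD(1)[OF V]
  have r: "pairing f (full_op E0 x0 V g) = pairing f (free_op E0 x0 g) + pairing f (V g)"
    if "f \<in> ell2" "g \<in> ell2" for f g
    unfolding full_op_def using that in2 Vin by (intro linear_on_add[OF pairing_ell2_linear]) auto
  have "pairing (full_op E0 x0 V u) w = cnj (pairing w (full_op E0 x0 V u))" by (rule pairing_commute)
  also have "\<dots> = pairing (free_op E0 x0 u) w + pairing (V u) w"
    unfolding r[OF w u] by (simp add: pairing_commute[of "free_op E0 x0 u"] pairing_commute[of "V u"])
  finally show ?thesis using r[OF u w] free_op_symmetric[OF u w] sym[OF u w] by simp
qed

section \<open>The threshold eigenspaces\<close>

text \<open>With \<open>l x = pairing x u\<close> the sum is \<open>basis_projection B u\<close>,
  which thereby becomes a Riesz representative. The functional may come from a \<open>u\<close>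
  outside \<open>W\<close> and from a form other than \<open>ip\<close>; the bound projection uses
  the first freedom and the non-resonance projection both.\<close>

lemma (in inner_product_on) riesz_basis_sum:
  assumes B: "orthonormal_basis B" and l: "linear_on W (\<lambda>x. cnj (l x))" and x: "x \<in> W"
  shows "ip x (\<Sum>b\<in>B. scaleC (l b) b) = l x"
proof -
  have BW: "B \<subseteq> W" using B by (auto simp: orthonormal_basis_def orthonormal_def)
  have "x = (\<Sum>b\<in>B. scaleC (ip b x) b)" using B x by (simp add: orthonormal_basis_def proj_def)
  then have "cnj (l x) = cnj (l (\<Sum>b\<in>B. scaleC (ip b x) b))" by simp
  also have "\<dots> = (\<Sum>b\<in>B. cnj (l (scaleC (ip b x) b)))"
    using BW subspace by (intro linear_on_sum[OF subspace l]) (auto intro: complex_vector.subspace_scale)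
  also have "\<dots> = (\<Sum>b\<in>B. ip b x * cnj (l b))"
    using BW linear_on_scale[OF l] by (intro sum.cong) auto
  finally have "cnj (l x) = (\<Sum>b\<in>B. ip b x * cnj (l b))" .
  from arg_cong[OF this, of cnj] have "l x = (\<Sum>b\<in>B. cnj (ip b x) * l b)" by simp
  also have "\<dots> = (\<Sum>b\<in>B. l b * ip x b)"
    using BW x by (intro sum.cong) (auto simp: ip_commute[of x])
  also have "\<dots> = ip x (\<Sum>b\<in>B. scaleC (l b) b)" by (rule ip_sum_right[OF x BW, symmetric])
  finally show ?thesis by simp
qed

lemma ell2_inner_product: "inner_product_on ell2 pairing"
proof
  fix u w :: "('a, 'n) gfun" assume u: "u \<in> ell2"
  show "linear_on ell2 (pairing u)" by (rule pairing_ell2_linear[OF u])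
  show "pairing u w = cnj (pairing w u)" by (rule pairing_commute)
  show "0 \<le> Re (pairing u u)" by (simp add: pairing_self[OF u] del: of_real_power)
  assume "pairing u u = 0"
  then have "ell2_norm u = 0" by (simp add: pairing_self[OF u])
  then show "u = 0" using ell2_bound[OF u] by (auto simp: fun_eq_iff)
qed (rule subspace_ell2)

lemma subspace_ones_plus_L: "complex_vector.subspace (ones_plus_L t)"
  unfolding ones_plus_L_def by (rule complex_vector.subspace_sums[OF complex_vector.subspace_span subspace_Lsp])

lemma ones_plus_L_sub_Ldual:
  assumes "0 \<le> t" "u \<in> ones_plus_L t"
  shows "u \<in> Ldual 0"
proof -
  have "complex_vector.span (range ray_1) \<subseteq> Ldual 0"
    by (intro complex_vector.span_minimal subspace_Ldual) (auto intro: ray_1_Ldual)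
  then show ?thesis
    using assms Lsp_sub_Ldual[of _ t 0] subspace_Ldual[of 0]
    by (auto simp: ones_plus_L_def intro!: complex_vector.subspace_add)
qed

lemma sum_ray_n_Ray: "(\<Sum>\<alpha>\<in>UNIV. scaleC (c \<alpha>) (ray_n \<alpha>)) (Ray \<alpha>' k :: ('a, 'n::finite) vertex) = c \<alpha>' * of_nat (Suc k)"
  by (simp add: sum_fun_apply if_distrib cong: if_cong)

text \<open>Linear growth is unbounded, so growth rates can be read off modulo bounded
  functions.\<close>

lemma ray_n_unbounded:
  fixes c :: "'n::finite \<Rightarrow> complex"
  assumes "(\<Sum>\<alpha>\<in>UNIV. scaleC (c \<alpha>) (ray_n \<alpha>)) \<in> (Ldual 0 :: ('a, 'n) gfun set)"
  shows "c \<alpha> = 0"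
proof (rule ccontr)
  assume c: "c \<alpha> \<noteq> 0"
  obtain C where C: "\<And>y. cmod ((\<Sum>\<alpha>\<in>UNIV. scaleC (c \<alpha>) (ray_n \<alpha>) :: ('a, 'n) gfun) y) \<le> C * weight 0 y"
    using assms unfolding Ldual_iff by blast
  have "cmod (c \<alpha>) * real (Suc k) \<le> C" for k
    using C[of "Ray \<alpha> k"] unfolding sum_ray_n_Ray weight_0 norm_mult norm_of_nat by simp
  then have "real (Suc k) \<le> C / cmod (c \<alpha>)" for k
    using c by (simp add: field_simps)
  then show False using reals_Archimedean2[of "C / cmod (c \<alpha>)"]
    by (metis less_le_not_le lessI of_nat_less_iff order.trans)
qed

lemma cinner_ext:
  fixes f f' :: "'k::complex_hilbert_space"
  assumes "\<And>g. cinner f g = cinner f' g"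
  shows "f = f'"
proof -
  have "inner f d = inner f' d" for d using assms[of d] by (simp add: Re_cinner[symmetric])
  then have "inner (f - f') (f - f') = 0" by (simp only: inner_diff_left diff_self)
  then show ?thesis by simp
qed

text \<open>The exponent is a natural number so that it can serve as an order of moments.
  \<open>res\<close> says that every resonance function is already a bound state.\<close>

locale threshold =
  fixes E0 :: "'a::finite set set"
    and x0 :: "'n::finite \<Rightarrow> 'a"
    and V :: "('a, 'n) gfun \<Rightarrow> ('a, 'n) gfun"
    and v :: "'k::complex_hilbert_space \<Rightarrow> ('a, 'n) gfun"
    and U :: "'k \<Rightarrow> 'k"
    and b :: nat
  assumes conn: "connected_simple_graph E0"
    and b4: "4 \<le> b"
    and A: "assumption_A (real b) V v U"
    and res: "res_eigenspace E0 x0 V (real b) = bound_eigenspace E0 x0 V (real b)"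
begin

abbreviation "Et \<equiv> gen_eigenspace E0 x0 V (real b)"
abbreviation "Eb \<equiv> bound_eigenspace E0 x0 V (real b)"

lemma b2: "real b - 2 = real (b - 2)" "b - 2 + 2 = b" "2 \<le> real b - 2"
  using b4 by auto

lemma
  shows V_ell2: "bounded_operator ell2 ell2_norm ell2 ell2_norm V"
    and V_sym: "\<And>u w. u \<in> ell2 \<Longrightarrow> w \<in> ell2 \<Longrightarrow> pairing (V u) w = pairing u (V w)"
    and v_bounded: "bounded_operator UNIV norm (Lsp (real b)) (Lnorm (real b)) v"
    and v_inj: "inj v"
    and U_sa: "\<And>f g. cinner (U f) g = cinner f (U g)"
    and U_iso: "\<And>f g. cinner (U f) (U g) = cinner f g"
    and U_linear: "linear_on UNIV U"
    and V_factor: "\<And>u. u \<in> Ldual (real b) \<Longrightarrow> V u = v (U (adj v u))"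
    and V_Ldual: "bounded_operator (Ldual (real b)) (Ldual_norm (real b)) (Lsp (real b)) (Lnorm (real b)) V"
  using A unfolding assumption_A_def selfadjoint_op_def unitary_op_def
  by (blast | blast intro: bounded_operatorD(2))+

lemma UU: "U (U f) = f"
  by (rule cinner_ext, subst U_sa, rule U_iso)

lemma v_in: "v g \<in> Lsp (real b)" and v_linear: "linear_on UNIV v"
  using bounded_operatorD[OF v_bounded] by auto

lemma V_in: "u \<in> Ldual (real b) \<Longrightarrow> V u \<in> Lsp (real b)" and V_linear: "linear_on (Ldual (real b)) V"
  using bounded_operatorD[OF V_Ldual] by auto

lemma V_in': "u \<in> Ldual (real b) \<Longrightarrow> t \<le> real b \<Longrightarrow> V u \<in> Lsp t"
  by (rule Lsp_mono[OF _ V_in])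

lemma V_moment: "u \<in> Ldual (real b) \<Longrightarrow> moment_summable b (\<lambda>k. V u (Ray \<alpha> k))"
  using V_in Lsp_iff by blast

text \<open>For fixed \<open>u\<close> in the dual space the pairing with \<open>v g\<close> is
  bounded in \<open>g\<close> by the dual norm of \<open>u\<close> times the operator bound of
  \<open>v\<close>. Riesz representation then makes the description in \<open>adj\<close>
  meaningful.\<close>

lemma adj_eq:
  assumes u: "u \<in> Ldual (real b)"
  shows "cinner (adj v u) g = pairing u (v g)"
proof -
  obtain C where C: "\<And>g. Lnorm (real b) (v g) \<le> C * norm g"
    using bounded_operatorD(3)[OF v_bounded] by auto
  have "\<exists>f. \<forall>g. cinner f g = pairing u (v g)"
  proof (rule riesz_representation)
    show "linear_on UNIV (\<lambda>g. pairing u (v g))"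
      by (rule linear_onI) (simp_all add: linear_on_add[OF v_linear] linear_on_scale[OF v_linear]
          linear_on_add[OF pairing_linear[OF u]] linear_on_scale[OF pairing_linear[OF u]] v_in)
    fix g
    have "cmod (pairing u (v g)) \<le> Ldual_norm (real b) u * Lnorm (real b) (v g)"
      by (rule pairing_bound[OF u v_in])
    also have "\<dots> \<le> Ldual_norm (real b) u * (C * norm g)"
      by (rule mult_left_mono[OF C Ldual_norm_nonneg[OF u]])
    finally show "cmod (pairing u (v g)) \<le> (Ldual_norm (real b) u * C) * norm g" by (simp add: mult.assoc)
  qed
  then obtain f where f: "\<forall>g. cinner f g = pairing u (v g)" by blast
  have "adj v u = f"
    unfolding adj_def using f by (intro the_equality) (auto intro: cinner_ext)
  then show ?thesis using f by simp
qed

lemma adj_linear: "linear_on (Ldual (real b)) (adj v)"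
proof (rule linear_onI; rule cinner_ext)
  have pl: "pairing (u + w) (v g) = pairing u (v g) + pairing w (v g)"
    "pairing (scaleC c u) (v g) = cnj c * pairing u (v g)"
    if "u \<in> Ldual (real b)" "w \<in> Ldual (real b)" for u w g c
    using linear_on_add[OF pairing_linear'[OF v_in] that] linear_on_scale[OF pairing_linear'[OF v_in] that(1), of g c]
    unfolding pairing_commute[of _ "v g"] by simp_all
  fix u w :: "('a, 'n) gfun" and g :: 'k and c assume u: "u \<in> Ldual (real b)"
  have "cinner (scaleC c (adj v u)) g = cnj (cinner g (scaleC c (adj v u)))" by (rule cinner_commute)
  also have "\<dots> = cnj c * cinner (adj v u) g"
    by (simp add: cinner_scaleC_right cinner_commute[of "adj v u" g])
  finally show "cinner (adj v (scaleC c u)) g = cinner (scaleC c (adj v u)) g"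
    by (simp add: adj_eq u complex_vector.subspace_scale[OF subspace_Ldual] pl(2)[OF u u])
  assume w: "w \<in> Ldual (real b)"
  have "cinner (adj v u + adj v w) g = cnj (cinner g (adj v u + adj v w))" by (rule cinner_commute)
  also have "\<dots> = cinner (adj v u) g + cinner (adj v w) g"
    by (simp add: cinner_add_right cinner_commute[of "adj v u" g] cinner_commute[of "adj v w" g])
  finally show "cinner (adj v (u + w)) g = cinner (adj v u + adj v w) g"
    by (simp add: adj_eq u w complex_vector.subspace_add[OF subspace_Ldual] pl(1)[OF u w])
qed

text \<open>\<open>V_sym\<close> covers square-summable functions only, whereas generalized
  eigenfunctions may grow. The factorization through \<open>v\<close>, \<open>U\<close> and the
  adjoint extends the symmetry to them.\<close>

lemma V_dual_symmetric:
  assumes u: "u \<in> Ldual (real b)" and w: "w \<in> Ldual (real b)"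
  shows "pairing (V u) w = pairing u (V w)"
proof -
  have "pairing u (V w) = cinner (adj v u) (U (adj v w))"
    by (simp add: V_factor[OF w] adj_eq[OF u])
  also have "\<dots> = cnj (cinner (adj v w) (U (adj v u)))"
    by (simp only: U_sa[symmetric] cinner_commute[of "U (adj v u)"])
  also have "\<dots> = cnj (pairing w (V u))"
    by (simp add: V_factor[OF u] adj_eq[OF w])
  finally show ?thesis by (simp only: pairing_commute[of "V u"])
qed

lemma H_linear: "linear_on (Ldual (real b)) (full_op E0 x0 V)"
  by (rule linear_onI) (auto simp: full_op_def linear_on_add[OF free_op_linear] linear_on_scale[OF free_op_linear]
        linear_on_add[OF V_linear] linear_on_scale[OF V_linear] complex_vector.scale_right_distrib)

lemma Et_iff: "\<Psi> \<in> Et \<longleftrightarrow> \<Psi> \<in> Ldual (real b) \<and> free_op E0 x0 \<Psi> = - V \<Psi>"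
  by (auto simp: gen_eigenspace_def full_op_def add_eq_0_iff2)

lemma subspace_Et: "complex_vector.subspace Et"
  unfolding complex_vector.subspace_def gen_eigenspace_def
  using subspace_Ldual[of "real b"] linear_on_0[OF H_linear complex_vector.subspace_0[OF subspace_Ldual]]
  by (auto simp: complex_vector.subspace_def linear_on_add[OF H_linear] linear_on_scale[OF H_linear])

lemma subspace_Eb: "complex_vector.subspace Eb"
  unfolding bound_eigenspace_def by (rule complex_vector.subspace_inter[OF subspace_Et subspace_Lsp])

text \<open>With \<open>f = - V \<Psi>\<close> this is the multiple of the linear solution in
  \<open>h_ray_solution\<close>. The formula makes sense and is linear on all of
  \<open>Ldual (real b)\<close>, not only on solutions.\<close>

definition growth :: "('a, 'n) gfun \<Rightarrow> 'n \<Rightarrow> complex" where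
  "growth \<Psi> \<alpha> = \<Psi> (Ray \<alpha> 0) + moment 0 (\<lambda>k. V \<Psi> (Ray \<alpha> k))"

lemma growth_linear: "linear_on (Ldual (real b)) (\<lambda>\<Psi>. growth \<Psi> \<alpha>)"
proof (rule linear_onI)
  have s: "(\<lambda>k. V u (Ray \<alpha> k)) summable_on UNIV" if "u \<in> Ldual (real b)" for u
    using moment_term_summable[OF V_moment[OF that], of 0] by simp
  fix u w :: "('a, 'n) gfun" and c assume u: "u \<in> Ldual (real b)"
  show "growth (scaleC c u) \<alpha> = scaleC c (growth u \<alpha>)"
    by (simp add: growth_def moment_def linear_on_scale[OF V_linear u] infsum_cmult_right' distrib_left)
  assume w: "w \<in> Ldual (real b)"
  show "growth (u + w) \<alpha> = growth u \<alpha> + growth w \<alpha>"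
    by (simp add: growth_def moment_def linear_on_add[OF V_linear u w] infsum_add s u w)
qed

lemma Et_representation:
  assumes "\<Psi> \<in> Et"
  shows "\<Psi> = G00 E0 x0 (- V \<Psi>) + (\<Sum>\<alpha>\<in>UNIV. scaleC (growth \<Psi> \<alpha>) (ray_n \<alpha>))"
proof -
  have L: "- V \<Psi> \<in> Lsp 0"
    using assms V_in' by (auto simp: Et_iff intro!: complex_vector.subspace_neg[OF subspace_Lsp])
  have "moment 0 (\<lambda>k. (- V \<Psi>) (Ray \<alpha> k)) = - moment 0 (\<lambda>k. V \<Psi> (Ray \<alpha> k))" for \<alpha>
    by (simp add: moment_def infsum_uminus)
  then show ?thesis
    using free_op_solution[OF conn L, of x0 \<Psi>] assms by (simp add: Et_iff growth_def)
qed

lemma ray_n_sum_Ldual: "(\<Sum>\<alpha>\<in>UNIV. scaleC (c \<alpha>) (ray_n \<alpha>)) \<in> Ldual 1"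
  by (intro complex_vector.subspace_sum[OF subspace_Ldual] complex_vector.subspace_scale[OF subspace_Ldual] ray_n_Ldual)

text \<open>Bootstrap: \<open>V\<close> maps the large dual space into weighted summable functions,
  so the representation through \<open>G00\<close> improves the a priori bound to linear growth.
  This is what allows pairings with functions of weight \<open>b - 2\<close>.\<close>

lemma Et_Ldual_1: "\<Psi> \<in> Et \<Longrightarrow> \<Psi> \<in> Ldual 1"
  by (subst Et_representation, assumption)
    (auto intro!: complex_vector.subspace_add[OF subspace_Ldual] G00_Ldual ray_n_sum_Ldual V_in'
      complex_vector.subspace_neg[OF subspace_Lsp] simp: Et_iff)

lemma Et_Ldual: "\<Psi> \<in> Et \<Longrightarrow> \<Psi> \<in> Ldual (real b - 2)"
  using Ldual_mono(1)[OF _ Et_Ldual_1] b2(3) by force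

lemma G00_ones_plus_L:
  assumes f: "f \<in> Lsp (real b)"
  shows "G00 E0 x0 f \<in> ones_plus_L (real b - 2)"
proof -
  let ?s = "\<Sum>\<alpha>\<in>UNIV. scaleC (moment 1 (\<lambda>k. f (Ray \<alpha> k))) (ray_1 \<alpha>)"
  have "G00 E0 x0 f - ?s \<in> Lsp (real b - 2)"
    using G00_asymptotics[of f "b - 2" E0 x0] f unfolding b2(1) b2(2) by simp
  moreover have "?s \<in> complex_vector.span (range ray_1)"
    by (intro complex_vector.span_sum complex_vector.span_scale complex_vector.span_base) auto
  ultimately have "\<exists>u w. G00 E0 x0 f = u + w \<and> u \<in> complex_vector.span (range ray_1) \<and> w \<in> Lsp (real b - 2)"
    by (intro exI[of _ ?s] exI[of _ "G00 E0 x0 f - ?s"]) auto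
  then show ?thesis by (auto simp: ones_plus_L_def)
qed

lemma Et_asymptotics:
  assumes "\<Psi> \<in> Et"
  shows "\<Psi> - (\<Sum>\<alpha>\<in>UNIV. scaleC (growth \<Psi> \<alpha>) (ray_n \<alpha>)) \<in> ones_plus_L (real b - 2)"
proof -
  have "- V \<Psi> \<in> Lsp (real b)"
    using assms V_in by (auto simp: Et_iff intro!: complex_vector.subspace_neg[OF subspace_Lsp])
  moreover have "\<Psi> - (\<Sum>\<alpha>\<in>UNIV. scaleC (growth \<Psi> \<alpha>) (ray_n \<alpha>)) = G00 E0 x0 (- V \<Psi>)"
    using Et_representation[OF assms] by (metis add_diff_cancel_right')
  ultimately show ?thesis using G00_ones_plus_L by simp
qed

text \<open>Two candidates differ by a linear function lying in a space of bounded functions. Hence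
  the vectors in the definition of a non-resonance basis are forced to be the growth rates.\<close>

lemma growth_unique:
  assumes \<Psi>: "\<Psi> \<in> Et" and c: "\<Psi> - (\<Sum>\<alpha>\<in>UNIV. scaleC (c \<alpha>) (ray_n \<alpha>)) \<in> ones_plus_L (real b - 2)"
  shows "c \<alpha> = growth \<Psi> \<alpha>"
proof -
  have "(\<Sum>\<alpha>\<in>UNIV. scaleC (c \<alpha> - growth \<Psi> \<alpha>) (ray_n \<alpha>))
    = (\<Psi> - (\<Sum>\<alpha>\<in>UNIV. scaleC (growth \<Psi> \<alpha>) (ray_n \<alpha>))) - (\<Psi> - (\<Sum>\<alpha>\<in>UNIV. scaleC (c \<alpha>) (ray_n \<alpha>)))"
    by (simp add: complex_vector.scale_left_diff_distrib sum_subtractf)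
  also have "\<dots> \<in> ones_plus_L (real b - 2)"
    by (intro complex_vector.subspace_diff[OF subspace_ones_plus_L] Et_asymptotics \<Psi> c)
  finally have "(\<Sum>\<alpha>\<in>UNIV. scaleC (c \<alpha> - growth \<Psi> \<alpha>) (ray_n \<alpha>)) \<in> (Ldual 0 :: ('a, 'n) gfun set)"
    using b2(3) by (intro ones_plus_L_sub_Ldual) auto
  from ray_n_unbounded[OF this, of \<alpha>] show ?thesis by simp
qed

text \<open>Without linear growth only constants plus a summable part remain, by
  \<open>Et_asymptotics\<close>; by \<open>res\<close> the constants must then be absent as
  well.\<close>

lemma Et_no_growth:
  assumes "\<Psi> \<in> Et" "\<And>\<alpha>. growth \<Psi> \<alpha> = 0"
  shows "\<Psi> \<in> Eb"
  using Et_asymptotics[OF assms(1)] assms unfolding res[symmetric] by (simp add: res_eigenspace_def)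

lemma Eb_Et: "\<Psi> \<in> Eb \<Longrightarrow> \<Psi> \<in> Et" by (simp add: bound_eigenspace_def)
lemma Eb_Lsp: "\<Psi> \<in> Eb \<Longrightarrow> \<Psi> \<in> Lsp (real b - 2)" by (simp add: bound_eigenspace_def)
lemma Et_Ldual_b: "\<Psi> \<in> Et \<Longrightarrow> \<Psi> \<in> Ldual (real b)" by (simp add: Et_iff)
lemma Eb_ell2: "\<Psi> \<in> Eb \<Longrightarrow> \<Psi> \<in> ell2"
  using Lsp_sub_ell2[OF Eb_Lsp] b2(3) by auto

lemma Eb_growth:
  assumes "\<Psi> \<in> Eb"
  shows "growth \<Psi> \<alpha> = 0"
proof -
  have "\<Psi> \<in> ones_plus_L (real b - 2)" using assms unfolding res[symmetric] by (simp add: res_eigenspace_def)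
  then show ?thesis using growth_unique[OF Eb_Et[OF assms], of "\<lambda>_. 0" \<alpha>] by simp
qed

text \<open>Without growth, \<Psi> on a half-line is the tail of \<open>V \<Psi>\<close> minus its
  first moment. Both \<Psi> and the tail are summable and so tend to zero, which forces the constant
  to vanish.\<close>

lemma
  assumes \<Psi>: "\<Psi> \<in> Eb"
  shows Eb_moment: "moment 1 (\<lambda>k. V \<Psi> (Ray \<alpha> k)) = 0"
    and Eb_tail: "\<Psi> (Ray \<alpha> k) = tail (\<lambda>k. V \<Psi> (Ray \<alpha> k)) k"
proof -
  let ?f = "\<lambda>k. V \<Psi> (Ray \<alpha> k)"
  have D: "\<Psi> \<in> Ldual (real b)" using Eb_Et[OF \<Psi>] Et_Ldual_b by blast
  have f: "moment_summable b ?f" by (rule V_moment[OF D])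
  have "\<Psi> = G00 E0 x0 (- V \<Psi>)" using Et_representation[OF Eb_Et[OF \<Psi>]] Eb_growth[OF \<Psi>] by simp
  then have "\<Psi> (Ray \<alpha> k) = green (\<lambda>k. - ?f k) k" for k
    by (metis (no_types, lifting) G00_Ray ext uminus_apply)
  also have "green (\<lambda>k. - ?f k) k = - green ?f k" for k by (simp add: green_def infsum_uminus)
  finally have "\<Psi> (Ray \<alpha> k) = - green ?f k" for k .
  then have eq: "\<Psi> (Ray \<alpha> k) = tail ?f k - moment 1 ?f" for k
    using green_eq_tail[OF moment_summable_mono[OF f, of 1]] b4 by simp
  have "moment_summable (b - 2) (\<lambda>k. \<Psi> (Ray \<alpha> k))" using Eb_Lsp[OF \<Psi>] unfolding b2(1) Lsp_iff by blast
  then have "(\<lambda>k. \<Psi> (Ray \<alpha> k)) summable_on UNIV" using moment_term_summable[of "b - 2" _ 0] by simp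
  then have 1: "(\<lambda>k. \<Psi> (Ray \<alpha> k)) \<longlonglongrightarrow> 0" by (intro summable_LIMSEQ_zero summable_on_imp_summable)
  have "moment_summable (b - 2) (tail ?f)" using f b2(2) by (intro moment_summable_tail) simp
  then have "tail ?f summable_on UNIV" using moment_term_summable[of "b - 2" _ 0] by simp
  then have "tail ?f \<longlonglongrightarrow> 0" by (intro summable_LIMSEQ_zero summable_on_imp_summable)
  then have "(\<lambda>k. tail ?f k - moment 1 ?f) \<longlonglongrightarrow> 0 - moment 1 ?f" by (intro tendsto_intros)
  with 1 show m: "moment 1 ?f = 0" unfolding eq using LIMSEQ_unique by fastforce
  show "\<Psi> (Ray \<alpha> k) = tail ?f k" using eq m by simp
qed

lemma Eb_inner_product: "inner_product_on Eb pairing"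
  by (rule inner_product_on_subset[OF ell2_inner_product subspace_Eb]) (auto intro: Eb_ell2)

text \<open>A bound state is small near infinity compared with its weighted sup norm, because the
  potential improves the weight.\<close>

lemma Eb_separated:
  obtains I where "finite I" "\<And>\<Psi>. \<Psi> \<in> Eb \<Longrightarrow> (\<And>y. y \<in> I \<Longrightarrow> \<Psi> y = 0) \<Longrightarrow> \<Psi> = 0"
proof -
  obtain C where C: "\<And>u. u \<in> Ldual (real b) \<Longrightarrow> Lnorm (real b) (V u) \<le> C * Ldual_norm (real b) u"
    using bounded_operatorD(3)[OF V_Ldual] by auto
  \<comment> \<open>Beyond position \<open>R\<close> the bound C N, where N is the weighted norm of
    the bound state, is at most half of N times the position. The weighted norm then turns out to be
    at most half of itself.\<close>
  obtain R where R: "2 * C < real R" using reals_Archimedean2 by blast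
  define I :: "('a, 'n) vertex set" where "I = range Core \<union> (\<Union>\<alpha>. Ray \<alpha> ` {..<R})"
  have "\<Psi> = 0" if \<Psi>: "\<Psi> \<in> Eb" and z: "\<And>y. y \<in> I \<Longrightarrow> \<Psi> y = 0" for \<Psi>
  proof -
    let ?N = "Ldual_norm (real b) \<Psi>"
    have D: "\<Psi> \<in> Ldual (real b)" using Eb_Et[OF \<Psi>] Et_Ldual_b by blast
    have N: "0 \<le> ?N" by (rule Ldual_norm_nonneg[OF D])
    have "cmod (\<Psi> y) \<le> (?N / 2) * weight (real b) y" for y
    proof (cases "y \<in> I")
      case True
      then show ?thesis using z N weight_pos[of "real b" y] by simp
    next
      case False
      then obtain \<alpha> k where yk: "y = Ray \<alpha> k" by (cases y) (auto simp: I_def)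
      with False have "\<not> k < R" by (auto simp: I_def)
      with yk have y: "y = Ray \<alpha> k" "R \<le> k" by simp_all
      have m: "moment_summable 1 (\<lambda>k. V \<Psi> (Ray \<alpha> k))"
        using b4 by (intro moment_summable_mono[OF V_moment[OF D]]) simp
      have "cmod (\<Psi> y) = cmod (tail (\<lambda>k. V \<Psi> (Ray \<alpha> k)) k)" by (simp add: y Eb_tail[OF \<Psi>])
      also have "\<dots> \<le> (\<Sum>\<^sub>\<infinity>m. real (Suc m) ^ 1 * cmod (V \<Psi> (Ray \<alpha> m)))"
      proof (rule norm_infsum_le[OF tail_has_sum[OF m] has_sum_infsum])
        show "(\<lambda>m. real (Suc m) ^ 1 * cmod (V \<Psi> (Ray \<alpha> m))) summable_on UNIV"
          using m unfolding moment_summable_def .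
        show "cmod (of_nat (j - k) * V \<Psi> (Ray \<alpha> j)) \<le> real (Suc j) ^ 1 * cmod (V \<Psi> (Ray \<alpha> j))" for j
          unfolding norm_mult norm_of_nat by (intro mult_right_mono) auto
      qed
      also have "\<dots> \<le> Lnorm (real b) (V \<Psi>)" using b4 by (intro ray_sum_le_Lnorm V_in D) simp
      also have "\<dots> \<le> C * ?N" by (rule C[OF D])
      also have "\<dots> \<le> (?N / 2) * real (Suc k) ^ 1"
        using mult_right_mono[of "2 * C" "real (Suc k)" ?N] R y N by (simp add: algebra_simps)
      also have "\<dots> \<le> (?N / 2) * real (Suc k) ^ b" using b4 N by (intro mult_left_mono power_increasing) auto
      also have "\<dots> \<le> (?N / 2) * weight (real b) y"
        unfolding y using N by (intro mult_left_mono weight_Ray_bounds) auto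
      finally show ?thesis .
    qed
    then have "?N \<le> ?N / 2" by (rule Ldual_norm_le)
    then have "?N = 0" using N by simp
    then show ?thesis using Ldual_bound[OF D] by (auto simp: fun_eq_iff)
  qed
  moreover have "finite I" by (auto simp: I_def)
  ultimately show thesis using that by blast
qed

section \<open>Orthonormal bases and the two projections\<close>

lemma Lsp_0_product:
  assumes "\<Phi> \<in> Eb" "\<Psi> \<in> Ldual (real b - 2)"
  shows "(\<lambda>y. cnj (\<Phi> y) * \<Psi> y) \<in> Lsp 0"
proof -
  have "(\<lambda>y. cmod (cnj (\<Psi> y) * \<Phi> y)) summable_on UNIV"
    by (rule pairing_abs_summable[OF assms(2) Eb_Lsp[OF assms(1)]])
  then show ?thesis by (simp add: Lsp_def weight_0 norm_mult mult.commute)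
qed

lemma bound_basis_iff: "bound_basis E0 x0 V (real b) B \<longleftrightarrow> inner_product_on.orthonormal_basis Eb pairing B"
proof -
  interpret inner_product_on Eb pairing by (rule Eb_inner_product)
  show ?thesis
  proof
    assume B: "bound_basis E0 x0 V (real b) B"
    then have sp: "complex_vector.span B = Eb" and fin: "finite B" by (auto simp: bound_basis_def)
    have on: "orthonormal B"
      using B complex_vector.span_base[of _ B] by (auto simp: bound_basis_def orthonormal_def)
    have "x = proj B x" if x: "x \<in> Eb" for x
    proof -
      obtain a where "x = (\<Sum>b\<in>B. scaleC (a b) b)"
        using x unfolding sp[symmetric] complex_vector.span_finite[OF fin] by auto
      then show ?thesis by (rule orthonormal_spanning[OF on])
    qed
    then show "orthonormal_basis B" using on by (auto simp: orthonormal_basis_def)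
  next
    assume B: "orthonormal_basis B"
    then have on: "orthonormal B" and BE: "B \<subseteq> Eb" by (auto simp: orthonormal_basis_def orthonormal_def)
    have "(\<lambda>y. cnj (\<Phi> y) * \<Psi> y) \<in> Lsp 0" if "\<Phi> \<in> B" "\<Psi> \<in> B" for \<Phi> \<Psi>
      using that BE by (intro Lsp_0_product Et_Ldual Eb_Et) auto
    then show "bound_basis E0 x0 V (real b) B"
      using on orthonormal_independent[OF on] orthonormal_basis_span[OF B]
      by (auto simp: bound_basis_def orthonormal_def)
  qed
qed

lemma ex_bound_basis: "\<exists>B. bound_basis E0 x0 V (real b) B"
proof -
  obtain I where I: "finite I" "\<And>\<Psi>. \<Psi> \<in> Eb \<Longrightarrow> (\<And>y. y \<in> I \<Longrightarrow> \<Psi> y = 0) \<Longrightarrow> \<Psi> = 0"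
    using Eb_separated by blast
  have "\<exists>B. inner_product_on.orthonormal_basis Eb pairing B"
    by (rule ex_orthonormal_basis[OF I(1) Eb_inner_product, of "\<lambda>y \<Psi>. \<Psi> y"])
      (use I(2) in \<open>auto intro!: linear_onI\<close>)
  then show ?thesis by (simp add: bound_basis_iff)
qed

lemma basis_projection_eq: "basis_projection B u = (\<Sum>\<Psi>\<in>B. scaleC (pairing \<Psi> u) \<Psi>)"
  by (simp add: basis_projection_def ket_bra_def)

lemma
  assumes B: "bound_basis E0 x0 V (real b) B"
  shows bound_projection_in: "basis_projection B u \<in> Eb"
    and bound_projection_pairing: "u \<in> Ldual (real b - 2) \<Longrightarrow> \<Phi> \<in> Eb \<Longrightarrow>
      pairing \<Phi> (basis_projection B u) = pairing \<Phi> u"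
proof -
  interpret inner_product_on Eb pairing by (rule Eb_inner_product)
  have B': "orthonormal_basis B" using B by (simp add: bound_basis_iff)
  show "basis_projection B u \<in> Eb"
    unfolding basis_projection_eq using B'
    by (intro subspace_sum_scale[OF subspace_Eb]) (auto simp: orthonormal_basis_def orthonormal_def)
  assume u: "u \<in> Ldual (real b - 2)" and \<Phi>: "\<Phi> \<in> Eb"
  have "linear_on Eb (pairing u)"
    by (rule linear_on_subset[OF pairing_linear[OF u]]) (auto intro: Eb_Lsp)
  then have "linear_on Eb (\<lambda>\<Psi>. cnj (pairing \<Psi> u))" by (simp only: pairing_commute[of _ u] complex_cnj_cnj)
  then show "pairing \<Phi> (basis_projection B u) = pairing \<Phi> u"
    unfolding basis_projection_eq by (rule riesz_basis_sum[OF B' _ \<Phi>])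
qed

text \<open>Canonical representatives of the generalized eigenfunctions modulo bound states. No
  basis enters, which is the source of the uniqueness of the non-resonance projection.\<close>

definition Wt :: "('a, 'n) gfun set" where
  "Wt = {\<Psi> \<in> Et. \<forall>\<Phi>\<in>Eb. pairing \<Phi> \<Psi> = 0}"

definition growth_ip :: "('a, 'n) gfun \<Rightarrow> ('a, 'n) gfun \<Rightarrow> complex" where
  "growth_ip \<Phi> \<Psi> = (\<Sum>\<alpha>\<in>UNIV. cnj (growth \<Phi> \<alpha>) * growth \<Psi> \<alpha>)"

lemma Wt_Et: "\<Psi> \<in> Wt \<Longrightarrow> \<Psi> \<in> Et" by (simp add: Wt_def)

lemma Wt_Eb: "\<Psi> \<in> Wt \<Longrightarrow> \<Psi> \<in> Eb \<Longrightarrow> \<Psi> = 0"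
  using inner_product_on.ip_definite[OF Eb_inner_product, of \<Psi>] by (auto simp: Wt_def)

lemma pairing_Eb_linear: "\<Phi> \<in> Eb \<Longrightarrow> linear_on (Ldual (real b - 2)) (pairing \<Phi>)"
  by (rule pairing_linear'[OF Eb_Lsp])

lemma subspace_Wt: "complex_vector.subspace Wt"
  unfolding complex_vector.subspace_def
proof (intro conjI ballI allI)
  note [simp] = linear_on_add[OF pairing_Eb_linear] linear_on_scale[OF pairing_Eb_linear] Et_Ldual
  show "0 \<in> Wt"
    using complex_vector.subspace_0[OF subspace_Et]
    by (auto simp: Wt_def linear_on_0[OF pairing_Eb_linear Et_Ldual])
  fix x y c assume "x \<in> Wt"
  then show "scaleC c x \<in> Wt"
    by (auto simp: Wt_def intro: complex_vector.subspace_scale[OF subspace_Et])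
  assume "y \<in> Wt"
  with \<open>x \<in> Wt\<close> show "x + y \<in> Wt"
    by (auto simp: Wt_def intro: complex_vector.subspace_add[OF subspace_Et])
qed

text \<open>Definiteness: vanishing growth makes the function a bound state, and an element of
  \<open>Wt\<close> that is a bound state is orthogonal to itself.\<close>

lemma Wt_inner_product: "inner_product_on Wt growth_ip"
proof
  note g = linear_on_subset[OF growth_linear, of Et]
  have EtL: "Et \<subseteq> Ldual (real b)" using Et_Ldual_b by auto
  fix x y assume x: "x \<in> Wt"
  show "linear_on Wt (growth_ip x)"
    by (rule linear_onI) (auto simp: growth_ip_def linear_on_add[OF g] linear_on_scale[OF g] EtL Wt_Et
        distrib_left sum.distrib sum_distrib_left mult.left_commute)
  show "growth_ip x y = cnj (growth_ip y x)" by (simp add: growth_ip_def mult.commute)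
  have self: "growth_ip x x = of_real (\<Sum>\<alpha>\<in>UNIV. (cmod (growth x \<alpha>))\<^sup>2)"
    unfolding growth_ip_def of_real_sum
    by (intro sum.cong) (simp_all add: complex_norm_square mult.commute del: of_real_power)
  show "0 \<le> Re (growth_ip x x)" unfolding self Re_complex_of_real by (intro sum_nonneg) auto
  assume "growth_ip x x = 0"
  then have "(\<Sum>\<alpha>\<in>UNIV. (cmod (growth x \<alpha>))\<^sup>2) = 0" unfolding self of_real_eq_0_iff .
  then have "growth x \<alpha> = 0" for \<alpha> by (simp add: sum_nonneg_eq_0_iff)
  then show "x = 0" using Wt_Eb[OF x] Et_no_growth[OF Wt_Et[OF x]] by blast
qed (rule subspace_Wt)

text \<open>By \<open>growth_unique\<close> the coefficient vectors are the growth rates, so their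
  orthonormality is orthonormality for \<open>growth_ip\<close>. Every class modulo bound states has
  exactly one representative in \<open>Wt\<close>, so a basis of the quotient consisting of such
  representatives is a basis of \<open>Wt\<close>.\<close>

lemma nonresonance_basis_iff:
  "nonresonance_basis E0 x0 V (real b) B \<longleftrightarrow> inner_product_on.orthonormal_basis Wt growth_ip B"
proof -
  interpret inner_product_on Wt growth_ip by (rule Wt_inner_product)
  show ?thesis
  proof
    assume B: "nonresonance_basis E0 x0 V (real b) B"
    then have fin: "finite B" and BE: "B \<subseteq> Et" 
      and gen: "\<And>\<Phi>. \<Phi> \<in> Et \<Longrightarrow> \<exists>a. \<Phi> - (\<Sum>\<Psi>\<in>B. scaleC (a \<Psi>) \<Psi>) \<in> Eb"
      by (auto simp: nonresonance_basis_def quotient_basis_def res)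
    have BW: "B \<subseteq> Wt" using B BE by (auto simp: nonresonance_basis_def Wt_def)
    obtain c where c: "\<And>\<Psi> \<Phi>. \<Psi> \<in> B \<Longrightarrow> \<Phi> \<in> B \<Longrightarrow> (\<Sum>\<alpha>\<in>UNIV. cnj (c \<Phi> \<alpha>) * c \<Psi> \<alpha>) = (if \<Phi> = \<Psi> then 1 else 0)"
      "\<And>\<Psi>. \<Psi> \<in> B \<Longrightarrow> \<Psi> - (\<Sum>\<alpha>\<in>UNIV. scaleC (c \<Psi> \<alpha>) (ray_n \<alpha>)) \<in> ones_plus_L (real b - 2)"
      using B unfolding nonresonance_basis_def by blast
    have "c \<Psi> \<alpha> = growth \<Psi> \<alpha>" if "\<Psi> \<in> B" for \<Psi> \<alpha>
      using growth_unique[OF _ c(2)[OF that]] that BE by auto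
    then have on: "orthonormal B" using c(1) fin BW by (auto simp: orthonormal_def growth_ip_def)
    have "x = proj B x" if x: "x \<in> Wt" for x
    proof -
      obtain a where a: "x - (\<Sum>\<Psi>\<in>B. scaleC (a \<Psi>) \<Psi>) \<in> Eb" using gen[OF Wt_Et[OF x]] by blast
      have "x - (\<Sum>\<Psi>\<in>B. scaleC (a \<Psi>) \<Psi>) \<in> Wt"
        by (intro complex_vector.subspace_diff[OF subspace_Wt] x subspace_sum_scale[OF subspace_Wt BW])
      then have "x = (\<Sum>\<Psi>\<in>B. scaleC (a \<Psi>) \<Psi>)" using Wt_Eb a by fastforce
      then show ?thesis by (rule orthonormal_spanning[OF on])
    qed
    then show "orthonormal_basis B" using on by (auto simp: orthonormal_basis_def)
  next
    assume B: "orthonormal_basis B"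
    then have on: "orthonormal B" and BW: "B \<subseteq> Wt" and fin: "finite B"
      by (auto simp: orthonormal_basis_def orthonormal_def)
    have BE: "B \<subseteq> Et" using BW Wt_Et by auto
    obtain B0 where B0: "bound_basis E0 x0 V (real b) B0" using ex_bound_basis by blast
    have "quotient_basis Et Eb B"
      unfolding quotient_basis_def
    proof (intro conjI allI impI ballI)
      fix a \<Psi> assume a: "(\<Sum>\<Psi>\<in>B. scaleC (a \<Psi>) \<Psi>) \<in> Eb" and \<Psi>: "\<Psi> \<in> B"
      have "(\<Sum>\<Psi>\<in>B. scaleC (a \<Psi>) \<Psi>) = 0"
        by (rule Wt_Eb[OF subspace_sum_scale[OF subspace_Wt BW] a])
      then show "a \<Psi> = 0"
        using orthonormal_ip_sum[OF on \<Psi>, of a] linear_on_0[OF ip_linear, of \<Psi>] \<Psi> BW by auto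
    next
      fix \<Phi> assume \<Phi>: "\<Phi> \<in> Et"
      \<comment> \<open>Removing the bound part moves the representative into \<open>Wt\<close>
        without changing its class.\<close>
      let ?P = "basis_projection B0 \<Phi>"
      have P: "?P \<in> Eb" by (rule bound_projection_in[OF B0])
      have "\<Phi> - ?P \<in> Et" by (intro complex_vector.subspace_diff[OF subspace_Et] \<Phi> Eb_Et P)
      moreover have "pairing \<Phi>' (\<Phi> - ?P) = 0" if "\<Phi>' \<in> Eb" for \<Phi>'
        using linear_on_diff[OF subspace_Ldual pairing_Eb_linear[OF that] Et_Ldual[OF \<Phi>] Et_Ldual[OF Eb_Et[OF P]]]
          bound_projection_pairing[OF B0 Et_Ldual[OF \<Phi>] that] by simp
      ultimately have "\<Phi> - ?P \<in> Wt" by (simp add: Wt_def)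
      then have S: "(\<Sum>\<Psi>\<in>B. scaleC (growth_ip \<Psi> (\<Phi> - ?P)) \<Psi>) = \<Phi> - ?P"
        using B by (simp add: orthonormal_basis_def proj_def)
      have "\<Phi> - (\<Sum>\<Psi>\<in>B. scaleC (growth_ip \<Psi> (\<Phi> - ?P)) \<Psi>) \<in> Eb"
        unfolding S using P by simp
      then show "\<exists>a. \<Phi> - (\<Sum>\<Psi>\<in>B. scaleC (a \<Psi>) \<Psi>) \<in> Eb"
        by (rule exI[where x = "\<lambda>\<Psi>. growth_ip \<Psi> (\<Phi> - ?P)"])
    qed (use fin BE in auto)
    moreover have "(\<lambda>y. cnj (\<Phi> y) * \<Psi> y) \<in> Lsp 0 \<and> pairing \<Phi> \<Psi> = 0" if "\<Psi> \<in> B" "\<Phi> \<in> Eb" for \<Phi> \<Psi>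
      using that BW Lsp_0_product[OF _ Et_Ldual] by (auto simp: Wt_def)
    moreover have "\<exists>c. (\<forall>\<Psi>\<in>B. \<forall>\<Phi>\<in>B. (\<Sum>\<alpha>\<in>UNIV. cnj (c \<Phi> \<alpha>) * c \<Psi> \<alpha>) = (if \<Phi> = \<Psi> then 1 else 0)) \<and>
        (\<forall>\<Psi>\<in>B. \<Psi> - (\<Sum>\<alpha>\<in>UNIV. scaleC (c \<Psi> \<alpha>) (ray_n \<alpha>)) \<in> ones_plus_L (real b - 2))"
      using on Et_asymptotics BE by (intro exI[of _ growth]) (auto simp: orthonormal_def growth_ip_def)
    ultimately show "nonresonance_basis E0 x0 V (real b) B"
      by (auto simp: nonresonance_basis_def res)
  qed
qed

text \<open>The growth rates on the finitely many half-lines separate the points of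
  \<open>Wt\<close>.\<close>

lemma ex_nonresonance_basis: "\<exists>B. nonresonance_basis E0 x0 V (real b) B"
proof -
  have "\<exists>B. inner_product_on.orthonormal_basis Wt growth_ip B"
  proof (rule ex_orthonormal_basis[OF _ Wt_inner_product, of UNIV "\<lambda>\<alpha> \<Psi>. growth \<Psi> \<alpha>"])
    show "linear_on Wt (\<lambda>\<Psi>. growth \<Psi> \<alpha>)" for \<alpha>
      by (rule linear_on_subset[OF growth_linear]) (auto intro: Wt_Et Et_Ldual_b)
    show "x = 0" if "x \<in> Wt" "\<And>\<alpha>. \<alpha> \<in> UNIV \<Longrightarrow> growth x \<alpha> = 0" for x
      using that Wt_Eb Et_no_growth Wt_Et by blast
  qed simp
  then show ?thesis by (simp add: nonresonance_basis_iff)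
qed

lemma
  assumes B: "nonresonance_basis E0 x0 V (real b) B" and u: "u \<in> Lsp (real b - 2)"
  shows nonresonance_projection_in: "basis_projection B u \<in> Wt"
    and nonresonance_projection_ip: "\<Phi> \<in> Wt \<Longrightarrow> growth_ip \<Phi> (basis_projection B u) = pairing \<Phi> u"
proof -
  interpret inner_product_on Wt growth_ip by (rule Wt_inner_product)
  have B': "orthonormal_basis B" using B by (simp add: nonresonance_basis_iff)
  then have BW: "B \<subseteq> Wt" by (auto simp: orthonormal_basis_def orthonormal_def)
  then show "basis_projection B u \<in> Wt"
    unfolding basis_projection_eq by (rule subspace_sum_scale[OF subspace_Wt])
  have "linear_on Wt (pairing u)"
    by (rule linear_on_subset[OF pairing_linear'[OF u]]) (auto intro: Wt_Et Et_Ldual)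
  then have l: "linear_on Wt (\<lambda>\<Psi>. cnj (pairing \<Psi> u))" by (simp only: pairing_commute[of _ u] complex_cnj_cnj)
  show "growth_ip \<Phi> (basis_projection B u) = pairing \<Phi> u" if "\<Phi> \<in> Wt"
    unfolding basis_projection_eq by (rule riesz_basis_sum[OF B' l that])
qed

lemma nonresonance_projection_unique:
  assumes "nonresonance_basis E0 x0 V (real b) B" "u \<in> Lsp (real b - 2)"
    and "y \<in> Wt" "\<And>\<Phi>. \<Phi> \<in> Wt \<Longrightarrow> growth_ip \<Phi> y = pairing \<Phi> u"
  shows "basis_projection B u = y"
  by (rule inner_product_on.unique_by_ip[OF Wt_inner_product])
    (simp_all add: assms nonresonance_projection_in nonresonance_projection_ip)

lemma nonresonance_projection_independent:
  assumes "nonresonance_basis E0 x0 V (real b) B" "nonresonance_basis E0 x0 V (real b) B'"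
    and "u \<in> Lsp (real b - 2)"
  shows "basis_projection B u = basis_projection B' u"
  by (rule nonresonance_projection_unique)
    (simp_all add: assms nonresonance_projection_in nonresonance_projection_ip)

end

section \<open>Expansions in powers of the spectral parameter\<close>

text \<open>On the path \<open>\<kappa> = 2 sinh (\<phi>/2)\<close>, \<open>\<phi> = t (1 + i)\<close>, the decaying exponential is \<open>z = e\<^sup>-\<^sup>\<phi>\<close>
  without a square root, and \<open>\<kappa>\<^sup>2\<close> is not real for \<open>0 < t < 1\<close>, so the path avoids the spectrum.\<close>

definition phi :: "real \<Rightarrow> complex" where "phi t = of_real t * (1 + \<i>)"
definition kap :: "real \<Rightarrow> complex" where "kap t = exp (phi t / 2) - exp (- (phi t / 2))"

lemma kap_square: "(kap t)\<^sup>2 = exp (phi t) + exp (- phi t) - 2"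
proof -
  have 1: "exp (phi t / 2) * exp (phi t / 2) = exp (phi t)" "exp (- (phi t / 2)) * exp (- (phi t / 2)) = exp (- phi t)"
    "exp (phi t / 2) * exp (- (phi t / 2)) = 1"
    by (simp_all add: exp_add[symmetric])
  have "(kap t)\<^sup>2 = exp (phi t / 2) * exp (phi t / 2) + exp (- (phi t / 2)) * exp (- (phi t / 2))
      - 2 * (exp (phi t / 2) * exp (- (phi t / 2)))"
    by (simp add: kap_def power2_eq_square algebra_simps)
  then show ?thesis unfolding 1 by simp
qed

lemma kap_exp: "(2 + (kap t)\<^sup>2) * exp (- phi t) = 1 + (exp (- phi t))\<^sup>2"
proof -
  have "exp (phi t) * exp (- phi t) = 1" by (simp add: exp_add[symmetric])
  then show ?thesis unfolding kap_square by (simp add: algebra_simps power2_eq_square)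
qed

lemma Re_phi: "Re (phi t) = t" and Im_phi: "Im (phi t) = t" and norm_phi: "cmod (phi t) = \<bar>t\<bar> * sqrt 2"
  by (simp_all add: phi_def norm_mult cmod_def real_sqrt_mult)

lemma kap_right_half_plane:
  assumes "0 < t" "t < 1"
  shows "0 < Re (kap t)"
proof -
  have "Re (kap t) = (exp (t / 2) - exp (- (t / 2))) * cos (t / 2)"
    by (simp add: kap_def Re_exp Re_phi Im_phi algebra_simps)
  moreover have "0 < cos (t / 2)" using assms pi_gt3 by (intro cos_gt_zero) auto
  moreover have "exp (- (t / 2)) < exp (t / 2)" using assms by simp
  ultimately show ?thesis by simp
qed

lemma kap_square_nonreal:
  assumes "0 < t" "t < 1"
  shows "Im (- (kap t)\<^sup>2) \<noteq> 0"
proof -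
  have "Im ((kap t)\<^sup>2) = (exp t - exp (- t)) * sin t"
    unfolding kap_square by (simp add: Im_exp Re_phi Im_phi algebra_simps)
  moreover have "0 < sin t" using assms pi_gt3 by (intro sin_gt_zero) auto
  moreover have "exp (- t) < exp t" using assms by simp
  ultimately show ?thesis by simp
qed

text \<open>\<open>kap t\<close> is odd in \<open>phi t\<close>, so the quadratic Taylor terms
  cancel and the difference is cubic. For t \<le> 1/2 the modulus of \<open>phi t\<close> is at most
  1 and the difference at most half of it, so errors in \<phi> can be restated in \<kappa>.\<close>

lemma kap_approx:
  assumes "0 < t" "t \<le> 1/2"
  shows "cmod (kap t - phi t) \<le> 3 * cmod (kap t) ^ 3" "cmod (phi t) \<le> 2 * cmod (kap t)"
proof -
  let ?w = "phi t / 2"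
  have "sqrt 2 \<le> 2" by (rule real_le_lsqrt) auto
  then have "cmod (phi t) \<le> 1/2 * 2"
    unfolding norm_phi using assms by (intro mult_mono) auto
  then have w: "cmod (phi t) \<le> 1" "cmod ?w \<le> 1" by (auto simp: norm_divide)
  have T: "cmod (exp x - (\<Sum>k\<le>2. x ^ k / fact k)) \<le> 3 * cmod ?w ^ 3 / 2" if "cmod x = cmod ?w" for x
  proof -
    have "cmod (exp x - (\<Sum>k\<le>2. x ^ k / fact k)) \<le> exp \<bar>Re x\<bar> * cmod x ^ Suc 2 / fact 2"
      by (rule Taylor_exp)
    also have "exp \<bar>Re x\<bar> \<le> exp 1" using abs_Re_le_cmod[of x] w that by simp
    also have "exp (1::real) \<le> 3" by (rule exp_le)
    finally show ?thesis using that by (simp add: eval_nat_numeral mult_right_mono divide_right_mono)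
  qed
  have S: "(\<Sum>k\<le>2. x ^ k / fact k) = 1 + x + x\<^sup>2 / 2" for x :: complex by (simp add: eval_nat_numeral)
  have "kap t - phi t = (exp ?w - (1 + ?w + ?w\<^sup>2 / 2)) - (exp (- ?w) - (1 + (- ?w) + (- ?w)\<^sup>2 / 2))"
    by (simp add: kap_def)
  then have "cmod (kap t - phi t) \<le> 3 * cmod ?w ^ 3 / 2 + 3 * cmod ?w ^ 3 / 2"
    using norm_triangle_ineq4 T[of ?w, unfolded S] T[of "- ?w", unfolded S]
    by (smt (verit) norm_minus_cancel)
  then have d: "cmod (kap t - phi t) \<le> 3 / 8 * cmod (phi t) ^ 3"
    by (simp add: norm_divide power_divide)
  have "cmod (phi t) ^ 3 \<le> cmod (phi t)" using w power_decreasing[of 1 3 "cmod (phi t)"] by simp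
  then have "cmod (kap t - phi t) \<le> 1/2 * cmod (phi t)" using d norm_ge_zero[of "phi t"] by linarith
  moreover have "cmod (phi t) \<le> cmod (kap t) + cmod (kap t - phi t)"
    using norm_triangle_ineq4[of "kap t" "kap t - phi t"] by simp
  ultimately show k: "cmod (phi t) \<le> 2 * cmod (kap t)" by simp
  have "cmod (phi t) ^ 3 \<le> (2 * cmod (kap t)) ^ 3" by (intro power_mono k) auto
  then show "cmod (kap t - phi t) \<le> 3 * cmod (kap t) ^ 3"
    using d by (simp add: power_mult_distrib)
qed

lemma phi_tendsto: "(phi \<longlongrightarrow> 0) (at_right 0)"
proof -
  have "((\<lambda>t. of_real t * (1 + \<i>)) \<longlongrightarrow> of_real 0 * (1 + \<i>)) (at_right 0)" by (intro tendsto_intros)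
  then show ?thesis by (simp add: phi_def[abs_def])
qed

lemma kap_tendsto: "(kap \<longlongrightarrow> 0) (at_right 0)"
proof -
  have "((\<lambda>t. exp (phi t / 2) - exp (- (phi t / 2))) \<longlongrightarrow> exp (0 / 2) - exp (- (0 / 2))) (at_right 0)"
    by (intro tendsto_intros phi_tendsto) auto
  then show ?thesis by (simp add: kap_def[abs_def])
qed

lemma eventually_small: "r > 0 \<Longrightarrow> eventually (\<lambda>t::real. 0 < t \<and> t < r) (at_right 0)"
  using eventually_at_right_field by fastforce

lemma kap_nonzero: "eventually (\<lambda>t. kap t \<noteq> 0) (at_right 0)"
  by (rule eventually_mono[OF eventually_small[of 1]]) (use kap_right_half_plane in force)+

lemma kap_le_1: "eventually (\<lambda>t. cmod (kap t) \<le> 1) (at_right 0)"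
  using tendstoD[OF kap_tendsto, of 1] by (auto elim: eventually_mono)

section \<open>Asymptotic orders and scalar expansions along the path\<close>

definition big :: "nat \<Rightarrow> (real \<Rightarrow> complex) set" where
  "big n = O[at_right 0](\<lambda>t. kap t ^ n)"

lemma bigI:
  assumes "r > 0" "\<And>t. 0 < t \<Longrightarrow> t < r \<Longrightarrow> cmod (f t) \<le> c * cmod (kap t) ^ n"
  shows "f \<in> big n"
  unfolding big_def
  by (rule bigoI[of _ c], rule eventually_mono[OF eventually_small[OF assms(1)]])
    (use assms(2) in \<open>auto simp: norm_power\<close>)

lemma bigD:
  assumes "f \<in> big n"
  obtains c where "eventually (\<lambda>t. cmod (f t) \<le> c * cmod (kap t) ^ n) (at_right 0)"
  using landau_o.bigE[OF assms[unfolded big_def]] by (auto simp: norm_power)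

lemma big_ev: "eventually (\<lambda>t. cmod (f t) \<le> c * cmod (kap t) ^ n) (at_right 0) \<Longrightarrow> f \<in> big n"
  unfolding big_def by (rule bigoI[of _ c]) (simp add: norm_power)

lemma big_mono:
  assumes "f \<in> big n" "m \<le> n"
  shows "f \<in> big m"
proof -
  have "(\<lambda>t. kap t ^ n) \<in> big m"
    by (rule big_ev[of _ 1], rule eventually_mono[OF kap_le_1])
      (use assms in \<open>auto simp: norm_power intro: power_decreasing\<close>)
  then show ?thesis using assms(1) landau_o.big_trans unfolding big_def by blast
qed

lemma big_mult: "f \<in> big m \<Longrightarrow> g \<in> big n \<Longrightarrow> (\<lambda>t. f t * g t) \<in> big (m + n)"
  using landau_o.big.mult unfolding big_def by (fastforce simp: power_add)

lemma big_add: "f \<in> big n \<Longrightarrow> g \<in> big n \<Longrightarrow> (\<lambda>t. f t + g t) \<in> big n"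
  unfolding big_def by (rule sum_in_bigo)

lemma big_diff: "f \<in> big n \<Longrightarrow> g \<in> big n \<Longrightarrow> (\<lambda>t. f t - g t) \<in> big n"
  unfolding big_def by (rule sum_in_bigo)

lemma big_cmult: "f \<in> big n \<Longrightarrow> (\<lambda>t. c * f t) \<in> big n"
  unfolding big_def by simp

lemma big_zero: "(\<lambda>t. 0) \<in> big n"
  unfolding big_def by simp

lemma big_sum: "(\<And>i. i \<in> I \<Longrightarrow> f i \<in> big n) \<Longrightarrow> (\<lambda>t. \<Sum>i\<in>I. f i t) \<in> big n"
  by (induction I rule: infinite_finite_induct) (auto intro: big_add big_zero)

lemma big_kap: "(\<lambda>t. kap t ^ m) \<in> big m"
  unfolding big_def by simp

lemma big_phi_power: "(\<lambda>t. phi t ^ m) \<in> big m"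
proof (rule bigI[of "1/2" _ "2 ^ m"])
  fix t :: real assume "0 < t" "t < 1/2"
  then have "cmod (phi t) ^ m \<le> (2 * cmod (kap t)) ^ m" by (intro power_mono kap_approx) auto
  then show "cmod (phi t ^ m) \<le> 2 ^ m * cmod (kap t) ^ m" by (simp add: norm_power power_mult_distrib)
qed simp

lemma big_phi_diff: "(\<lambda>t. kap t - phi t) \<in> big 3"
  by (rule bigI[of "1/2" _ 3]) (use kap_approx in auto)

lemma big_cong: "f \<in> big n \<Longrightarrow> eventually (\<lambda>t. f t = g t) (at_right 0) \<Longrightarrow> g \<in> big n"
  unfolding big_def using landau_o.big.in_cong by blast

text \<open>The coefficients beyond \<open>n\<close> are unconstrained, so \<open>a\<close> can be
  given by a formula that is meaningful only up to \<open>n\<close>.\<close>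

definition expands :: "nat \<Rightarrow> (real \<Rightarrow> complex) \<Rightarrow> (nat \<Rightarrow> complex) \<Rightarrow> bool" where
  "expands n f a \<longleftrightarrow> (\<lambda>t. f t - (\<Sum>k\<le>n. a k * kap t ^ k)) \<in> big (Suc n)"

lemma big_tendsto_0:
  assumes "f \<in> big (Suc n)"
  shows "(f \<longlongrightarrow> 0) (at_right 0)"
proof -
  have "f \<in> big 1" using assms by (rule big_mono) simp
  then obtain c where c: "eventually (\<lambda>t. cmod (f t) \<le> c * cmod (kap t) ^ 1) (at_right 0)"
    by (rule bigD)
  have "((\<lambda>t. c * cmod (kap t) ^ 1) \<longlongrightarrow> c * cmod 0 ^ 1) (at_right 0)"
    by (intro tendsto_intros kap_tendsto)
  then show ?thesis using c by (intro Lim_null_comparison[of f "\<lambda>t. c * cmod (kap t) ^ 1"]) auto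
qed

lemma big_cancel:
  assumes "(\<lambda>t. kap t * f t) \<in> big (Suc n)"
  shows "f \<in> big n"
proof -
  obtain c where c: "eventually (\<lambda>t. cmod (kap t * f t) \<le> c * cmod (kap t) ^ Suc n) (at_right 0)"
    using assms by (rule bigD)
  show ?thesis
  proof (rule big_ev[of _ c], rule eventually_mono[OF eventually_conj[OF c kap_nonzero]])
    fix t assume t: "cmod (kap t * f t) \<le> c * cmod (kap t) ^ Suc n \<and> kap t \<noteq> 0"
    then have "cmod (kap t) * cmod (f t) \<le> cmod (kap t) * (c * cmod (kap t) ^ n)"
      by (simp add: norm_mult norm_power mult_ac)
    then show "cmod (f t) \<le> c * cmod (kap t) ^ n" using t by simp
  qed
qed

text \<open>The limit isolates the constant coefficient; dividing what is left by \<open>kap\<close>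
  lowers the degree and the order together.\<close>

lemma polynomial_big_zero:
  assumes "(\<lambda>t. \<Sum>k\<le>n. d k * kap t ^ k) \<in> big (Suc n)" "k \<le> n"
  shows "d k = 0"
  using assms
proof (induction n arbitrary: d k)
  case (0 d)
  have "(\<lambda>t. d 0) \<in> big (Suc 0)" using 0 by simp
  from big_tendsto_0[OF this] have "d 0 = 0" using tendsto_const_iff[of "at_right (0::real)" "d 0" 0] by simp
  then show ?case using 0 by simp
next
  case (Suc n d)
  have split: "(\<Sum>k\<le>Suc n. d k * kap t ^ k) = d 0 + kap t * (\<Sum>k\<le>n. d (Suc k) * kap t ^ k)" for t
    unfolding sum.atMost_Suc_shift sum_distrib_left by (simp add: mult_ac)
  have "((\<lambda>t. d 0 + kap t * (\<Sum>k\<le>n. d (Suc k) * kap t ^ k)) \<longlongrightarrow> d 0 + 0 * (\<Sum>k\<le>n. d (Suc k) * 0 ^ k)) (at_right 0)"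
    by (intro tendsto_intros kap_tendsto)
  moreover have "((\<lambda>t. d 0 + kap t * (\<Sum>k\<le>n. d (Suc k) * kap t ^ k)) \<longlongrightarrow> 0) (at_right 0)"
    using big_tendsto_0[OF Suc.prems(1)] unfolding split .
  ultimately have d0: "d 0 = 0" using tendsto_unique trivial_limit_at_right_real by fastforce
  have "(\<lambda>t. kap t * (\<Sum>k\<le>n. d (Suc k) * kap t ^ k)) \<in> big (Suc (Suc n))"
    using Suc.prems(1) unfolding split d0 by simp
  then have "(\<lambda>t. \<Sum>k\<le>n. d (Suc k) * kap t ^ k) \<in> big (Suc n)" by (rule big_cancel)
  from Suc.IH[OF this] show ?case using d0 Suc.prems(2) by (cases k) auto
qed

lemma expands_unique:
  assumes "expands n f a" "expands n f c" "k \<le> n"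
  shows "a k = c k"
proof -
  have "(\<lambda>t. (f t - (\<Sum>k\<le>n. c k * kap t ^ k)) - (f t - (\<Sum>k\<le>n. a k * kap t ^ k))) \<in> big (Suc n)"
    using assms by (intro big_diff[of "\<lambda>t. f t - _ t"]) (simp_all add: expands_def)
  then have "(\<lambda>t. \<Sum>k\<le>n. (a k - c k) * kap t ^ k) \<in> big (Suc n)"
    by (simp add: left_diff_distrib sum_subtractf)
  from polynomial_big_zero[OF this assms(3)] show ?thesis by simp
qed

lemma expands_add: "expands n f a \<Longrightarrow> expands n g c \<Longrightarrow> expands n (\<lambda>t. f t + g t) (\<lambda>k. a k + c k)"
  unfolding expands_def by (drule (1) big_add) (simp add: distrib_right sum.distrib algebra_simps)

lemma expands_cmult: "expands n f a \<Longrightarrow> expands n (\<lambda>t. c * f t) (\<lambda>k. c * a k)"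
  unfolding expands_def by (drule big_cmult[of _ _ c]) (simp add: right_diff_distrib sum_distrib_left mult.assoc)

lemma expands_diff: "expands n f a \<Longrightarrow> expands n g c \<Longrightarrow> expands n (\<lambda>t. f t - g t) (\<lambda>k. a k - c k)"
  using expands_add[of n f a "\<lambda>t. (-1) * g t" "\<lambda>k. (-1) * c k"] expands_cmult[of n g c "-1"] by simp

lemma expands_const: "expands n (\<lambda>t. c) (\<lambda>k. if k = 0 then c else 0)"
proof -
  have "(\<Sum>k\<le>n. (if k = 0 then c else 0) * kap t ^ k) = c" for t
    by (simp add: if_distrib[of "\<lambda>x. x * _"] cong: if_cong)
  then show ?thesis by (simp add: expands_def big_zero)
qed

text \<open>The order is kept at \<open>n\<close>, with the term of degree \<open>n + 1\<close>
  moved into the error, so that products with different powers of \<kappa> can be added at a common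
  order.\<close>

lemma expands_kap_mult:
  assumes "expands n f a"
  shows "expands n (\<lambda>t. kap t * f t) (\<lambda>k. case k of 0 \<Rightarrow> 0 | Suc j \<Rightarrow> a j)"
proof -
  have "(\<lambda>t. kap t * (f t - (\<Sum>k\<le>n. a k * kap t ^ k))) \<in> big (1 + Suc n)"
    using assms big_kap[of 1] by (intro big_mult) (auto simp: expands_def)
  then have "(\<lambda>t. kap t * (f t - (\<Sum>k\<le>n. a k * kap t ^ k))) \<in> big (Suc n)" by (rule big_mono) simp
  moreover have "(\<lambda>t. a n * kap t ^ Suc n) \<in> big (Suc n)" by (intro big_cmult big_kap)
  ultimately have "(\<lambda>t. kap t * (f t - (\<Sum>k\<le>n. a k * kap t ^ k)) + a n * kap t ^ Suc n) \<in> big (Suc n)"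
    by (rule big_add)
  moreover have "(\<Sum>k\<le>n. (case k of 0 \<Rightarrow> 0 | Suc j \<Rightarrow> a j) * kap t ^ k) = kap t * (\<Sum>k\<le>n. a k * kap t ^ k) - a n * kap t ^ Suc n" for t
  proof (cases n)
    case (Suc m)
    show ?thesis
      unfolding Suc by (subst sum.atMost_Suc_shift) (simp add: sum_distrib_left algebra_simps)
  qed simp
  then have "kap t * f t - (\<Sum>k\<le>n. (case k of 0 \<Rightarrow> 0 | Suc j \<Rightarrow> a j) * kap t ^ k)
      = kap t * (f t - (\<Sum>k\<le>n. a k * kap t ^ k)) + a n * kap t ^ Suc n" for t
    by (simp add: right_diff_distrib)
  ultimately show ?thesis unfolding expands_def by simp
qed

lemma expands_mono:
  assumes "expands n f a" "m \<le> n"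
  shows "expands m f a"
proof -
  have "(\<lambda>t. f t - (\<Sum>k\<le>n. a k * kap t ^ k)) \<in> big (Suc m)"
    using assms by (auto simp: expands_def intro: big_mono)
  moreover have "(\<lambda>t. \<Sum>k\<in>{m<..n}. a k * kap t ^ k) \<in> big (Suc m)"
    by (intro big_sum big_cmult big_mono[OF big_kap]) auto
  ultimately have "(\<lambda>t. f t - (\<Sum>k\<le>n. a k * kap t ^ k) + (\<Sum>k\<in>{m<..n}. a k * kap t ^ k)) \<in> big (Suc m)"
    by (rule big_add)
  moreover have "(\<Sum>k\<le>n. a k * kap t ^ k) = (\<Sum>k\<le>m. a k * kap t ^ k) + (\<Sum>k\<in>{m<..n}. a k * kap t ^ k)" for t
  proof -
    have "{..n} = {..m} \<union> {m<..n}" using assms by auto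
    then show ?thesis by (simp add: sum.union_disjoint ivl_disj_int)
  qed
  ultimately show ?thesis by (simp add: expands_def)
qed

lemma expands_cong_big:
  assumes "expands n f a" "(\<lambda>t. g t - f t) \<in> big (Suc n)"
  shows "expands n g a"
  using big_add[OF assms(2) assms(1)[unfolded expands_def]] by (simp add: expands_def)

lemma expands_cong:
  assumes "expands n f a" "eventually (\<lambda>t. f t = g t) (at_right 0)"
  shows "expands n g a"
  using assms(1) unfolding expands_def
  by (rule big_cong) (use assms(2) in \<open>auto elim: eventually_mono\<close>)

lemma expands_big_0:
  assumes "expands n f a"
  shows "f \<in> big 0"
proof -
  have "(\<lambda>t. (f t - (\<Sum>k\<le>n. a k * kap t ^ k)) + (\<Sum>k\<le>n. a k * kap t ^ k)) \<in> big 0"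
    using assms by (intro big_add big_sum big_cmult big_mono[OF big_kap]) (auto simp: expands_def intro: big_mono)
  then show ?thesis by simp
qed

lemma expands_big_1: "expands n f a \<Longrightarrow> a 0 = 0 \<Longrightarrow> f \<in> big 1"
  using expands_mono[of n f a 0] by (simp add: expands_def)

text \<open>Taylor's formula in every summand with w = (m + 1) \<phi>. The bound is uniform in m, so
  the remainders add up to a multiple of the fourth absolute moment.\<close>

lemma ray_boundary_expansion:
  assumes F: "moment_summable 4 F" and \<phi>: "Re \<phi> \<ge> 0"
  shows "cmod ((\<Sum>\<^sub>\<infinity>m. exp (- \<phi>) ^ Suc m * F m)
      - (moment 0 F - \<phi> * moment 1 F + \<phi>\<^sup>2 / 2 * moment 2 F - \<phi> ^ 3 / 6 * moment 3 F))
    \<le> 4 * cmod \<phi> ^ 4 * (\<Sum>\<^sub>\<infinity>m. real (Suc m) ^ 4 * cmod (F m))"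
proof -
  have m: "((\<lambda>m. of_nat (Suc m) ^ i * F m) has_sum moment i F) UNIV" if "i \<le> 4" for i
    unfolding moment_def by (intro has_sum_infsum moment_term_summable[OF F that])
  let ?T = "\<lambda>m. of_nat (Suc m) ^ 0 * F m + ((- \<phi>) * (of_nat (Suc m) ^ 1 * F m) + (\<phi>\<^sup>2 / 2 * (of_nat (Suc m) ^ 2 * F m)
      + (- (\<phi> ^ 3) / 6) * (of_nat (Suc m) ^ 3 * F m)))"
  let ?S = "moment 0 F + ((- \<phi>) * moment 1 F + (\<phi>\<^sup>2 / 2 * moment 2 F + (- (\<phi> ^ 3) / 6) * moment 3 F))"
  have T: "(?T has_sum ?S) UNIV"
    by (intro has_sum_add has_sum_cmult_right m) auto
  have T_eq: "?T m = (1 - of_nat (Suc m) * \<phi> + (of_nat (Suc m) * \<phi>)\<^sup>2 / 2 - (of_nat (Suc m) * \<phi>) ^ 3 / 6) * F m" for m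
    by (simp add: ring_distribs power_mult_distrib mult_ac del: of_nat_Suc)
  have ex: "exp (- \<phi>) ^ Suc m = exp (- (of_nat (Suc m) * \<phi>))" for m
    by (simp only: exp_of_nat_mult[symmetric] mult_minus_right)
  have "(\<lambda>m. exp (- \<phi>) ^ Suc m * F m) summable_on UNIV"
  proof (rule weighted_summable[OF moment_summable_mono[OF F, of 0], where C = 1])
    have "exp (- Re \<phi>) \<le> 1" using \<phi> by simp
    then show "cmod (exp (- \<phi>) ^ Suc m) \<le> 1 * real (Suc m) ^ 0" for m
      by (simp only: norm_power norm_exp_eq_Re uminus_complex.sel) (auto intro!: power_le_one mult_le_one)
  qed simp
  then have E: "((\<lambda>m. exp (- \<phi>) ^ Suc m * F m) has_sum (\<Sum>\<^sub>\<infinity>m. exp (- \<phi>) ^ Suc m * F m)) UNIV"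
    by (rule has_sum_infsum)
  have D: "((\<lambda>m. exp (- \<phi>) ^ Suc m * F m + (-1) * ?T m) has_sum ((\<Sum>\<^sub>\<infinity>m. exp (- \<phi>) ^ Suc m * F m) + (-1) * ?S)) UNIV"
    by (intro has_sum_add has_sum_cmult_right E T)
  have bound: "cmod ((\<Sum>\<^sub>\<infinity>m. exp (- \<phi>) ^ Suc m * F m) + (-1) * ?S) \<le> 4 * cmod \<phi> ^ 4 * (\<Sum>\<^sub>\<infinity>m. real (Suc m) ^ 4 * cmod (F m))"
  proof (rule norm_infsum_le[OF D])
    show "((\<lambda>m. 4 * cmod \<phi> ^ 4 * (real (Suc m) ^ 4 * cmod (F m))) has_sum 4 * cmod \<phi> ^ 4 * (\<Sum>\<^sub>\<infinity>m. real (Suc m) ^ 4 * cmod (F m))) UNIV"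
      using F by (intro has_sum_cmult_right has_sum_infsum) (simp add: moment_summable_def)
    fix m
    let ?w = "of_nat (Suc m) * \<phi>"
    have "exp (- \<phi>) ^ Suc m * F m + (-1) * ?T m = (exp (- ?w) - (1 - ?w + ?w\<^sup>2 / 2 - ?w ^ 3 / 6)) * F m"
      unfolding T_eq ex by (simp add: algebra_simps)
    then have "cmod (exp (- \<phi>) ^ Suc m * F m + (-1) * ?T m) = cmod (exp (- ?w) - (1 - ?w + ?w\<^sup>2 / 2 - ?w ^ 3 / 6)) * cmod (F m)"
      by (simp only: norm_mult)
    also have "\<dots> \<le> 4 * cmod ?w ^ 4 * cmod (F m)"
      using \<phi> by (intro mult_right_mono exp_taylor_half_plane) (auto simp del: of_nat_Suc)
    also have "\<dots> = 4 * cmod \<phi> ^ 4 * (real (Suc m) ^ 4 * cmod (F m))"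
      by (simp add: norm_mult power_mult_distrib del: of_nat_Suc)
    finally show "cmod (exp (- \<phi>) ^ Suc m * F m + (-1) * ?T m) \<le> 4 * cmod \<phi> ^ 4 * (real (Suc m) ^ 4 * cmod (F m))" .
  qed
  have eq: "(\<Sum>\<^sub>\<infinity>m. exp (- \<phi>) ^ Suc m * F m) + (-1) * ?S = (\<Sum>\<^sub>\<infinity>m. exp (- \<phi>) ^ Suc m * F m)
      - (moment 0 F - \<phi> * moment 1 F + \<phi>\<^sup>2 / 2 * moment 2 F - \<phi> ^ 3 / 6 * moment 3 F)"
    by (simp add: algebra_simps)
  show ?thesis using bound unfolding eq .
qed

lemma moment_le_Lnorm:
  fixes g :: "('a::finite, 'n::finite) gfun"
  assumes g: "g \<in> Lsp (real p)" and i: "i \<le> p"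
  shows "cmod (moment i (\<lambda>k. g (Ray \<alpha> k))) \<le> Lnorm (real p) g"
proof -
  have ms: "moment_summable i (\<lambda>k. g (Ray \<alpha> k))" using g moment_summable_mono[OF _ i] unfolding Lsp_iff by blast
  have "cmod (moment i (\<lambda>k. g (Ray \<alpha> k))) \<le> (\<Sum>\<^sub>\<infinity>m. real (Suc m) ^ i * cmod (g (Ray \<alpha> m)))"
    unfolding moment_def
    by (rule norm_infsum_le[OF has_sum_infsum[OF moment_term_summable[OF ms order_refl]] has_sum_infsum])
      (use ms in \<open>auto simp: moment_summable_def norm_mult norm_power simp del: of_nat_Suc\<close>)
  then show ?thesis using ray_sum_le_Lnorm[OF g i, of \<alpha>] by simp
qed

lemma moment_linear:
  assumes "i \<le> p"
  shows "linear_on (Lsp (real p)) (\<lambda>g :: ('a::finite, 'n::finite) gfun. moment i (\<lambda>k. g (Ray \<alpha> k)))"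
proof (rule linear_onI)
  have s: "(\<lambda>k. of_nat (Suc k) ^ i * g (Ray \<alpha> k)) summable_on UNIV" if "g \<in> Lsp (real p)" for g :: "('a, 'n) gfun"
    using that moment_term_summable[OF _ assms] unfolding Lsp_iff by blast
  show "moment i (\<lambda>k. (u + w) (Ray \<alpha> k)) = moment i (\<lambda>k. u (Ray \<alpha> k)) + moment i (\<lambda>k. w (Ray \<alpha> k))"
    if "u \<in> Lsp (real p)" "w \<in> Lsp (real p)" for u w :: "('a, 'n) gfun"
    using infsum_add[OF s[OF that(1)] s[OF that(2)]] by (simp add: moment_def distrib_left)
  show "moment i (\<lambda>k. scaleC c u (Ray \<alpha> k)) = scaleC c (moment i (\<lambda>k. u (Ray \<alpha> k)))" for c and u :: "('a, 'n) gfun"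
    by (simp add: moment_def mult.left_commute infsum_cmult_right')
qed

section \<open>The coefficients of the resolvent\<close>

lemma expands_kap_square_mult:
  "expands n f a \<Longrightarrow> expands n (\<lambda>t. (kap t)\<^sup>2 * f t) (\<lambda>k. if k < 2 then 0 else a (k - 2))"
  using expands_kap_mult[OF expands_kap_mult[of n f a]]
  by (simp add: power2_eq_square mult.assoc, elim back_subst[of "expands n _"])
    (auto simp: fun_eq_iff split: nat.split)

text \<open>The vector \<open>u\<close> is fixed, so that the coefficients become functions on the
  graph. \<open>b6\<close> says that the power \<kappa>^0 occurs in the expansion.\<close>

locale threshold_expansion = threshold E0 x0 V v U b
  for E0 :: "'a::finite set set"
    and x0 :: "'n::finite \<Rightarrow> 'a"
    and V :: "('a, 'n) gfun \<Rightarrow> ('a, 'n) gfun"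
    and v :: "'k::complex_hilbert_space \<Rightarrow> ('a, 'n) gfun"
    and U :: "'k \<Rightarrow> 'k"
    and b :: nat +
  fixes G :: "int \<Rightarrow> ('a, 'n) gfun \<Rightarrow> ('a, 'n) gfun" and u :: "('a, 'n) gfun"
  assumes G: "resolvent_expansion (real b - 2) (full_op E0 x0 V) (- 2) (int b - 6) G"
    and b6: "6 \<le> b"
    and u: "u \<in> Lsp (real b - 2)"
begin

abbreviation "s \<equiv> real b - 2"
abbreviation "H \<equiv> full_op E0 x0 V"

text \<open>The index is shifted by two because \<open>sol\<close> is \<kappa>^2 times the resolvent
  applied to \<open>u\<close>, whose expansion has only nonnegative powers: \<open>coeff 0\<close>
  to \<open>coeff 3\<close> are G_(-2) u, G_(-1) u, G_0 u and G_1 u.\<close>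

definition coeff :: "nat \<Rightarrow> ('a, 'n) gfun" where "coeff k = G (int k - 2) u"

definition sol :: "real \<Rightarrow> ('a, 'n) gfun" where
  "sol t = scaleC ((kap t)\<^sup>2) (resolvent H (kap t) u)"

definition remainder :: "real \<Rightarrow> ('a, 'n) gfun" where
  "remainder t = sol t - (\<Sum>k\<le>b - 4. scaleC (kap t ^ k) (coeff k))"

lemma s_nonneg: "0 \<le> s" and s_le: "s \<le> real b" using b6 by auto

lemma coeff_in:
  assumes "k \<le> b - 4"
  shows "coeff k \<in> Ldual s"
proof -
  have "int k - 2 \<in> {- 2..int b - 6}" using assms b6 by auto
  then have "bounded_operator (Lsp s) (Lnorm s) (Ldual s) (Ldual_norm s) (G (int k - 2))"
    using G unfolding resolvent_expansion_def by blast
  then show ?thesis unfolding coeff_def using bounded_operatorD(1) u by blast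
qed

lemma u_ell2: "u \<in> ell2" by (rule Lsp_sub_ell2[OF u s_nonneg])

lemma H_bounded: "bounded_operator ell2 ell2_norm ell2 ell2_norm H"
  by (rule full_op_bounded[OF V_ell2])

lemma H_symmetric: "f \<in> ell2 \<Longrightarrow> g \<in> ell2 \<Longrightarrow> pairing (H f) g = pairing f (H g)"
  by (rule full_op_symmetric[OF V_ell2 V_sym])

lemma spectrum_path: "0 < t \<Longrightarrow> t < 1 \<Longrightarrow> - (kap t)\<^sup>2 \<notin> spectrum H"
  by (rule nonreal_notin_spectrum[OF H_bounded H_symmetric kap_square_nonreal])

lemma
  assumes "0 < t" "t < 1"
  shows resolvent_in: "resolvent H (kap t) u \<in> ell2"
    and resolvent_eq: "H (resolvent H (kap t) u) + scaleC ((kap t)\<^sup>2) (resolvent H (kap t) u) = u"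
proof -
  let ?f = "\<lambda>w. H w + scaleC ((kap t)\<^sup>2) w"
  obtain S where S: "bounded_operator ell2 ell2_norm ell2 ell2_norm S"
    "\<And>w. w \<in> ell2 \<Longrightarrow> H (S w) - scaleC (- (kap t)\<^sup>2) (S w) = w"
    using spectrum_path[OF assms] unfolding spectrum_def by blast
  have "?f (S u) = u" using S(2)[OF u_ell2] by simp
  then have im: "u \<in> ?f ` ell2" using bounded_operatorD(1)[OF S(1) u_ell2] by (intro rev_image_eqI[of "S u"]) simp_all
  show "resolvent H (kap t) u \<in> ell2" unfolding resolvent_def by (rule inv_into_into[OF im])
  show "?f (resolvent H (kap t) u) = u" unfolding resolvent_def by (rule f_inv_into_f[OF im])
qed

lemma
  assumes t: "0 < t" "t < 1"
  shows sol_ell2: "sol t \<in> ell2"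
    and sol_eq: "H (sol t) + scaleC ((kap t)\<^sup>2) (sol t) = scaleC ((kap t)\<^sup>2) u"
proof -
  show "sol t \<in> ell2"
    unfolding sol_def by (rule complex_vector.subspace_scale[OF subspace_ell2 resolvent_in[OF t]])
  have "H (sol t) + scaleC ((kap t)\<^sup>2) (sol t)
      = scaleC ((kap t)\<^sup>2) (H (resolvent H (kap t) u) + scaleC ((kap t)\<^sup>2) (resolvent H (kap t) u))"
    unfolding sol_def linear_on_scale[OF bounded_operatorD(2)[OF H_bounded] resolvent_in[OF t]]
    by (simp add: complex_vector.scale_right_distrib)
  then show "H (sol t) + scaleC ((kap t)\<^sup>2) (sol t) = scaleC ((kap t)\<^sup>2) u"
    by (simp only: resolvent_eq[OF t])
qed

lemma sol_Ldual: "0 < t \<Longrightarrow> t < 1 \<Longrightarrow> 0 \<le> r \<Longrightarrow> sol t \<in> Ldual r"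
  by (rule ell2_sub_Ldual[OF sol_ell2])

lemma coeff_sum_in: "(\<Sum>k\<le>b - 4. scaleC (kap t ^ k) (coeff k)) \<in> Ldual s"
  by (intro complex_vector.subspace_sum[OF subspace_Ldual] complex_vector.subspace_scale[OF subspace_Ldual] coeff_in) simp

lemma remainder_in: "0 < t \<Longrightarrow> t < 1 \<Longrightarrow> remainder t \<in> Ldual s"
  unfolding remainder_def
  by (intro complex_vector.subspace_diff[OF subspace_Ldual] sol_Ldual coeff_sum_in s_nonneg)

lemma path_filter:
  "filterlim kap (at 0 within {\<kappa>. Re \<kappa> > 0 \<and> - \<kappa>\<^sup>2 \<notin> spectrum H}) (at_right 0)"
  unfolding filterlim_at
proof (intro conjI)
  show "\<forall>\<^sub>F t in at_right 0. kap t \<in> {\<kappa>. Re \<kappa> > 0 \<and> - \<kappa>\<^sup>2 \<notin> spectrum H} \<and> kap t \<noteq> 0"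
    by (rule eventually_mono[OF eventually_conj[OF eventually_small[of 1] kap_nonzero]])
      (auto simp: kap_right_half_plane spectrum_path)
qed (rule kap_tendsto)

lemma expansion_shift:
  assumes "\<kappa> \<noteq> 0"
  shows "scaleC (\<kappa>\<^sup>2) (\<Sum>j\<in>{- 2..int b - 6}. scaleC (\<kappa> powi j) (G j u)) = (\<Sum>k\<le>b - 4. scaleC (\<kappa> ^ k) (coeff k))"
proof -
  have "\<kappa>\<^sup>2 * \<kappa> powi (int k - 2) = \<kappa> ^ k" for k
    using assms by (simp add: power_int_diff)
  then have "(\<Sum>k\<le>b - 4. scaleC (\<kappa> ^ k) (coeff k)) = (\<Sum>k\<le>b - 4. scaleC (\<kappa>\<^sup>2) (scaleC (\<kappa> powi (int k - 2)) (coeff k)))"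
    by (simp add: scaleC_scaleC)
  also have "\<dots> = (\<Sum>j\<in>{- 2..int b - 6}. scaleC (\<kappa>\<^sup>2) (scaleC (\<kappa> powi j) (G j u)))"
    by (rule sum.reindex_bij_witness[of _ "\<lambda>j. nat (j + 2)" "\<lambda>k. int k - 2"])
      (use b6 in \<open>auto simp: coeff_def\<close>)
  finally show ?thesis by (simp only: complex_vector.scale_sum_right)
qed

lemma remainder_bound:
  obtains M where "eventually (\<lambda>t. Ldual_norm s (remainder t) \<le> M * cmod (kap t) ^ (b - 3)) (at_right 0)"
proof -
  obtain M where "\<forall>\<^sub>F \<kappa> in at 0 within {\<kappa>. Re \<kappa> > 0 \<and> - \<kappa>\<^sup>2 \<notin> spectrum H}. \<forall>u\<in>Lsp s.
        Ldual_norm s (resolvent H \<kappa> u - (\<Sum>j\<in>{- 2..int b - 6}. scaleC (\<kappa> powi j) (G j u)))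
          \<le> M * cmod \<kappa> powi (int b - 6 + 1) * Lnorm s u"
    using G unfolding resolvent_expansion_def by blast
  from eventually_compose_filterlim[OF this path_filter]
  have ev: "\<forall>\<^sub>F t in at_right 0. Ldual_norm s (resolvent H (kap t) u - (\<Sum>j\<in>{- 2..int b - 6}. scaleC (kap t powi j) (G j u)))
          \<le> M * cmod (kap t) powi (int b - 6 + 1) * Lnorm s u"
    using u by (auto elim: eventually_mono)
  have "eventually (\<lambda>t. Ldual_norm s (remainder t) \<le> (M * Lnorm s u) * cmod (kap t) ^ (b - 3)) (at_right 0)"
  proof (rule eventually_mono[OF eventually_conj[OF ev eventually_conj[OF kap_nonzero eventually_small[of 1]]]])
    fix t :: real
    let ?\<rho> = "resolvent H (kap t) u - (\<Sum>j\<in>{- 2..int b - 6}. scaleC (kap t powi j) (G j u))"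
    assume *: "Ldual_norm s ?\<rho> \<le> M * cmod (kap t) powi (int b - 6 + 1) * Lnorm s u \<and>
      kap t \<noteq> 0 \<and> 0 < t \<and> t < 1"
    then have t: "0 < t" "t < 1" and k: "kap t \<noteq> 0" by auto
    have r: "remainder t = scaleC ((kap t)\<^sup>2) ?\<rho>"
      unfolding remainder_def sol_def expansion_shift[OF k, symmetric] by (simp add: complex_vector.scale_right_diff_distrib)
    \<comment> \<open>The expansion bounds only a supremum, which says nothing pointwise unless the
      function is known to lie in \<open>Ldual s\<close>. Membership is obtained from that of
      \<open>remainder t\<close> by scaling back.\<close>
    have eq: "?\<rho> = scaleC (inverse ((kap t)\<^sup>2)) (remainder t)" unfolding r using k by (simp add: scaleC_scaleC scaleC_one)
    have \<rho>: "?\<rho> \<in> Ldual s"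
      unfolding eq by (rule complex_vector.subspace_scale[OF subspace_Ldual remainder_in[OF t]])
    show "Ldual_norm s (remainder t) \<le> (M * Lnorm s u) * cmod (kap t) ^ (b - 3)"
    proof (rule Ldual_norm_le)
      fix y
      have "cmod (remainder t y) = (cmod (kap t))\<^sup>2 * cmod (?\<rho> y)"
        unfolding r by (simp add: norm_mult norm_power)
      also have "\<dots> \<le> (cmod (kap t))\<^sup>2 * ((M * cmod (kap t) powi (int b - 6 + 1) * Lnorm s u) * weight s y)"
        using * by (intro mult_left_mono order_trans[OF Ldual_bound[OF \<rho>]] mult_right_mono less_imp_le[OF weight_pos]) auto
      also have "\<dots> = M * Lnorm s u * ((cmod (kap t))\<^sup>2 * cmod (kap t) powi (int b - 6 + 1)) * weight s y"
        by (simp add: mult_ac)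
      also have "(cmod (kap t))\<^sup>2 * cmod (kap t) powi (int b - 6 + 1) = cmod (kap t) ^ (b - 3)"
      proof -
        have e: "int b - 6 + 1 = int (b - 3) - 2" using b6 by simp
        show ?thesis unfolding e using k by (simp add: power_int_diff)
      qed
      finally show "cmod (remainder t y) \<le> M * Lnorm s u * cmod (kap t) ^ (b - 3) * weight s y" .
    qed
  qed simp
  then show thesis by (rule that)
qed

text \<open>Such functionals turn the remainder estimate in the dual norm into scalar expansions, so
  that identities between coefficients follow from \<open>expands_unique\<close>.\<close>

definition bounded_functional :: "(('a, 'n) gfun \<Rightarrow> complex) \<Rightarrow> bool" where
  "bounded_functional l \<longleftrightarrow> linear_on (Ldual s) l \<and> (\<exists>C\<ge>0. \<forall>\<rho>\<in>Ldual s. cmod (l \<rho>) \<le> C * Ldual_norm s \<rho>)"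

lemma bounded_functional_expands:
  assumes l: "bounded_functional l"
  shows "expands (b - 4) (\<lambda>t. l (sol t)) (\<lambda>k. l (coeff k))"
proof -
  obtain C where C: "C \<ge> 0" "\<And>\<rho>. \<rho> \<in> Ldual s \<Longrightarrow> cmod (l \<rho>) \<le> C * Ldual_norm s \<rho>"
    and lin: "linear_on (Ldual s) l" using l by (auto simp: bounded_functional_def)
  obtain M where M: "eventually (\<lambda>t. Ldual_norm s (remainder t) \<le> M * cmod (kap t) ^ (b - 3)) (at_right 0)"
    by (rule remainder_bound)
  have "b - 3 = Suc (b - 4)" using b6 by simp
  then have "eventually (\<lambda>t. cmod (l (sol t) - (\<Sum>k\<le>b - 4. l (coeff k) * kap t ^ k)) \<le> (C * M) * cmod (kap t) ^ Suc (b - 4)) (at_right 0)"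
  proof (intro eventually_mono[OF eventually_conj[OF M eventually_small[of 1]]])
    fix t :: real
    assume *: "Ldual_norm s (remainder t) \<le> M * cmod (kap t) ^ (b - 3) \<and> 0 < t \<and> t < 1" and b: "b - 3 = Suc (b - 4)"
    then have t: "0 < t" "t < 1" by auto
    have in': "scaleC (kap t ^ k) (coeff k) \<in> Ldual s" if "k \<in> {..b - 4}" for k
      using that by (intro complex_vector.subspace_scale[OF subspace_Ldual] coeff_in) simp
    have "l (remainder t) = l (sol t) - (\<Sum>k\<le>b - 4. l (scaleC (kap t ^ k) (coeff k)))"
      unfolding remainder_def
      by (simp only: linear_on_diff[OF subspace_Ldual lin sol_Ldual[OF t s_nonneg] coeff_sum_in]
          linear_on_sum[OF subspace_Ldual lin in'])
    also have "(\<Sum>k\<le>b - 4. l (scaleC (kap t ^ k) (coeff k))) = (\<Sum>k\<le>b - 4. l (coeff k) * kap t ^ k)"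
      by (intro sum.cong) (auto simp: linear_on_scale[OF lin coeff_in])
    finally have "cmod (l (sol t) - (\<Sum>k\<le>b - 4. l (coeff k) * kap t ^ k)) = cmod (l (remainder t))" by simp
    also have "\<dots> \<le> C * Ldual_norm s (remainder t)" by (rule C(2)[OF remainder_in[OF t]])
    also have "\<dots> \<le> C * (M * cmod (kap t) ^ (b - 3))" using * C(1) by (intro mult_left_mono) auto
    finally show "cmod (l (sol t) - (\<Sum>k\<le>b - 4. l (coeff k) * kap t ^ k)) \<le> (C * M) * cmod (kap t) ^ Suc (b - 4)"
      unfolding b[symmetric] by (simp add: mult.assoc)
  qed simp_all
  then show ?thesis unfolding expands_def by (rule big_ev)
qed

lemma bounded_functionalI:
  assumes "linear_on (Ldual s) l" "\<And>\<rho>. \<rho> \<in> Ldual s \<Longrightarrow> cmod (l \<rho>) \<le> C * Ldual_norm s \<rho>"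
  shows "bounded_functional l"
  unfolding bounded_functional_def
proof (intro conjI exI ballI)
  show "linear_on (Ldual s) l" by fact
  show "0 \<le> max 0 C" by simp
  fix \<rho> :: "('a, 'n) gfun" assume r: "\<rho> \<in> Ldual s"
  have "C * Ldual_norm s \<rho> \<le> max 0 C * Ldual_norm s \<rho>"
    by (intro mult_right_mono Ldual_norm_nonneg[OF r]) simp
  then show "cmod (l \<rho>) \<le> max 0 C * Ldual_norm s \<rho>" using assms(2)[OF r] by simp
qed

lemma bounded_functional_add:
  assumes "bounded_functional l" "bounded_functional l'"
  shows "bounded_functional (\<lambda>\<rho>. l \<rho> + l' \<rho>)"
proof -
  obtain C C' where C: "\<And>\<rho>. \<rho> \<in> Ldual s \<Longrightarrow> cmod (l \<rho>) \<le> C * Ldual_norm s \<rho>"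
    "\<And>\<rho>. \<rho> \<in> Ldual s \<Longrightarrow> cmod (l' \<rho>) \<le> C' * Ldual_norm s \<rho>"
    using assms by (auto simp: bounded_functional_def)
  show ?thesis
  proof (rule bounded_functionalI[of _ "C + C'"])
    show "linear_on (Ldual s) (\<lambda>\<rho>. l \<rho> + l' \<rho>)"
      using assms by (auto simp: bounded_functional_def linear_on_def algebra_simps)
    show "cmod (l \<rho> + l' \<rho>) \<le> (C + C') * Ldual_norm s \<rho>" if "\<rho> \<in> Ldual s" for \<rho>
      using norm_triangle_ineq[of "l \<rho>" "l' \<rho>"] C[OF that] by (simp add: distrib_right)
  qed
qed

lemma bounded_functional_cmult:
  assumes "bounded_functional l"
  shows "bounded_functional (\<lambda>\<rho>. c * l \<rho>)"
proof -
  obtain C where C: "\<And>\<rho>. \<rho> \<in> Ldual s \<Longrightarrow> cmod (l \<rho>) \<le> C * Ldual_norm s \<rho>"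
    using assms by (auto simp: bounded_functional_def)
  show ?thesis
  proof (rule bounded_functionalI[of _ "cmod c * C"])
    show "linear_on (Ldual s) (\<lambda>\<rho>. c * l \<rho>)"
      using assms by (auto simp: bounded_functional_def linear_on_def algebra_simps)
    show "cmod (c * l \<rho>) \<le> (cmod c * C) * Ldual_norm s \<rho>" if "\<rho> \<in> Ldual s" for \<rho>
      using mult_left_mono[OF C[OF that], of "cmod c"] by (simp add: norm_mult mult.assoc)
  qed
qed

lemma bounded_functional_diff:
  "bounded_functional l \<Longrightarrow> bounded_functional l' \<Longrightarrow> bounded_functional (\<lambda>\<rho>. l \<rho> - l' \<rho>)"
  using bounded_functional_add[of l "\<lambda>\<rho>. (-1) * l' \<rho>"] bounded_functional_cmult[of l' "-1"] by simp

lemma bounded_functional_sum: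
  assumes "\<And>i. i \<in> I \<Longrightarrow> bounded_functional (l i)"
  shows "bounded_functional (\<lambda>\<rho>. \<Sum>i\<in>I. l i \<rho>)"
  using assms
proof (induction I rule: infinite_finite_induct)
  case (insert i I)
  then show ?case by (simp add: bounded_functional_add)
qed (auto intro!: bounded_functionalI[of _ 0] linear_onI)

lemma bounded_functional_eval: "bounded_functional (\<lambda>\<rho>. \<rho> y)"
  by (rule bounded_functionalI[of _ "weight s y"])
    (auto intro!: linear_onI simp: mult.commute[of "weight s y"] intro: Ldual_bound)

lemma Ldual_s_b: "\<rho> \<in> Ldual s \<Longrightarrow> \<rho> \<in> Ldual (real b)"
  by (rule Ldual_mono[OF s_le])

lemma V_bound: "\<exists>C\<ge>0. \<forall>\<rho>\<in>Ldual s. Lnorm (real b) (V \<rho>) \<le> C * Ldual_norm s \<rho>"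
proof -
  obtain C where C: "\<And>\<rho>. \<rho> \<in> Ldual (real b) \<Longrightarrow> Lnorm (real b) (V \<rho>) \<le> C * Ldual_norm (real b) \<rho>"
    using bounded_operatorD(3)[OF V_Ldual] by auto
  have "Lnorm (real b) (V \<rho>) \<le> max 0 C * Ldual_norm s \<rho>" if r: "\<rho> \<in> Ldual s" for \<rho>
  proof -
    have "C * Ldual_norm (real b) \<rho> \<le> max 0 C * Ldual_norm (real b) \<rho>"
      by (intro mult_right_mono Ldual_norm_nonneg[OF Ldual_s_b[OF r]]) simp
    also have "\<dots> \<le> max 0 C * Ldual_norm s \<rho>" by (intro mult_left_mono Ldual_mono(2)[OF s_le r]) simp
    finally show ?thesis using C[OF Ldual_s_b[OF r]] by simp
  qed
  then show ?thesis by (intro exI[of _ "max 0 C"]) simp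
qed

lemma bounded_functional_V:
  assumes l: "linear_on (Lsp (real b)) l" "\<And>g. g \<in> Lsp (real b) \<Longrightarrow> cmod (l g) \<le> Lnorm (real b) g"
  shows "bounded_functional (\<lambda>\<rho>. l (V \<rho>))"
proof -
  obtain C where C: "\<And>\<rho>. \<rho> \<in> Ldual s \<Longrightarrow> Lnorm (real b) (V \<rho>) \<le> C * Ldual_norm s \<rho>" using V_bound by blast
  show ?thesis
  proof (rule bounded_functionalI[of _ C])
    show "linear_on (Ldual s) (\<lambda>\<rho>. l (V \<rho>))"
      by (rule linear_onI) (simp_all add: Ldual_s_b linear_on_add[OF V_linear] linear_on_scale[OF V_linear]
          linear_on_add[OF l(1)] linear_on_scale[OF l(1)] V_in del: scaleC_complex_eq)
    show "cmod (l (V \<rho>)) \<le> C * Ldual_norm s \<rho>" if "\<rho> \<in> Ldual s" for \<rho>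
      using l(2)[OF V_in[OF Ldual_s_b[OF that]]] C[OF that] by simp
  qed
qed

lemma bounded_functional_V_eval: "bounded_functional (\<lambda>\<rho>. V \<rho> y)"
proof (rule bounded_functional_V)
  show "linear_on (Lsp (real b)) (\<lambda>g. g y)" by (auto intro: linear_onI)
  fix g :: "('a, 'n) gfun" assume g: "g \<in> Lsp (real b)"
  have "1 * cmod (g y) \<le> weight (real b) y * cmod (g y)" by (intro mult_right_mono weight_ge_1) auto
  then show "cmod (g y) \<le> Lnorm (real b) g" using Lsp_bound[OF g, of y] by simp
qed

lemma bounded_functional_V_moment: "i \<le> b \<Longrightarrow> bounded_functional (\<lambda>\<rho>. moment i (\<lambda>k. V \<rho> (Ray \<alpha> k)))"
  by (rule bounded_functional_V) (auto intro: moment_linear moment_le_Lnorm)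

lemma bounded_functional_pairing: "\<Phi> \<in> Lsp s \<Longrightarrow> bounded_functional (pairing \<Phi>)"
proof (rule bounded_functionalI[of _ "Lnorm s \<Phi>"])
  assume \<Phi>: "\<Phi> \<in> Lsp s"
  then show "linear_on (Ldual s) (pairing \<Phi>)" by (rule pairing_linear')
  show "cmod (pairing \<Phi> \<rho>) \<le> Lnorm s \<Phi> * Ldual_norm s \<rho>" if "\<rho> \<in> Ldual s" for \<rho>
    using pairing_bound[OF that \<Phi>] pairing_commute[of \<Phi> \<rho>] by (simp add: mult.commute)
qed

lemma bounded_functional_H_eval: "bounded_functional (\<lambda>\<rho>. H \<rho> y)"
proof -
  have "bounded_functional (\<lambda>\<rho>. free_op E0 x0 \<rho> y)"
  proof (cases y)
    case (Core x)
    then show ?thesis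
      unfolding Core free_op.simps h_core_def
      by (intro bounded_functional_add bounded_functional_sum bounded_functional_diff bounded_functional_cmult
          bounded_functional_eval)
  next
    case (Ray \<alpha> k)
    show ?thesis
      unfolding Ray free_op.simps
      by (cases k) (auto intro!: bounded_functional_diff bounded_functional_cmult bounded_functional_eval)
  qed
  then show ?thesis
    unfolding full_op_def plus_fun_apply by (intro bounded_functional_add bounded_functional_V_eval)
qed

section \<open>Equations and boundary values of the coefficients\<close>

lemma eventually_path:
  assumes "\<And>t. 0 < t \<Longrightarrow> t < 1 \<Longrightarrow> P t"
  shows "eventually P (at_right (0::real))"
  by (rule eventually_mono[OF eventually_small[of 1]]) (use assms in auto)

text \<open>Comparison of the powers of \<kappa> in \<open>sol_eq\<close> at the vertex
  \<open>y\<close>; the factor \<kappa>^2 shifts the index by two.\<close>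

lemma coeff_equation:
  assumes "k \<le> b - 4"
  shows "H (coeff k) y + (if k < 2 then 0 else coeff (k - 2) y) = (if k = 2 then u y else 0)"
proof (rule expands_unique[OF _ _ assms])
  let ?f = "\<lambda>t. H (sol t) y + (kap t)\<^sup>2 * sol t y"
  show "expands (b - 4) ?f (\<lambda>k. H (coeff k) y + (if k < 2 then 0 else coeff (k - 2) y))"
    by (intro expands_add expands_kap_square_mult bounded_functional_expands
        bounded_functional_H_eval bounded_functional_eval)
  have "expands (b - 4) (\<lambda>t. (kap t)\<^sup>2 * u y) (\<lambda>k. if k < 2 then 0 else if k - 2 = 0 then u y else 0)"
    by (intro expands_kap_square_mult expands_const)
  moreover have "(\<lambda>k. if k < 2 then 0 else if k - 2 = 0 then u y else 0) = (\<lambda>k::nat. if k = 2 then u y else 0)"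
    by auto
  ultimately have e: "expands (b - 4) (\<lambda>t. (kap t)\<^sup>2 * u y) (\<lambda>k. if k = 2 then u y else 0)" by simp
  have "(kap t)\<^sup>2 * u y = ?f t" if "0 < t" "t < 1" for t
    using fun_cong[OF sol_eq[OF that], of y] by simp
  then show "expands (b - 4) ?f (\<lambda>k. if k = 2 then u y else 0)"
    by (intro expands_cong[OF e eventually_path])
qed

text \<open>As H annihilates \<Phi>, symmetry shows that the pairing of \<Phi> with
  \<open>sol t\<close> does not depend on \<open>t\<close>, so its expansion has only a constant
  term.\<close>

lemma coeff_bound_pairing:
  assumes \<Phi>: "\<Phi> \<in> Eb" and k: "k \<le> b - 4"
  shows "pairing \<Phi> (coeff k) = (if k = 0 then pairing \<Phi> u else 0)"
proof (rule expands_unique[OF _ _ k])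
  show "expands (b - 4) (\<lambda>t. pairing \<Phi> (sol t)) (\<lambda>k. pairing \<Phi> (coeff k))"
    by (intro bounded_functional_expands bounded_functional_pairing Eb_Lsp \<Phi>)
  have \<Phi>2: "\<Phi> \<in> ell2" by (rule Eb_ell2[OF \<Phi>])
  have H0: "H \<Phi> = 0" using Eb_Et[OF \<Phi>] by (simp add: gen_eigenspace_def)
  have "pairing \<Phi> u = pairing \<Phi> (sol t)" if t: "0 < t" "t < 1" for t
  proof -
    let ?w = "resolvent H (kap t) u"
    have w: "?w \<in> ell2" by (rule resolvent_in[OF t])
    have "pairing \<Phi> u = pairing \<Phi> (H ?w + scaleC ((kap t)\<^sup>2) ?w)" by (simp only: resolvent_eq[OF t])
    also have "\<dots> = pairing \<Phi> (H ?w) + pairing \<Phi> (sol t)"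
      unfolding sol_def
      by (rule linear_on_add[OF pairing_ell2_linear[OF \<Phi>2] bounded_operatorD(1)[OF H_bounded w]
            complex_vector.subspace_scale[OF subspace_ell2 w]])
    also have "pairing \<Phi> (H ?w) = 0"
      using H_symmetric[OF \<Phi>2 w] by (simp add: H0 pairing_def)
    finally show ?thesis by simp
  qed
  then show "expands (b - 4) (\<lambda>t. pairing \<Phi> (sol t)) (\<lambda>k. if k = 0 then pairing \<Phi> u else 0)"
    by (intro expands_cong[OF expands_const eventually_path])
qed

text \<open>Moments on a half-line of \<kappa>^2 u - V w for w = \<open>sol t\<close>, the
  right-hand side once the potential is moved over. The companion \<open>ray_coeff\<close> holds its
  expansion coefficients, where \<open>u\<close> enters only at \<kappa>^2.\<close>

definition ray_moment :: "nat \<Rightarrow> 'n \<Rightarrow> real \<Rightarrow> complex" where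
  "ray_moment i \<alpha> t = (kap t)\<^sup>2 * moment i (\<lambda>k. u (Ray \<alpha> k)) - moment i (\<lambda>k. V (sol t) (Ray \<alpha> k))"

definition ray_coeff :: "nat \<Rightarrow> 'n \<Rightarrow> nat \<Rightarrow> complex" where
  "ray_coeff i \<alpha> k = (if k = 2 then moment i (\<lambda>k. u (Ray \<alpha> k)) else 0) - moment i (\<lambda>j. V (coeff k) (Ray \<alpha> j))"

lemma ray_moment_expands:
  assumes "i \<le> b"
  shows "expands (b - 4) (ray_moment i \<alpha>) (ray_coeff i \<alpha>)"
proof -
  let ?m = "moment i (\<lambda>k. u (Ray \<alpha> k))"
  have "expands (b - 4) (\<lambda>t. (kap t)\<^sup>2 * ?m - moment i (\<lambda>k. V (sol t) (Ray \<alpha> k)))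
    (\<lambda>k. (if k < 2 then 0 else if k - 2 = 0 then ?m else 0) - moment i (\<lambda>j. V (coeff k) (Ray \<alpha> j)))"
    by (intro expands_diff expands_kap_square_mult expands_const bounded_functional_expands
        bounded_functional_V_moment assms)
  moreover have "(\<lambda>k. (if k < 2 then 0 else if k - 2 = 0 then ?m else 0) - moment i (\<lambda>j. V (coeff k) (Ray \<alpha> j))) = ray_coeff i \<alpha>"
    by (auto simp: ray_coeff_def)
  ultimately show ?thesis by (simp add: ray_moment_def[abs_def])
qed

text \<open>Serves to bound the fourth moment of \<open>V (sol t)\<close> uniformly along the
  path.\<close>

lemma sol_norm_bounded: obtains K where "eventually (\<lambda>t. Ldual_norm s (sol t) \<le> K) (at_right 0)"
proof -
  obtain M where M: "eventually (\<lambda>t. Ldual_norm s (remainder t) \<le> M * cmod (kap t) ^ (b - 3)) (at_right 0)"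
    by (rule remainder_bound)
  have "eventually (\<lambda>t. Ldual_norm s (sol t) \<le> \<bar>M\<bar> + (\<Sum>k\<le>b - 4. Ldual_norm s (coeff k))) (at_right 0)"
  proof (rule eventually_mono[OF eventually_conj[OF M eventually_conj[OF kap_le_1 eventually_small[of 1]]]])
    fix t :: real
    assume *: "Ldual_norm s (remainder t) \<le> M * cmod (kap t) ^ (b - 3) \<and> cmod (kap t) \<le> 1 \<and> 0 < t \<and> t < 1"
    then have t: "0 < t" "t < 1" and k1: "cmod (kap t) \<le> 1" by auto
    have "M * cmod (kap t) ^ (b - 3) \<le> \<bar>M\<bar> * 1" using k1 by (intro mult_mono power_le_one) auto
    then have r: "Ldual_norm s (remainder t) \<le> \<bar>M\<bar>" using * by simp
    show "Ldual_norm s (sol t) \<le> \<bar>M\<bar> + (\<Sum>k\<le>b - 4. Ldual_norm s (coeff k))"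
    proof (rule Ldual_norm_le)
      fix y
      have "sol t y = remainder t y + (\<Sum>k\<le>b - 4. kap t ^ k * coeff k y)"
        by (simp add: remainder_def sum_fun_apply)
      then have "cmod (sol t y) \<le> cmod (remainder t y) + (\<Sum>k\<le>b - 4. cmod (kap t ^ k * coeff k y))"
        by (simp only: order_trans[OF norm_triangle_ineq add_left_mono[OF norm_sum]])
      also have "\<dots> \<le> \<bar>M\<bar> * weight s y + (\<Sum>k\<le>b - 4. Ldual_norm s (coeff k) * weight s y)"
      proof (intro add_mono sum_mono)
        show "cmod (remainder t y) \<le> \<bar>M\<bar> * weight s y"
          using Ldual_bound[OF remainder_in[OF t]] mult_right_mono[OF r less_imp_le[OF weight_pos]] by (rule order_trans)
        fix k assume "k \<in> {..b - 4}"
        then have c: "coeff k \<in> Ldual s" by (intro coeff_in) simp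
        have "cmod (kap t ^ k * coeff k y) \<le> 1 * cmod (coeff k y)"
          unfolding norm_mult norm_power using k1 by (intro mult_right_mono power_le_one) auto
        then show "cmod (kap t ^ k * coeff k y) \<le> Ldual_norm s (coeff k) * weight s y"
          using Ldual_bound[OF c, of y] by simp
      qed
      finally show "cmod (sol t y) \<le> (\<bar>M\<bar> + (\<Sum>k\<le>b - 4. Ldual_norm s (coeff k))) * weight s y"
        by (simp add: distrib_right sum_distrib_right)
    qed
  qed simp
  then show thesis by (rule that)
qed

abbreviation "phi_series \<alpha> \<equiv> \<lambda>t. ray_moment 0 \<alpha> t - phi t * ray_moment 1 \<alpha> t
  + (phi t)\<^sup>2 / 2 * ray_moment 2 \<alpha> t - phi t ^ 3 / 6 * ray_moment 3 \<alpha> t"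

text \<open>Testing with the powers of z = exp (- \<phi>) gives the boundary value exactly. The
  cubic Taylor polynomial leaves the four moments in \<open>phi_series\<close>, and the fourth
  moment bounds the remainder.\<close>

lemma boundary_value_phi:
  "(\<lambda>t. sol t (Ray \<alpha> 0) - phi_series \<alpha> t) \<in> big 4"
proof -
  have b4': "4 \<le> b - 2" using b6 by simp
  have s: "s = real (b - 2)" by (rule b2(1))
  obtain K where K: "eventually (\<lambda>t. Ldual_norm s (sol t) \<le> K) (at_right 0)" by (rule sol_norm_bounded)
  obtain C where C: "C \<ge> 0" "\<And>\<rho>. \<rho> \<in> Ldual s \<Longrightarrow> Lnorm (real b) (V \<rho>) \<le> C * Ldual_norm s \<rho>" using V_bound by blast
  define D where "D = Lnorm s u + C * K"
  show ?thesis
  \<comment> \<open>The constant 64 is the 4 of the Taylor bound times 2^4 from |\<phi>| \<le> 2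
    |\<kappa>|.\<close>
  proof (rule big_ev[of _ "64 * D"], rule eventually_mono[OF eventually_conj[OF K eventually_conj[OF kap_le_1 eventually_small[of "1/2"]]]])
    fix t :: real
    assume *: "Ldual_norm s (sol t) \<le> K \<and> cmod (kap t) \<le> 1 \<and> 0 < t \<and> t < 1/2"
    then have t: "0 < t" "t < 1" and t2: "t \<le> 1/2" and k1: "cmod (kap t) \<le> 1" by auto
    have sd: "sol t \<in> Ldual s" "sol t \<in> Ldual (real b)" using sol_Ldual[OF t] s_nonneg by auto
    define F where "F m = (kap t)\<^sup>2 * u (Ray \<alpha> m) - V (sol t) (Ray \<alpha> m)" for m
    define g where "g = scaleC ((kap t)\<^sup>2) u - V (sol t)"
    have Vs: "V (sol t) \<in> Lsp (real (b - 2))" using V_in'[OF sd(2), of s] s_le unfolding s[symmetric] by simp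
    have us: "u \<in> Lsp (real (b - 2))" using u unfolding s .
    have gs: "g \<in> Lsp (real (b - 2))"
      unfolding g_def by (intro complex_vector.subspace_diff[OF subspace_Lsp] complex_vector.subspace_scale[OF subspace_Lsp] Vs us)
    have Fg: "F = (\<lambda>m. g (Ray \<alpha> m))" by (auto simp: F_def g_def)
    have F: "moment_summable (b - 2) F" using gs unfolding Lsp_iff Fg by blast
    have mom: "moment i F = ray_moment i \<alpha> t" if "i \<le> b - 2" for i
    proof -
      note lin = moment_linear[OF that, of \<alpha>]
      have "moment i F = moment i (\<lambda>k. scaleC ((kap t)\<^sup>2) u (Ray \<alpha> k)) - moment i (\<lambda>k. V (sol t) (Ray \<alpha> k))"
        unfolding Fg g_def
        by (rule linear_on_diff[OF subspace_Lsp lin complex_vector.subspace_scale[OF subspace_Lsp us] Vs])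
      also have "moment i (\<lambda>k. scaleC ((kap t)\<^sup>2) u (Ray \<alpha> k)) = (kap t)\<^sup>2 * moment i (\<lambda>k. u (Ray \<alpha> k))"
        using linear_on_scale[OF lin us] by simp
      finally show ?thesis by (simp add: ray_moment_def)
    qed
    have bv: "sol t (Ray \<alpha> 0) = (\<Sum>\<^sub>\<infinity>m. exp (- phi t) ^ Suc m * F m)"
    proof (rule ray_boundary_value[where \<mu> = "(kap t)\<^sup>2" and w = "\<lambda>k. sol t (Ray \<alpha> k)"])
      show "cmod (exp (- phi t)) < 1" using t by (simp add: Re_phi)
      show "(2 + (kap t)\<^sup>2) * exp (- phi t) = 1 + (exp (- phi t))\<^sup>2" by (rule kap_exp)
      show "cmod (sol t (Ray \<alpha> k)) \<le> ell2_norm (sol t)" for k by (rule ell2_bound[OF sol_ell2[OF t]])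
      show "moment_summable 0 F" by (rule moment_summable_mono[OF F]) simp
      show "h_ray (\<lambda>k. sol t (Ray \<alpha> k)) k + (kap t)\<^sup>2 * sol t (Ray \<alpha> k) = F k" for k
        using fun_cong[OF sol_eq[OF t], of "Ray \<alpha> k"] by (simp add: full_op_def F_def algebra_simps)
    qed simp
    have sums: "(\<Sum>\<^sub>\<infinity>m. real (Suc m) ^ 4 * cmod (F m)) \<le> D"
    proof -
      have su: "(\<lambda>m. real (Suc m) ^ 4 * cmod (u (Ray \<alpha> m))) summable_on UNIV"
        using us moment_summable_mono[OF _ b4', of "\<lambda>m. u (Ray \<alpha> m)"] unfolding Lsp_iff moment_summable_def by blast
      have sV: "(\<lambda>m. real (Suc m) ^ 4 * cmod (V (sol t) (Ray \<alpha> m))) summable_on UNIV"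
        using Vs moment_summable_mono[OF _ b4', of "\<lambda>m. V (sol t) (Ray \<alpha> m)"] unfolding Lsp_iff moment_summable_def by blast
      have sF: "(\<lambda>m. real (Suc m) ^ 4 * cmod (F m)) summable_on UNIV"
        using moment_summable_mono[OF F b4'] unfolding moment_summable_def .
      have "(\<Sum>\<^sub>\<infinity>m. real (Suc m) ^ 4 * cmod (F m))
        \<le> (\<Sum>\<^sub>\<infinity>m. real (Suc m) ^ 4 * cmod (u (Ray \<alpha> m)) + real (Suc m) ^ 4 * cmod (V (sol t) (Ray \<alpha> m)))"
      proof (rule infsum_mono[OF sF summable_on_add[OF su sV]])
        fix m
        have "cmod (F m) \<le> (cmod (kap t))\<^sup>2 * cmod (u (Ray \<alpha> m)) + cmod (V (sol t) (Ray \<alpha> m))"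
          unfolding F_def by (rule order_trans[OF norm_triangle_ineq4]) (simp add: norm_mult norm_power)
        also have "\<dots> \<le> 1 * cmod (u (Ray \<alpha> m)) + cmod (V (sol t) (Ray \<alpha> m))"
          using k1 by (intro add_mono mult_right_mono power_le_one) auto
        finally show "real (Suc m) ^ 4 * cmod (F m) \<le> real (Suc m) ^ 4 * cmod (u (Ray \<alpha> m)) + real (Suc m) ^ 4 * cmod (V (sol t) (Ray \<alpha> m))"
          unfolding distrib_left[symmetric] by (intro mult_left_mono) auto
      qed
      also have "\<dots> = (\<Sum>\<^sub>\<infinity>m. real (Suc m) ^ 4 * cmod (u (Ray \<alpha> m))) + (\<Sum>\<^sub>\<infinity>m. real (Suc m) ^ 4 * cmod (V (sol t) (Ray \<alpha> m)))"
        by (rule infsum_add[OF su sV])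
      also have "\<dots> \<le> Lnorm s u + Lnorm (real b) (V (sol t))"
        unfolding s using b6 by (intro add_mono ray_sum_le_Lnorm us V_in sd b4') auto
      also have "\<dots> \<le> Lnorm s u + C * K"
        using C(2)[OF sd(1)] mult_left_mono[of "Ldual_norm s (sol t)" K C] * C(1) by simp
      finally show ?thesis by (simp add: D_def)
    qed
    have "cmod (sol t (Ray \<alpha> 0) - phi_series \<alpha> t) \<le> 4 * cmod (phi t) ^ 4 * (\<Sum>\<^sub>\<infinity>m. real (Suc m) ^ 4 * cmod (F m))"
      using ray_boundary_expansion[OF moment_summable_mono[OF F b4'], of "phi t"] t b4'
      by (simp add: bv mom Re_phi del: power_Suc)
    also have "\<dots> \<le> 4 * (2 * cmod (kap t)) ^ 4 * D"
      using t t2 by (intro mult_mono power_mono kap_approx(2) sums infsum_nonneg mult_nonneg_nonneg) auto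
    also have "\<dots> = 64 * D * cmod (kap t) ^ 4" by (simp add: power_mult_distrib)
    finally show "cmod (sol t (Ray \<alpha> 0) - phi_series \<alpha> t) \<le> 64 * D * cmod (kap t) ^ 4" .
  qed simp
qed

abbreviation "kap_series \<alpha> \<equiv> \<lambda>t. ray_moment 0 \<alpha> t - kap t * ray_moment 1 \<alpha> t
  + 1/2 * (kap t * (kap t * ray_moment 2 \<alpha> t)) - 1/6 * (kap t * (kap t * (kap t * ray_moment 3 \<alpha> t)))"

text \<open>Replacing \<phi> by \<kappa> costs (\<kappa> - \<phi>) times the first moment, of order
  3 + r. In the quadratic and cubic terms the difference has a further factor of order at least 1,
  so their errors are of order 4 or better, whence r \<le> 1.\<close>

lemma boundary_value_kap:
  assumes r: "ray_moment 1 \<alpha> \<in> big r" "r \<le> 1"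
  shows "(\<lambda>t. sol t (Ray \<alpha> 0) - kap_series \<alpha> t) \<in> big (3 + r)"
proof -
  have m0: "ray_moment i \<alpha> \<in> big 0" if "i \<le> 3" for i
    using that b6 by (intro expands_big_0[OF ray_moment_expands]) simp
  have p1: "phi \<in> big 1" using big_phi_power[of 1] by simp
  have k1: "kap \<in> big 1" using big_kap[of 1] by simp
  have a: "(\<lambda>t. (kap t - phi t) * ray_moment 1 \<alpha> t) \<in> big (3 + r)" by (intro big_mult big_phi_diff r)
  have "(\<lambda>t. (kap t - phi t) * (phi t + kap t) * ray_moment 2 \<alpha> t) \<in> big (3 + 1 + 0)"
    by (intro big_mult big_phi_diff big_add p1 k1 m0) simp
  then have c: "(\<lambda>t. 1/2 * ((kap t - phi t) * (phi t + kap t) * ray_moment 2 \<alpha> t)) \<in> big (3 + r)"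
    using r(2) by (intro big_cmult) (erule big_mono, simp)
  have "(\<lambda>t. (kap t - phi t) * (phi t * phi t + phi t * kap t + kap t * kap t) * ray_moment 3 \<alpha> t) \<in> big (3 + (1 + 1) + 0)"
    by (intro big_mult big_phi_diff big_add p1 k1 m0) simp
  then have d: "(\<lambda>t. 1/6 * ((kap t - phi t) * (phi t * phi t + phi t * kap t + kap t * kap t) * ray_moment 3 \<alpha> t)) \<in> big (3 + r)"
    using r(2) by (intro big_cmult) (erule big_mono, simp)
  have e: "(\<lambda>t. sol t (Ray \<alpha> 0) - phi_series \<alpha> t) \<in> big (3 + r)"
    using r(2) by (intro big_mono[OF boundary_value_phi]) simp
  have "(\<lambda>t. (sol t (Ray \<alpha> 0) - phi_series \<alpha> t) + (kap t - phi t) * ray_moment 1 \<alpha> t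
     - 1/2 * ((kap t - phi t) * (phi t + kap t) * ray_moment 2 \<alpha> t)
     + 1/6 * ((kap t - phi t) * (phi t * phi t + phi t * kap t + kap t * kap t) * ray_moment 3 \<alpha> t)) \<in> big (3 + r)"
    by (rule big_add[OF big_diff[OF big_add[OF e a] c] d])
  moreover have "(sol t (Ray \<alpha> 0) - phi_series \<alpha> t) + (kap t - phi t) * ray_moment 1 \<alpha> t
     - 1/2 * ((kap t - phi t) * (phi t + kap t) * ray_moment 2 \<alpha> t)
     + 1/6 * ((kap t - phi t) * (phi t * phi t + phi t * kap t + kap t * kap t) * ray_moment 3 \<alpha> t)
     = sol t (Ray \<alpha> 0) - kap_series \<alpha> t" for t
    by (simp add: field_simps power2_eq_square power3_eq_cube)
  ultimately show ?thesis by (simp only:)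
qed

abbreviation "shift a \<equiv> \<lambda>k. case k of 0 \<Rightarrow> 0 | Suc j \<Rightarrow> a j"

text \<open>Each factor \<kappa> in \<open>kap_series\<close> becomes one \<open>shift\<close>. The
  case r = 0 reaches the coefficient of \<kappa>^2; that of \<kappa>^3 needs r = 1, that is, a first
  moment vanishing to first order.\<close>

lemma boundary_coefficients:
  assumes r: "ray_moment 1 \<alpha> \<in> big r" "r \<le> 1" "2 + r \<le> b - 4" and k: "k \<le> 2 + r"
  shows "coeff k (Ray \<alpha> 0) = ray_coeff 0 \<alpha> k - shift (ray_coeff 1 \<alpha>) k
    + 1/2 * shift (shift (ray_coeff 2 \<alpha>)) k - 1/6 * shift (shift (shift (ray_coeff 3 \<alpha>))) k"
proof (rule expands_unique[OF _ _ k])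
  let ?a = "\<lambda>k. ray_coeff 0 \<alpha> k - shift (ray_coeff 1 \<alpha>) k
    + 1/2 * shift (shift (ray_coeff 2 \<alpha>)) k - 1/6 * shift (shift (shift (ray_coeff 3 \<alpha>))) k"
  show "expands (2 + r) (\<lambda>t. sol t (Ray \<alpha> 0)) (\<lambda>k. coeff k (Ray \<alpha> 0))"
    by (rule expands_mono[OF bounded_functional_expands[OF bounded_functional_eval] r(3)])
  have "expands (b - 4) (kap_series \<alpha>) ?a"
    using b6 by (intro expands_diff expands_add expands_cmult expands_kap_mult ray_moment_expands) auto
  then have *: "expands (2 + r) (kap_series \<alpha>) ?a"
    by (rule expands_mono[OF _ r(3)])
  show "expands (2 + r) (\<lambda>t. sol t (Ray \<alpha> 0)) ?a"
    by (rule expands_cong_big[OF *]) (use boundary_value_kap[OF r(1,2)] in \<open>simp add: numeral_3_eq_3\<close>)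
qed

end

section \<open>The formulas for the coefficients\<close>

lemma cinner_inner_product: "inner_product_on UNIV (cinner :: 'k::complex_hilbert_space \<Rightarrow> 'k \<Rightarrow> complex)"
proof
  fix x y :: 'k
  show "linear_on UNIV (cinner x)"
    by (rule linear_onI) (simp_all add: cinner_add_right cinner_scaleC_right)
  show "cinner x y = cnj (cinner y x)" by (rule cinner_commute)
  show "0 \<le> Re (cinner x x)" by (simp add: Re_cinner)
  assume "cinner x x = 0"
  then have "inner x x = 0" by (simp add: Re_cinner[symmetric])
  then show "x = 0" by simp
qed (rule complex_vector.subspace_UNIV)

lemma pairing_ray_n:
  fixes f :: "('a::finite, 'n::finite) gfun"
  assumes f: "f \<in> Lsp 1"
  shows "pairing (ray_n \<alpha>) f = moment 1 (\<lambda>k. f (Ray \<alpha> k))"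
proof -
  have "(\<Sum>\<^sub>\<infinity>k. cnj (ray_n \<alpha> (Ray \<alpha>' k :: ('a, 'n) vertex)) * f (Ray \<alpha>' k))
      = (if \<alpha>' = \<alpha> then moment 1 (\<lambda>k. f (Ray \<alpha> k)) else 0)" for \<alpha>'
    by (simp add: moment_def)
  then show ?thesis
    unfolding pairing_vertex[OF pairing_summable[OF ray_n_Ldual f]] by simp
qed

lemma pairing_uminus_left: "pairing (- u) w = - pairing u w"
  by (simp add: pairing_def infsum_uminus)

section \<open>The kernel and the pseudo-inverse of the threshold operator\<close>

context threshold
begin

abbreviation "M \<equiv> M0 E0 x0 v U"

lemma Ldual_1_b: "w \<in> Ldual 1 \<Longrightarrow> w \<in> Ldual (real b)"
  by (rule Ldual_mono(1)[rotated]) (use b4 in auto)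

lemma Ldual_1_s: "w \<in> Ldual 1 \<Longrightarrow> w \<in> Ldual (real b - 2)"
  by (rule Ldual_mono(1)[rotated]) (use b4 in auto)

lemma v_in': "t \<le> real b \<Longrightarrow> v g \<in> Lsp t"
  by (rule Lsp_mono[OF _ v_in])

lemma G00_v_in: "G00 E0 x0 (v g) \<in> Ldual (real b)"
  by (intro Ldual_1_b G00_Ldual v_in') simp

lemma G00_v_linear: "linear_on UNIV (\<lambda>g. G00 E0 x0 (v g))"
  by (rule linear_onI) (simp_all add: linear_on_add[OF v_linear] linear_on_scale[OF v_linear]
      linear_on_add[OF G00_linear[OF conn]] linear_on_scale[OF G00_linear[OF conn]] v_in')

lemma M_linear: "linear_on UNIV M"
  by (rule linear_onI) (simp_all add: M0_def linear_on_add[OF U_linear] linear_on_scale[OF U_linear]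
      linear_on_add[OF G00_v_linear] linear_on_scale[OF G00_v_linear]
      linear_on_add[OF adj_linear] linear_on_scale[OF adj_linear] G00_v_in complex_vector.scale_right_distrib)

lemma M_selfadjoint: "cinner (M f) g = cinner f (M g)"
proof -
  let ?A = "\<lambda>g. adj v (G00 E0 x0 (v g))"
  have "cinner (?A f) g = pairing (v f) (G00 E0 x0 (v g))"
    using b4 by (simp add: adj_eq[OF G00_v_in] G00_symmetric[OF conn] v_in')
  also have "\<dots> = cnj (cinner (?A g) f)"
    by (simp only: adj_eq[OF G00_v_in] pairing_commute[of "v f"])
  also have "\<dots> = cinner f (?A g)" by (rule cinner_commute[symmetric])
  finally have A: "cinner (?A f) g = cinner f (?A g)" .
  have "cinner (U f + ?A f) g = cnj (cinner g (U f + ?A f))" by (rule cinner_commute)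
  also have "\<dots> = cinner (U f) g + cinner (?A f) g"
    by (simp add: cinner_add_right cinner_commute[of "U f" g] cinner_commute[of "?A f" g])
  finally show ?thesis by (simp add: M0_def cinner_add_right U_sa A)
qed

text \<open>Write \<Phi> for \<open>G00 E0 x0 (v g)\<close>. The hypothesis says
  \<open>adj v \<Phi> = - U g\<close>, and as \<open>U\<close> is an involution this gives
  \<open>V \<Phi> = - v g\<close>, hence H \<Phi> = 0. The boundary value of \<open>G00\<close>
  cancels the potential term in \<open>growth\<close>, so \<Phi> is bound.\<close>

lemma kernel_bound_state:
  assumes "M g = 0"
  shows "G00 E0 x0 (v g) \<in> Eb"
proof -
  let ?\<Phi> = "G00 E0 x0 (v g)"
  have "adj v ?\<Phi> = - U g" using assms by (simp add: M0_def add_eq_0_iff)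
  then have V\<Phi>: "V ?\<Phi> = - v g"
    by (simp add: V_factor[OF G00_v_in] linear_on_uminus[OF U_linear] linear_on_uminus[OF v_linear] UU)
  have Et: "?\<Phi> \<in> Et"
    by (simp add: Et_iff G00_v_in V\<Phi> free_op_G00[OF conn v_in'])
  show ?thesis
  proof (rule Et_no_growth[OF Et])
    show "growth ?\<Phi> \<alpha> = 0" for \<alpha>
      by (simp add: growth_def G00_boundary V\<Phi> moment_def infsum_uminus)
  qed
qed

text \<open>The kernel embeds into the bound states by g -> \<open>G00 E0 x0 (v g)\<close>:
  \<open>free_op\<close> recovers \<open>v g\<close>, and \<open>v\<close> is injective. Finitely
  many evaluations therefore separate it, which yields a finite orthonormal basis and the orthogonal
  projection, although the surrounding Hilbert space may be infinite-dimensional.\<close>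

lemma kernel_projection:
  obtains g1 where "M g1 = 0" "\<And>n. M n = 0 \<Longrightarrow> cinner n (g - g1) = 0"
proof -
  interpret K: inner_product_on "UNIV :: 'k set" cinner by (rule cinner_inner_product)
  let ?N = "kernel_op M"
  have N: "complex_vector.subspace ?N"
    using linear_on_0[OF M_linear]
    by (auto simp: complex_vector.subspace_def kernel_op_def linear_on_add[OF M_linear] linear_on_scale[OF M_linear])
  have ipN: "inner_product_on ?N cinner"
    by (rule inner_product_on_subset[OF cinner_inner_product N]) simp
  interpret N: inner_product_on ?N cinner by (rule ipN)
  obtain I where I: "finite I" "\<And>\<Psi>. \<Psi> \<in> Eb \<Longrightarrow> (\<And>y. y \<in> I \<Longrightarrow> \<Psi> y = 0) \<Longrightarrow> \<Psi> = 0"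
    using Eb_separated by blast
  have "\<exists>B. N.orthonormal_basis B"
  proof (rule ex_orthonormal_basis[OF I(1) ipN, of "\<lambda>y g. G00 E0 x0 (v g) y"])
    show "linear_on ?N (\<lambda>g. G00 E0 x0 (v g) y)" for y
      by (rule linear_onI) (simp_all add: linear_on_add[OF G00_v_linear] linear_on_scale[OF G00_v_linear])
    fix g assume g: "g \<in> ?N" and z: "\<And>y. y \<in> I \<Longrightarrow> G00 E0 x0 (v g) y = 0"
    have "G00 E0 x0 (v g) = 0" using I(2)[OF kernel_bound_state z] g by (simp add: kernel_op_def)
    then have "v g = 0"
      using free_op_G00[OF conn v_in'[of 0 g], of x0] linear_on_0[OF free_op_linear[of E0 x0]] by simp
    then have "v g = v 0" using linear_on_0[OF v_linear] by simp
    then show "g = 0" by (rule injD[OF v_inj])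
  qed
  then obtain B where B: "N.orthonormal_basis B" by blast
  then have on: "K.orthonormal B" and BN: "B \<subseteq> ?N"
    by (auto simp: N.orthonormal_basis_def N.orthonormal_def K.orthonormal_def)
  define g1 where "g1 = K.proj B g"
  have "g1 \<in> ?N" unfolding g1_def K.proj_def by (rule subspace_sum_scale[OF N BN])
  moreover have "cinner n (g - g1) = 0" if n: "n \<in> ?N" for n
  proof -
    have "n = (\<Sum>b\<in>B. scaleC (cinner b n) b)" using B n by (simp add: N.orthonormal_basis_def N.proj_def)
    then have "cinner (g - g1) n = (\<Sum>b\<in>B. cinner b n * cinner (g - g1) b)"
      using K.ip_sum_right[of "g - g1" B "\<lambda>b. cinner b n"] by simp
    also have "\<dots> = 0"
    proof (intro sum.neutral ballI)
      fix c assume "c \<in> B"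
      then have "cinner c (g - g1) = 0" unfolding g1_def by (rule K.proj_orthogonal[OF on UNIV_I])
      then show "cinner c n * cinner (g - g1) c = 0" by (simp add: cinner_commute[of "g - g1" c])
    qed
    finally show ?thesis by (simp add: cinner_commute[of n])
  qed
  ultimately show thesis using that by (simp add: kernel_op_def)
qed

text \<open>At a value of \<open>M\<close> the description is met by the part of \<open>g\<close>
  orthogonal to the kernel, because self-adjointness makes the range of \<open>M\<close> orthogonal
  to the kernel.\<close>

lemma pseudo_inverse_M:
  assumes g1: "M g1 = 0" "\<And>n. M n = 0 \<Longrightarrow> cinner n (g - g1) = 0"
  shows "pseudo_inverse M (M g) = g - g1"
  unfolding pseudo_inverse_def
proof (rule the_equality)
  have diff: "M (x - y) = M x - M y" for x y
    by (rule linear_on_diff[OF complex_vector.subspace_UNIV M_linear]) auto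
  have cdiff: "cinner n (x - y) = cinner n x - cinner n y" for n x y :: 'k
    by (rule linear_on_diff[OF complex_vector.subspace_UNIV inner_product_on.ip_linear[OF cinner_inner_product]]) auto
  have range: "cinner n (M x) = 0" if "M n = 0" for n x
    using M_selfadjoint[of n x] that cinner_commute[of 0 x] inner_product_on.ip_linear[OF cinner_inner_product, of x]
      linear_on_0[of UNIV "cinner x"] by auto
  have Mg: "M (g - g1) = M g" by (simp add: diff g1(1))
  show "g - g1 \<in> orth_compl (kernel_op M) \<and> M (g - g1) \<in> orth_compl (kernel_op M) \<and> M g - M (g - g1) \<in> kernel_op M"
    using g1(2) range linear_on_0[OF M_linear] by (auto simp: Mg orth_compl_def kernel_op_def)
  fix g' assume g': "g' \<in> orth_compl (kernel_op M) \<and> M g' \<in> orth_compl (kernel_op M) \<and> M g - M g' \<in> kernel_op M"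
  \<comment> \<open>The difference lies both in the kernel and in the range, which are orthogonal,
    and is therefore zero.\<close>
  then have "M (M g - M g') = 0" by (simp add: kernel_op_def)
  then have "cinner (M g - M g') (M g - M g') = 0" using range[of "M g - M g'" "g - g'"] by (simp add: diff)
  then have "M g - M g' = 0" using inner_product_on.ip_definite[OF cinner_inner_product] by blast
  then have k: "M (g - g1 - g') = 0" by (simp add: diff g1(1))
  then have "cinner (g - g1 - g') (g - g1 - g') = 0"
    using g1(2)[OF k] g' by (simp add: cdiff[of _ _ g'] orth_compl_def kernel_op_def)
  then have "g - g1 - g' = 0" using inner_product_on.ip_definite[OF cinner_inner_product] by blast
  then show "g' = g - g1" by simp
qed

lemma bound_projection_unique:
  assumes B: "bound_basis E0 x0 V (real b) B" and f: "f \<in> Ldual (real b - 2)"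
    and \<Psi>: "\<Psi> \<in> Eb" "\<And>\<Phi>. \<Phi> \<in> Eb \<Longrightarrow> pairing \<Phi> \<Psi> = pairing \<Phi> f"
  shows "basis_projection B f = \<Psi>"
  by (rule inner_product_on.unique_by_ip[OF Eb_inner_product bound_projection_in[OF B] \<Psi>(1)])
    (simp add: bound_projection_pairing[OF B f] \<Psi>(2))

text \<open>The solution of \<open>M g = v\<^sup>* G\<^sub>0\<^sub>0 f\<close> is unique up to bound states, which the outer projection removes.\<close>

lemma constant_term_formula:
  assumes B: "bound_basis E0 x0 V (real b) B" and f: "f \<in> Lsp (real b - 2)"
    and w: "w \<in> Ldual (real b - 2)" "\<And>\<Phi>. \<Phi> \<in> Eb \<Longrightarrow> pairing \<Phi> w = 0"
    and eq: "w = G00 E0 x0 (f - V w)"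
  shows "w = compl_projection B (G00 E0 x0 f - G00 E0 x0 (v (pseudo_inverse M (adj v (G00 E0 x0 f)))))"
proof -
  have wb: "w \<in> Ldual (real b)" by (rule Ldual_mono(1)[OF _ w(1)]) simp
  have f0: "f \<in> Lsp 0" by (rule Lsp_mono[OF _ f]) (use b4 in simp)
  \<comment> \<open>As \<open>U\<close> is an involution, \<open>adj v w = U g\<close>. Applying the
    adjoint of \<open>v\<close> to the equation for \<open>w\<close> then gives
    \<open>M g = adj v (G00 E0 x0 f)\<close>.\<close>
  define g where "g = U (adj v w)"
  have Vw: "V w = v g" by (simp add: g_def V_factor[OF wb])
  have Gf: "G00 E0 x0 f = w + G00 E0 x0 (v g)"
    using eq linear_on_diff[OF subspace_Lsp G00_linear[OF conn] f0 v_in'[of 0 g], of x0] by (simp add: Vw)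
  have "M g = adj v w + adj v (G00 E0 x0 (v g))" by (simp add: M0_def g_def UU)
  also have "\<dots> = adj v (G00 E0 x0 f)" unfolding Gf by (rule linear_on_add[OF adj_linear wb G00_v_in, symmetric])
  finally have Mg: "M g = adj v (G00 E0 x0 f)" .
  obtain g1 where g1: "M g1 = 0" "\<And>n. M n = 0 \<Longrightarrow> cinner n (g - g1) = 0"
    using kernel_projection[of g] by blast
  \<comment> \<open>The pseudo-inverse returns \<open>g - g1\<close> instead of \<open>g\<close>,
    and this adds exactly ?\<Phi> to \<open>w\<close>.\<close>
  let ?\<Phi> = "G00 E0 x0 (v g1)"
  have \<Phi>: "?\<Phi> \<in> Eb" by (rule kernel_bound_state[OF g1(1)])
  have \<Phi>s: "?\<Phi> \<in> Ldual (real b - 2)" by (rule Et_Ldual[OF Eb_Et[OF \<Phi>]])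
  have pinv: "pseudo_inverse M (M g) = g - g1" by (rule pseudo_inverse_M) (use g1 in auto)
  have "G00 E0 x0 f - G00 E0 x0 (v (pseudo_inverse M (adj v (G00 E0 x0 f)))) = w + ?\<Phi>"
    unfolding Mg[symmetric] pinv
    using linear_on_diff[OF complex_vector.subspace_UNIV G00_v_linear, of g g1] by (simp add: Gf)
  moreover have "basis_projection B (w + ?\<Phi>) = ?\<Phi>"
  proof (rule bound_projection_unique[OF B _ \<Phi>])
    show "w + ?\<Phi> \<in> Ldual (real b - 2)" by (rule complex_vector.subspace_add[OF subspace_Ldual w(1) \<Phi>s])
    show "pairing \<Psi> ?\<Phi> = pairing \<Psi> (w + ?\<Phi>)" if "\<Psi> \<in> Eb" for \<Psi>
      by (simp add: linear_on_add[OF pairing_Eb_linear[OF that] w(1) \<Phi>s] w(2)[OF that])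
  qed
  ultimately show ?thesis by (simp add: compl_projection_def)
qed

end

section \<open>Identification of the first four coefficients\<close>

context threshold_expansion
begin

lemma coeff_in_b: "k \<le> b - 4 \<Longrightarrow> coeff k \<in> Ldual (real b)"
  by (rule Ldual_s_b[OF coeff_in])

lemma coeff_Et:
  assumes k: "k \<le> b - 4" "k \<noteq> 2" and prev: "k < 2 \<or> coeff (k - 2) = 0"
  shows "coeff k \<in> Et"
proof -
  have "H (coeff k) y = 0" for y using coeff_equation[OF k(1), of y] k(2) prev by (auto split: if_splits)
  then show ?thesis using coeff_in_b[OF k(1)] by (simp add: gen_eigenspace_def fun_eq_iff)
qed

lemma ray_moment_big_0: "ray_moment 1 \<alpha> \<in> big 0"
  using b6 by (intro expands_big_0[OF ray_moment_expands]) simp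

text \<open>At order zero the boundary formula reduces to minus the zeroth moment of
  \<open>V (coeff 0)\<close>, which is the statement that the growth vanishes.\<close>

lemma coeff_0_Eb: "coeff 0 \<in> Eb"
proof (rule Et_no_growth)
  show "coeff 0 \<in> Et" by (rule coeff_Et) auto
  show "growth (coeff 0) \<alpha> = 0" for \<alpha>
    using boundary_coefficients[OF ray_moment_big_0, of 0 \<alpha>] b6 by (simp add: growth_def ray_coeff_def)
qed

lemma coeff_0_moment: "ray_coeff 1 \<alpha> 0 = 0"
  using Eb_moment[OF coeff_0_Eb, of \<alpha>] by (simp add: ray_coeff_def)

lemma coeff_0_projection: "bound_basis E0 x0 V (real b) B \<Longrightarrow> basis_projection B u = coeff 0"
  using b6 by (intro bound_projection_unique Lsp_sub_Ldual[OF u] coeff_0_Eb) (auto simp: coeff_bound_pairing)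

text \<open>Its growth is minus the leading first moment, zero by \<open>coeff_0_moment\<close>, so
  it is a bound state; yet it is orthogonal to all bound states, hence to itself.\<close>

lemma coeff_1_zero: "coeff 1 = 0"
proof (rule inner_product_on.ip_definite[OF Eb_inner_product])
  show E: "coeff 1 \<in> Eb"
  proof (rule Et_no_growth)
    show "coeff 1 \<in> Et" using b6 by (intro coeff_Et) auto
    show "growth (coeff 1) \<alpha> = 0" for \<alpha>
      using boundary_coefficients[OF ray_moment_big_0, of 1 \<alpha>] b6 coeff_0_moment[of \<alpha>]
      by (simp add: growth_def ray_coeff_def)
  qed
  show "pairing (coeff 1) (coeff 1) = 0" using coeff_bound_pairing[OF E, of 1] b6 by simp
qed

lemma V_coeff_1: "V (coeff 1) = 0"
  unfolding coeff_1_zero by (rule linear_on_0[OF V_linear complex_vector.subspace_0[OF subspace_Ldual]])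

lemma moment_zero: "moment i (\<lambda>k. 0) = 0"
  by (simp add: moment_def)

text \<open>Right-hand side of the free equation for \<open>coeff 2\<close>, from the \<kappa>^2
  coefficient of the resolvent equation with the potential moved over.\<close>

definition source :: "('a, 'n) gfun" where "source = u - coeff 0 - V (coeff 2)"

lemma V_coeff_2_in: "V (coeff 2) \<in> Lsp s"
  using b6 by (intro V_in' coeff_in_b s_le) simp

lemma coeff_0_in: "coeff 0 \<in> Lsp s" by (rule Eb_Lsp[OF coeff_0_Eb])

lemma source_in: "source \<in> Lsp s"
  unfolding source_def by (intro complex_vector.subspace_diff[OF subspace_Lsp] u coeff_0_in V_coeff_2_in)

lemma source_moment:
  assumes "i \<le> b - 2"
  shows "moment i (\<lambda>k. source (Ray \<alpha> k)) = moment i (\<lambda>k. u (Ray \<alpha> k)) - moment i (\<lambda>k. coeff 0 (Ray \<alpha> k))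
    - moment i (\<lambda>k. V (coeff 2) (Ray \<alpha> k))"
proof -
  note lin = moment_linear[OF assms, of \<alpha>] and in' = u coeff_0_in V_coeff_2_in
  note in'' = in'[unfolded b2(1)]
  show ?thesis
    unfolding source_def
    by (simp only: linear_on_diff[OF subspace_Lsp lin complex_vector.subspace_diff[OF subspace_Lsp in''(1,2)] in''(3)]
        linear_on_diff[OF subspace_Lsp lin in''(1,2)])
qed

text \<open>\<open>coeff 0\<close> is the tail of \<open>V (coeff 0)\<close> on each half-line, and
  for a bound state the first moment in \<open>moment_0_tail\<close> and
  \<open>moment_1_tail\<close> drops out.\<close>

lemma
  shows coeff_0_moment_0: "2 * moment 0 (\<lambda>k. coeff 0 (Ray \<alpha> k)) = moment 2 (\<lambda>k. V (coeff 0) (Ray \<alpha> k))"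
    and coeff_0_moment_1: "6 * moment 1 (\<lambda>k. coeff 0 (Ray \<alpha> k)) = moment 3 (\<lambda>k. V (coeff 0) (Ray \<alpha> k))"
proof -
  let ?f = "\<lambda>k. V (coeff 0) (Ray \<alpha> k)"
  have f: "moment_summable b ?f" by (intro V_moment coeff_in_b) simp
  have e: "(\<lambda>k. coeff 0 (Ray \<alpha> k)) = tail ?f" using Eb_tail[OF coeff_0_Eb] by auto
  show "2 * moment 0 (\<lambda>k. coeff 0 (Ray \<alpha> k)) = moment 2 ?f"
    using moment_0_tail[OF moment_summable_mono[OF f, of 2]] b6 Eb_moment[OF coeff_0_Eb, of \<alpha>] unfolding e by simp
  show "6 * moment 1 (\<lambda>k. coeff 0 (Ray \<alpha> k)) = moment 3 ?f"
    using moment_1_tail[OF moment_summable_mono[OF f, of 3]] b6 Eb_moment[OF coeff_0_Eb, of \<alpha>] unfolding e by simp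
qed

text \<open>At order \<kappa>^2 the Taylor term, minus half the second moment of
  \<open>V (coeff 0)\<close>, equals minus the zeroth moment of \<open>coeff 0\<close>. Thus the
  boundary value is the zeroth moment of \<open>source\<close>, and no linear growth is
  left.\<close>

lemma coeff_2_eq: "coeff 2 = G00 E0 x0 source"
proof (rule G00_unique[OF conn])
  show "source \<in> Lsp 0" by (rule Lsp_mono[OF s_nonneg source_in])
  have "free_op E0 x0 (coeff 2) y = source y" for y
    using coeff_equation[of 2 y] b6 by (simp add: full_op_def source_def algebra_simps)
  then show "free_op E0 x0 (coeff 2) = source" by auto
  fix \<alpha>
  have "coeff 2 (Ray \<alpha> 0) = ray_coeff 0 \<alpha> 2 - ray_coeff 1 \<alpha> 1 + 1/2 * ray_coeff 2 \<alpha> 0"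
    using boundary_coefficients[OF ray_moment_big_0, of 2 \<alpha>] b6 by (simp add: numeral_2_eq_2)
  then show "coeff 2 (Ray \<alpha> 0) = moment 0 (\<lambda>k. source (Ray \<alpha> k))"
    using coeff_0_moment_0[of \<alpha>, symmetric] source_moment[of 0 \<alpha>] V_coeff_1
    by (simp add: ray_coeff_def moment_zero)
qed

lemma G_0_formula:
  assumes B: "bound_basis E0 x0 V (real b) B"
  shows "G 0 u = compl_projection B ((\<lambda>w. G00 E0 x0 w - G00 E0 x0 (v (pseudo_inverse (M0 E0 x0 v U) (adj v (G00 E0 x0 w)))))
    (compl_projection B u))"
proof -
  have cp: "compl_projection B u = u - coeff 0" by (simp add: compl_projection_def coeff_0_projection[OF B])
  have "coeff 2 = compl_projection B (G00 E0 x0 (u - coeff 0)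
      - G00 E0 x0 (v (pseudo_inverse M (adj v (G00 E0 x0 (u - coeff 0))))))"
  proof (rule constant_term_formula[OF B])
    show "u - coeff 0 \<in> Lsp s" by (intro complex_vector.subspace_diff[OF subspace_Lsp] u coeff_0_in)
    show "coeff 2 \<in> Ldual s" using b6 by (intro coeff_in) simp
    show "pairing \<Phi> (coeff 2) = 0" if "\<Phi> \<in> Eb" for \<Phi>
      using coeff_bound_pairing[OF that, of 2] b6 by simp
    show "coeff 2 = G00 E0 x0 (u - coeff 0 - V (coeff 2))"
      using coeff_2_eq unfolding source_def .
  qed
  then show ?thesis unfolding cp by (simp add: coeff_def)
qed

lemma coeff_3_Wt:
  assumes b7: "7 \<le> b"
  shows "coeff 3 \<in> Wt"
proof -
  have "coeff 3 \<in> Et" using b7 coeff_1_zero by (intro coeff_Et) auto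
  then show ?thesis using coeff_bound_pairing[of _ 3] b7 by (auto simp: Wt_def)
qed

text \<open>Here the boundary formula is needed with r = 1. The term with the third moment of
  \<open>V (coeff 0)\<close> over 6 becomes the first moment of \<open>coeff 0\<close>, the missing
  part of the first moment of \<open>source\<close>.\<close>

lemma coeff_3_growth:
  assumes b7: "7 \<le> b"
  shows "growth (coeff 3) \<alpha> = - moment 1 (\<lambda>k. source (Ray \<alpha> k))"
proof -
  have "ray_moment 1 \<alpha> \<in> big 1"
    using b6 by (intro expands_big_1[OF ray_moment_expands] coeff_0_moment) simp
  then have "coeff 3 (Ray \<alpha> 0) = ray_coeff 0 \<alpha> 3 - ray_coeff 1 \<alpha> 2 + 1/2 * ray_coeff 2 \<alpha> 1 - 1/6 * ray_coeff 3 \<alpha> 0"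
    using boundary_coefficients[of \<alpha> 1 3] b7 by (simp add: numeral_2_eq_2 numeral_3_eq_3)
  then show ?thesis
    using coeff_0_moment_1[of \<alpha>, symmetric] source_moment[of 1 \<alpha>] V_coeff_1 b6
    by (simp add: ray_coeff_def moment_zero growth_def)
qed

text \<open>Green's identity: \<Phi> is \<open>G00\<close> of minus its potential term plus linear
  functions. Symmetry of \<open>G00\<close> and of \<open>V\<close> makes the first part cancel the
  pairing of \<Phi> with \<open>V (coeff 2)\<close>, the linear functions give first moments of
  \<open>source\<close>, and \<open>coeff 0\<close> is orthogonal to \<Phi>.\<close>

lemma pairing_Wt_u:
  assumes \<Phi>: "\<Phi> \<in> Wt"
  shows "pairing \<Phi> u = (\<Sum>\<alpha>\<in>UNIV. cnj (growth \<Phi> \<alpha>) * moment 1 (\<lambda>k. source (Ray \<alpha> k)))"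
proof -
  have E: "\<Phi> \<in> Et" by (rule Wt_Et[OF \<Phi>])
  have \<Phi>s: "\<Phi> \<in> Ldual s" by (rule Et_Ldual[OF E])
  have \<Phi>b: "\<Phi> \<in> Ldual (real b)" by (rule Et_Ldual_b[OF E])
  have w: "coeff 2 \<in> Ldual (real b)" using b6 by (intro coeff_in_b) simp
  define g where "g = - V \<Phi>"
  have g: "g \<in> Lsp 1" "g \<in> Lsp 0"
    unfolding g_def using b6 by (auto intro!: complex_vector.subspace_neg[OF subspace_Lsp] V_in' \<Phi>b)
  have F1: "source \<in> Lsp 1" by (rule Lsp_mono[OF _ source_in]) (use b6 in simp)
  have rep: "\<Phi> = G00 E0 x0 g + (\<Sum>\<alpha>\<in>UNIV. scaleC (growth \<Phi> \<alpha>) (ray_n \<alpha>))"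
    unfolding g_def by (rule Et_representation[OF E])
  have n_in: "scaleC c (ray_n \<alpha>) \<in> Ldual s" for c \<alpha>
    by (intro complex_vector.subspace_scale[OF subspace_Ldual] Ldual_1_s ray_n_Ldual)
  note lin = pairing_linear'[OF source_in]
  have "pairing source \<Phi> = pairing source (G00 E0 x0 g) + (\<Sum>\<alpha>\<in>UNIV. pairing source (scaleC (growth \<Phi> \<alpha>) (ray_n \<alpha>)))"
    by (subst rep, subst linear_on_add[OF lin], (intro Ldual_1_s G00_Ldual g ray_n_sum_Ldual)+,
        subst linear_on_sum[OF subspace_Ldual lin n_in]) simp_all
  also have "\<dots> = pairing source (G00 E0 x0 g) + (\<Sum>\<alpha>\<in>UNIV. growth \<Phi> \<alpha> * pairing source (ray_n \<alpha>))"
    by (simp add: linear_on_scale[OF lin Ldual_1_s[OF ray_n_Ldual]])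
  finally have ps: "pairing source \<Phi> = pairing source (G00 E0 x0 g) + (\<Sum>\<alpha>\<in>UNIV. growth \<Phi> \<alpha> * pairing source (ray_n \<alpha>))" .
  have "pairing \<Phi> source = cnj (pairing source \<Phi>)" by (rule pairing_commute)
  also have "\<dots> = pairing (G00 E0 x0 g) source + (\<Sum>\<alpha>\<in>UNIV. cnj (growth \<Phi> \<alpha>) * pairing (ray_n \<alpha>) source)"
    unfolding ps by (simp add: pairing_commute[of "G00 E0 x0 g" source] pairing_commute[of "ray_n _" source])
  also have "pairing (G00 E0 x0 g) source = pairing g (coeff 2)"
    unfolding coeff_2_eq by (rule G00_symmetric[OF conn F1 g(1)])
  also have "pairing g (coeff 2) = - pairing \<Phi> (V (coeff 2))"
    unfolding g_def pairing_uminus_left V_dual_symmetric[OF \<Phi>b w] ..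
  finally have 1: "pairing \<Phi> source + pairing \<Phi> (V (coeff 2))
      = (\<Sum>\<alpha>\<in>UNIV. cnj (growth \<Phi> \<alpha>) * moment 1 (\<lambda>k. source (Ray \<alpha> k)))"
    by (simp add: pairing_ray_n[OF F1])
  have "pairing (coeff 0) \<Phi> = 0" using \<Phi> coeff_0_Eb by (simp add: Wt_def)
  then have 2: "pairing \<Phi> (coeff 0) = 0" by (simp add: pairing_commute[of \<Phi>])
  note lin' = pairing_linear[OF \<Phi>s]
  have "u = source + V (coeff 2) + coeff 0" by (simp add: source_def)
  then have "pairing \<Phi> u = pairing \<Phi> (source + V (coeff 2) + coeff 0)" by simp
  also have "\<dots> = pairing \<Phi> source + pairing \<Phi> (V (coeff 2)) + pairing \<Phi> (coeff 0)"
    by (simp only: linear_on_add[OF lin' complex_vector.subspace_add[OF subspace_Lsp source_in V_coeff_2_in] coeff_0_in]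
        linear_on_add[OF lin' source_in V_coeff_2_in])
  finally show ?thesis using 1 2 by simp
qed

lemma G_1_formula:
  assumes b7: "7 \<le> b" and B: "nonresonance_basis E0 x0 V (real b) B"
  shows "G 1 u = - basis_projection B u"
proof -
  have W: "coeff 3 \<in> Wt" by (rule coeff_3_Wt[OF b7])
  have "basis_projection B u = - coeff 3"
  proof (rule nonresonance_projection_unique[OF B u])
    show "- coeff 3 \<in> Wt" by (rule complex_vector.subspace_neg[OF subspace_Wt W])
    fix \<Phi> assume \<Phi>: "\<Phi> \<in> Wt"
    have "growth_ip \<Phi> (- coeff 3) = - growth_ip \<Phi> (coeff 3)"
      by (rule linear_on_uminus[OF inner_product_on.ip_linear[OF Wt_inner_product \<Phi>] W])
    also have "\<dots> = pairing \<Phi> u"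
      by (simp add: growth_ip_def coeff_3_growth[OF b7] pairing_Wt_u[OF \<Phi>] sum_negf)
    finally show "growth_ip \<Phi> (- coeff 3) = pairing \<Phi> u" .
  qed
  then show ?thesis by (simp add: coeff_def)
qed

end

theorem theoremB6:
  fixes E0 :: "'a::finite set set"
    and x0 :: "'n::finite \<Rightarrow> 'a"
    and V :: "('a, 'n) gfun \<Rightarrow> ('a, 'n) gfun"
    and v :: "'k::complex_hilbert_space \<Rightarrow> ('a, 'n) gfun"
    and U :: "'k \<Rightarrow> 'k"
    and \<beta> :: int
    and G :: "int \<Rightarrow> ('a, 'n) gfun \<Rightarrow> ('a, 'n) gfun"
  assumes "connected_simple_graph E0"
    and "\<beta> \<ge> 4"
    and "assumption_A (of_int \<beta>) V v U"
    and "res_eigenspace E0 x0 V (of_int \<beta>) = bound_eigenspace E0 x0 V (of_int \<beta>)"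
    and "{0} \<subset> bound_eigenspace E0 x0 V (of_int \<beta>)"
    and "resolvent_expansion (of_int \<beta> - 2) (full_op E0 x0 V) (- 2) (\<beta> - 6) G"
  shows "(\<exists>B. bound_basis E0 x0 V (of_int \<beta>) B) \<and>
    (\<exists>B. nonresonance_basis E0 x0 V (of_int \<beta>) B) \<and>
    (\<forall>B B'. nonresonance_basis E0 x0 V (of_int \<beta>) B \<longrightarrow>
       nonresonance_basis E0 x0 V (of_int \<beta>) B' \<longrightarrow>
       (\<forall>u\<in>Lsp (of_int \<beta> - 2). basis_projection B u = basis_projection B' u)) \<and>
    (0 \<le> \<beta> - 6 \<longrightarrow>
       (\<forall>B. bound_basis E0 x0 V (of_int \<beta>) B \<longrightarrow>
         (\<forall>u\<in>Lsp (of_int \<beta> - 2).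
           G 0 u = compl_projection B
             ((\<lambda>w. G00 E0 x0 w -
                 G00 E0 x0 (v (pseudo_inverse (M0 E0 x0 v U) (adj v (G00 E0 x0 w)))))
               (compl_projection B u))))) \<and>
    (1 \<le> \<beta> - 6 \<longrightarrow>
       (\<forall>B. nonresonance_basis E0 x0 V (of_int \<beta>) B \<longrightarrow>
         (\<forall>u\<in>Lsp (of_int \<beta> - 2). G 1 u = - basis_projection B u)))"
proof -
  define b where "b = nat \<beta>"
  have \<beta>: "\<beta> = int b" using assms(2) by (simp add: b_def)
  then have r: "of_int \<beta> = real b" by simp
  interpret threshold E0 x0 V v U b
    by unfold_locales (use assms \<beta> in auto)
  \<comment> \<open>The expansion locale needs an exponent of at least 6, which is exactly the case
    in which the coefficient with index 0 occurs.\<close>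
  have ex: "threshold_expansion E0 x0 V v U b G u" if "0 \<le> \<beta> - 6" "u \<in> Lsp (real b - 2)" for u
    by unfold_locales (use assms(6) that \<beta> in auto)
  show ?thesis
    unfolding r
  proof (intro conjI allI impI ballI)
    show "\<exists>B. bound_basis E0 x0 V (real b) B" by (rule ex_bound_basis)
    show "\<exists>B. nonresonance_basis E0 x0 V (real b) B" by (rule ex_nonresonance_basis)
    show "basis_projection B u = basis_projection B' u"
      if "nonresonance_basis E0 x0 V (real b) B" "nonresonance_basis E0 x0 V (real b) B'" "u \<in> Lsp (real b - 2)"
      for B B' u
      using that by (rule nonresonance_projection_independent)
    show "G 0 u = compl_projection B
             ((\<lambda>w. G00 E0 x0 w -
                 G00 E0 x0 (v (pseudo_inverse (M0 E0 x0 v U) (adj v (G00 E0 x0 w)))))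
               (compl_projection B u))"
      if "0 \<le> \<beta> - 6" "bound_basis E0 x0 V (real b) B" "u \<in> Lsp (real b - 2)" for B u
      by (rule threshold_expansion.G_0_formula[OF ex[OF that(1,3)] that(2)])
    show "G 1 u = - basis_projection B u"
      if "1 \<le> \<beta> - 6" "nonresonance_basis E0 x0 V (real b) B" "u \<in> Lsp (real b - 2)" for B u
      by (rule threshold_expansion.G_1_formula[OF ex[OF _ that(3)] _ that(2)]) (use that(1) \<beta> in auto)
  qed
qed

end
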